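(* Let $m \ge 2$ and let $F_m$ be the free group of rank $m$. For every $n \ge 2$ there exists a $C$-test word $v_n(x_1, \dots, x_n)$ in $n$ letters for $F_m$ with the additional property that, for $X_1,\dots,X_n \in F_m$, $v_n(X_1, \dots, X_n) = 1$ if and only if the subgroup $\langle X_1, \dots, X_n \rangle$ of $F_m$ generated by $X_1, \dots, X_n$ is cyclic.
   Context: A non-empty word $v(x_1,\dots,x_n)$ (a group word in the letters $x_1,\dots,x_n$ and their inverses) is a $C$-test word in $n$ letters for $F_m$ if for any two $n$-tuples $(X_1,\dots,X_n)$, $(Y_1,\dots,Y_n)$ of elements of $F_m$ the equality $v(X_1,\dots,X_n) = v(Y_1,\dots,Y_n) \neq 1$ (in $F_m$) implies the existence of an element $S \in F_m$ such that $Y_i = S X_i S^{-1}$ for all $i = 1, 2, \dots, n$. Here $v(X_1,\dots,X_n)$ denotes the element of $F_m$ obtained by substituting $X_i$ for $x_i$. The trivial subgroup is cyclic. *)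

theory Defs
  imports "HOL-Algebra.Elementary_Groups"
begin

text \<open>A group word over a set of letters is a list of pairs: \<open>(a, True)\<close> stands for the letter
  \<open>a\<close> and \<open>(a, False)\<close> for its formal inverse. Words need not be reduced.\<close>

type_synonym 'a group_word = "('a \<times> bool) list"

definition group_words :: "'a set \<Rightarrow> 'a group_word set" where
  "group_words A = lists (A \<times> UNIV)"

fun inv_letter :: "'a \<times> bool \<Rightarrow> 'a \<times> bool" where
  "inv_letter (a, b) = (a, \<not> b)"

definition reduced :: "'a group_word \<Rightarrow> bool" where
  "reduced w \<longleftrightarrow> successively (\<lambda>x y. y \<noteq> inv_letter x) w"

fun cancel_Cons :: "'a \<times> bool \<Rightarrow> 'a group_word \<Rightarrow> 'a group_word" where
  "cancel_Cons x [] = [x]"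
| "cancel_Cons x (y # ys) = (if y = inv_letter x then ys else x # y # ys)"

definition reduce :: "'a group_word \<Rightarrow> 'a group_word" where
  "reduce w = foldr cancel_Cons w []"

definition free_group :: "'a set \<Rightarrow> 'a group_word monoid" where
  "free_group A =
     \<lparr>carrier = {w \<in> group_words A. reduced w}, mult = (\<lambda>u v. reduce (u @ v)), one = []\<rparr>"

text \<open>The value \<open>v(X\<^sub>1, \<dots>, X\<^sub>n)\<close> of a word under substitution of group elements for its letters.\<close>

fun word_value :: "('g, 'b) monoid_scheme \<Rightarrow> ('a \<Rightarrow> 'g) \<Rightarrow> 'a group_word \<Rightarrow> 'g" where
  "word_value G X [] = \<one>\<^bsub>G\<^esub>"
| "word_value G X ((a, b) # w) = (if b then X a else inv\<^bsub>G\<^esub> (X a)) \<otimes>\<^bsub>G\<^esub> word_value G X w"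

text \<open>An \<open>n\<close>-tuple is a function on indices of which only the values on \<open>{1..n}\<close> matter.\<close>

definition C_test_word :: "('g, 'b) monoid_scheme \<Rightarrow> nat \<Rightarrow> nat group_word \<Rightarrow> bool" where
  "C_test_word G n v \<longleftrightarrow>
     v \<noteq> [] \<and> v \<in> group_words {1..n} \<and>
     (\<forall>X \<in> {1..n} \<rightarrow> carrier G. \<forall>Y \<in> {1..n} \<rightarrow> carrier G.
        word_value G X v = word_value G Y v \<and> word_value G Y v \<noteq> \<one>\<^bsub>G\<^esub> \<longrightarrow>
        (\<exists>S \<in> carrier G. \<forall>i \<in> {1..n}. Y i = S \<otimes>\<^bsub>G\<^esub> X i \<otimes>\<^bsub>G\<^esub> inv\<^bsub>G\<^esub> S))"


lemma inv_letter_inv_letter [simp]: "inv_letter (inv_letter x) = x"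
  by (cases x) simp

lemma reduced_Nil [simp]: "reduced []"
  by (simp add: reduced_def)

lemma reduced_Cons: "reduced (x # w) \<longleftrightarrow> w = [] \<or> hd w \<noteq> inv_letter x \<and> reduced w"
  by (auto simp: reduced_def successively_Cons)

lemma reduced_cancel_Cons: "reduced w \<Longrightarrow> reduced (cancel_Cons x w)"
  by (cases w) (auto simp: reduced_Cons)

lemma reduced_reduce: "reduced (reduce w)"
  by (induction w) (auto simp: reduce_def reduced_cancel_Cons)

lemma cancel_Cons_inv_letter:
  assumes "reduced w"
  shows "cancel_Cons x (cancel_Cons (inv_letter x) w) = w"
proof (cases w)
  case (Cons y ys)
  then show ?thesis
    using assms by (cases ys) (auto simp: reduced_Cons)
qed simp

lemma reduce_Nil [simp]: "reduce [] = []"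
  by (simp add: reduce_def)

lemma reduce_Cons: "reduce (x # w) = cancel_Cons x (reduce w)"
  by (simp add: reduce_def)

lemma reduce_cancel_Cons_append: "reduce (cancel_Cons x u @ v) = cancel_Cons x (reduce (u @ v))"
proof (cases u)
  case (Cons y ys)
  show ?thesis
  proof (cases "y = inv_letter x")
    case True
    then show ?thesis
      using Cons cancel_Cons_inv_letter[OF reduced_reduce, of x "ys @ v"]
      by (simp add: reduce_Cons)
  next
    case False
    then show ?thesis
      using Cons by (simp add: reduce_Cons)
  qed
qed (simp add: reduce_Cons)

lemma reduce_reduce_append_left: "reduce (reduce u @ v) = reduce (u @ v)"
  by (induction u) (simp_all add: reduce_Cons reduce_cancel_Cons_append)

lemma reduce_id: "reduced w \<Longrightarrow> reduce w = w"
proof (induction w)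
  case (Cons x w)
  then show ?case
    by (cases w) (auto simp: reduced_Cons reduce_Cons)
qed simp

lemma reduce_reduce_append_right: "reduce (u @ reduce v) = reduce (u @ v)"
  by (induction u) (simp_all add: reduce_Cons reduce_id reduced_reduce)

lemma cancel_Cons_in_group_words:
  "fst x \<in> A \<Longrightarrow> w \<in> group_words A \<Longrightarrow> cancel_Cons x w \<in> group_words A"
  by (cases w; cases x) (auto simp: group_words_def)

lemma reduce_in_group_words: "w \<in> group_words A \<Longrightarrow> reduce w \<in> group_words A"
proof (induction w)
  case (Cons x w)
  then show ?case
    using cancel_Cons_in_group_words[of x A "reduce w"]
    by (auto simp: group_words_def reduce_Cons)
qed simp

lemma reduce_inverse_word: "reduce (rev (map inv_letter w) @ w) = []"
proof (induction w)
  case (Cons x w)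
  have "reduce (u @ inv_letter x # x # w) = reduce (u @ w)" for u
    using cancel_Cons_inv_letter[OF reduced_reduce, of "inv_letter x" w]
    by (induction u) (simp_all add: reduce_Cons)
  then show ?case
    using Cons by simp
qed simp

theorem group_free_group: "group (free_group A)"
proof (rule groupI)
  show "\<exists>u \<in> carrier (free_group A). u \<otimes>\<^bsub>free_group A\<^esub> w = \<one>\<^bsub>free_group A\<^esub>"
    if w: "w \<in> carrier (free_group A)" for w
  proof
    have "rev (map inv_letter w) \<in> group_words A"
      using w by (fastforce simp: free_group_def group_words_def)
    then show "reduce (rev (map inv_letter w)) \<in> carrier (free_group A)"
      by (simp add: free_group_def reduced_reduce reduce_in_group_words)
    show "reduce (rev (map inv_letter w)) \<otimes>\<^bsub>free_group A\<^esub> w = \<one>\<^bsub>free_group A\<^esub>"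
      by (simp add: free_group_def reduce_reduce_append_left reduce_inverse_word)
  qed
  show "u \<otimes>\<^bsub>free_group A\<^esub> v \<in> carrier (free_group A)"
    if "u \<in> carrier (free_group A)" "v \<in> carrier (free_group A)" for u v
    using that reduce_in_group_words[of "u @ v" A]
    by (simp add: free_group_def reduced_reduce group_words_def)
qed (auto simp: free_group_def group_words_def reduce_id
       reduce_reduce_append_left reduce_reduce_append_right)

end

theory Submission
  imports Defs
begin

text \<open>A free group acts freely on its Cayley tree, so every \<open>g \<noteq> 1\<close> translates an axis by its translation length
\<open>tlen g\<close>. Everything below rests on one rigidity property: two elements that both move each of two far
apart points only a little commute (\<open>small_displacement_commute\<close>). Commuting is transitive on
non-trivial elements, roots of commuting elements commute, and an element that conjugates \<open>u\<close> to something
commuting with \<open>u\<close> commutes with \<open>u\<close>; these facts follow from it as well.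

The test word has the form \<open>v = u^N\<^sub>1 a\<^sub>1 u^N\<^sub>2 a\<^sub>2 \<dots> u^N\<^sub>k a\<^sub>k\<close> with \<open>N\<^sub>1 \<gg> N\<^sub>2 \<gg> \<dots> \<gg> N\<^sub>k\<close>, where \<open>u\<close> and
the \<open>a\<^sub>j\<close> are themselves words in the letters. Suppose that for every tuple generating a non-cyclic group, at
some point of the axis of \<open>u\<close> the displacements of all \<open>a\<^sub>j\<close> are at most \<open>C\<close> times \<open>tlen u\<close>, and that no
\<open>a\<^sub>j\<close> commutes with \<open>u\<close> (the predicate \<open>frame\<close>). Then the axis of the value \<open>W\<close> of \<open>v\<close> runs along \<open>Axis(u)\<close> for most of
a period, leaves it at a definite place, runs along \<open>u^N\<^sub>1 a\<^sub>1 Axis(u)\<close>, and so on. If a second tuple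
gives the same \<open>W\<close>, then, after conjugation by a power of \<open>W\<close>, the two longest stretches overlap in roughly half a
period or more, hence \<open>u\<close> and \<open>u'\<close> commute (\<open>overlap_commute\<close>); the places where the axis turns then
have to agree (\<open>frames_close\<close>), and the following stretches coincide one after the other (\<open>unpeel\<close>).
This gives \<open>a\<^sub>j' = c\<^sub>j a\<^sub>j d\<^sub>j\<^sup>-\<^sup>1\<close> with \<open>c\<^sub>j, d\<^sub>j\<close> in the centralizer of \<open>u\<close>. Using each word three times in a row
forces \<open>u' = u\<close> and all \<open>c\<^sub>j\<close>, \<open>d\<^sub>j\<close> to be trivial (\<open>related_triples\<close>), which is \<open>zig_rigid\<close>.

It remains to find \<open>u\<close> and the \<open>a\<^sub>j\<close>. If \<open>k\<close> and \<open>x\<close> do not commute, then the commutator \<open>c\<close> of \<open>k^7\<close> and \<open>x^7\<close>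
dominates both: at some point both have displacement at most \<open>tlen c\<close> (\<open>pcomm_dominates\<close>). Starting with two
letters that do not commute, and absorbing the other letters one after the other (\<open>absorb_letter\<close>), one obtains
a word that dominates all letters. There is one such word for each pair of
letters, trivial when these letters commute; since each is trivial or dominates all
the others, a product of rapidly decreasing powers of them behaves like its first non-trivial factor
(\<open>select_nontrivial\<close>). The result \<open>U\<close>, a similarly built word \<open>V\<close> that does not commute with \<open>U\<close>, and
\<open>u = V^n U\<close> then satisfy, on non-cyclic tuples: no non-trivial value of a word that is short compared with \<open>n\<close> commutes with \<open>u\<close>. Taking
for the \<open>a\<^sub>j\<close> the words \<open>V\<close>, \<open>U\<close>, \<open>x\<^sub>i V x\<^sub>i\<^sup>-\<^sup>1\<close> and \<open>x\<^sub>i U x\<^sub>i\<^sup>-\<^sup>1\<close>, which are never trivial on a non-cyclic tuple and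
which determine the \<open>x\<^sub>i\<close>, finishes the construction (\<open>frame_words\<close>).\<close>

section \<open>Groups acting freely on trees\<close>

text \<open>The function \<open>len\<close> plays the role of the distance by which \<open>x\<close> moves a base vertex of a simplicial tree on which
the group acts freely, with the group elements as vertices. The axioms are: the four-point inequality that characterises
trees, existence of vertices on geodesics, the bipartite structure of a tree, and, for every \<open>x\<close>, a vertex on the axis of \<open>x\<close>.\<close>


class tree_group = monoid_mult +
  fixes iv :: "'a \<Rightarrow> 'a" and len :: "'a \<Rightarrow> int"
  assumes iv_left: "iv x * x = 1"
    and len_eq_0_iff: "len x = 0 \<longleftrightarrow> x = 1"
    and len_iv: "len (iv x) = len x"
    and len_four: "len (iv x * y) + len (iv z * w) \<le>
          max (len (iv x * z) + len (iv y * w)) (len (iv x * w) + len (iv y * z))"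
    and len_between: "0 \<le> i \<Longrightarrow> i \<le> len x \<Longrightarrow> \<exists>y. len y = i \<and> len (iv y * x) = len x - i"
    and len_parity: "even (len x + len y + len (x * y))"
    and len_axis: "\<exists>q. \<forall>n. len (iv q * x ^ n * q) = int n * len (iv q * x * q)"

lemma iv_right: "(x::'a::tree_group) * iv x = 1"
proof -
  have "x * iv x = iv (iv x) * iv x * (x * iv x)" by (simp add: iv_left)
  also have "\<dots> = iv (iv x) * (iv x * x) * iv x" by (simp add: mult.assoc)
  also have "\<dots> = 1" by (simp add: iv_left)
  finally show ?thesis .
qed

lemma iv_cancel [simp]:
  fixes x y :: "'a::tree_group"
  shows "iv x * (x * y) = y" "x * (iv x * y) = y"
  by (simp_all add: mult.assoc[symmetric] iv_left iv_right)

lemma iv_unique: "(x::'a::tree_group) * y = 1 \<Longrightarrow> iv x = y"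
  by (metis iv_cancel(1) mult_1_right)

lemma iv_simps [simp]:
  fixes x y :: "'a::tree_group"
  shows "iv x * x = 1" "x * iv x = 1" "iv (iv x) = x" "iv 1 = (1::'a)" "iv (x * y) = iv y * iv x"
proof -
  show "iv x * x = 1" "x * iv x = 1" by (rule iv_left iv_right)+
  show "iv (iv x) = x" by (rule iv_unique) (rule iv_left)
  show "iv 1 = (1::'a)" by (rule iv_unique) simp
  show "iv (x * y) = iv y * iv x"
    by (rule iv_unique) (simp add: mult.assoc iv_right)
qed

lemma cancel_left [simp]: "(x::'a::tree_group) * y = x * z \<longleftrightarrow> y = z"
  by (metis iv_cancel(1))

lemma cancel_right [simp]: "(y::'a::tree_group) * x = z * x \<longleftrightarrow> y = z"
  by (metis iv_simps(2) mult.assoc mult_1_right)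

lemma iv_power: "iv ((x::'a::tree_group) ^ n) = iv x ^ n"
  by (induction n) (simp_all add: power_commutes)

definition commute :: "'a::tree_group \<Rightarrow> 'a \<Rightarrow> bool" where
  "commute x y \<longleftrightarrow> x * y = y * x"

definition dst :: "'a::tree_group \<Rightarrow> 'a \<Rightarrow> int" where
  "dst x y = len (iv x * y)"

definition disp :: "'a::tree_group \<Rightarrow> 'a \<Rightarrow> int" where
  "disp g x = dst x (g * x)"

lemma dst_refl [simp]: "dst x x = 0"
  by (simp add: dst_def len_eq_0_iff)

lemma dst_sym: "dst x y = dst y x"
  by (metis dst_def iv_simps(3,5) len_iv)

lemma dst_four: "dst x y + dst z w \<le> max (dst x z + dst y w) (dst x w + dst y z)"
  unfolding dst_def by (rule len_four)

lemma dst_nonneg [simp]: "0 \<le> dst x y"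
  using dst_four[of x x y y] by simp

lemma dst_tri: "dst x z \<le> dst x y + dst y z"
  using dst_four[of x z y y] by (simp add: dst_sym)

lemma dst_eq_0 [simp]: "dst x y = 0 \<longleftrightarrow> x = y"
  by (metis cancel_left dst_def iv_left len_eq_0_iff)

lemma dst_left [simp]: "dst (g * x) (g * y) = dst x y"
  by (simp add: dst_def mult.assoc)

lemma dst_between:
  assumes "0 \<le> i" "i \<le> dst x y"
  obtains z where "dst x z = i" "dst z y = dst x y - i"
proof -
  obtain y' where "len y' = i" "len (iv y' * (iv x * y)) = len (iv x * y) - i"
    using len_between[of i "iv x * y"] assms by (auto simp: dst_def)
  then have "dst x (x * y') = i" "dst (x * y') y = dst x y - i"
    by (simp_all add: dst_def mult.assoc)
  then show ?thesis by (rule that)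
qed

lemma dst_unique:
  assumes "dst p x + dst x q = dst p q" "dst p y + dst y q = dst p q" "dst p x = dst p y"
  shows "x = y"
proof -
  have "dst x y + dst p q \<le> dst p q"
    using dst_four[of x y p q] assms by (simp add: dst_sym)
  then show ?thesis using dst_nonneg[of x y] by simp
qed

lemma dst_parity: "even (dst x y + dst y z + dst x z)"
  using len_parity[of "iv x * y" "iv y * z"] by (simp add: dst_def mult.assoc)

lemma disp_nonneg [simp]: "0 \<le> disp g x"
  by (simp add: disp_def)

lemma disp_one [simp]: "disp 1 x = 0"
  by (simp add: disp_def)

lemma disp_eq_0 [simp]: "disp g x = 0 \<longleftrightarrow> g = 1"
  unfolding disp_def dst_eq_0 by (metis cancel_right mult_1_left)

lemma disp_iv [simp]: "disp (iv g) x = disp g x"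
proof -
  have "dst x (iv g * x) = dst (g * x) (g * (iv g * x))" by (simp only: dst_left)
  then show ?thesis by (simp add: disp_def dst_sym)
qed

lemma disp_mult: "disp (g * h) x \<le> disp g x + disp h x"
  using dst_tri[of x "g * h * x" "g * x"] by (simp add: disp_def mult.assoc)

lemma disp_power: "disp (g ^ n) x \<le> int n * disp g x"
proof (induction n)
  case (Suc n)
  then show ?case using disp_mult[of g "g ^ n" x] by (simp add: algebra_simps)
qed simp

lemma disp_move: "disp g y \<le> disp g x + 2 * dst x y"
proof -
  have "dst y (g * y) \<le> dst y x + dst x (g * y)" by (rule dst_tri)
  also have "dst x (g * y) \<le> dst x (g * x) + dst (g * x) (g * y)" by (rule dst_tri)
  finally show ?thesis by (simp add: disp_def dst_sym)
qed

lemma disp_conj: "disp (b * g * iv b) x = disp g (iv b * x)"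
proof -
  have "disp g (iv b * x) = dst (b * (iv b * x)) (b * (g * (iv b * x)))"
    by (simp only: disp_def dst_left)
  then show ?thesis by (simp add: disp_def mult.assoc)
qed

lemma disp_shift: "commute g b \<Longrightarrow> disp g (b * x) = disp g x"
  unfolding disp_def commute_def by (simp add: mult.assoc[symmetric]) (simp add: mult.assoc)

text \<open>Displacement is a convex function along geodesics; the last bracket measures how far \<open>z\<close> is from lying between \<open>p\<close> and \<open>q\<close>.\<close>

lemma disp_le_between:
  "disp g z \<le> max (disp g p) (disp g q) + (dst z p + dst z q - dst p q)"
proof -
  have "dst (g * z) q \<le> dst z q + disp g q" "dst (g * z) p \<le> dst z p + disp g p"
    using dst_tri[of "g * z" q "g * q"] dst_tri[of "g * z" p "g * p"]
    by (simp_all add: disp_def dst_sym)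
  then show ?thesis
    using dst_four[of z "g * z" p q] by (simp add: disp_def)
qed

text \<open>An element that moves both ends of a long segment by little shifts the middle part of the segment along itself, every
point by the same signed amount.\<close>

lemma disp_shift_along:
  assumes B: "disp g p \<le> B" "disp g q \<le> B"
    and i: "dst p z = i" "dst z q = dst p q - i" "B < i" "i < dst p q - B"
  obtains s where "\<bar>s\<bar> \<le> B" "s = dst p q - dst (g * p) q"
    "dst p (g * z) = i + s" "dst (g * z) q = dst p q - i - s"
proof -
  define D where "D = dst p q"
  have gp: "dst p (g * p) \<le> B" "dst q (g * q) \<le> B" using B by (simp_all add: disp_def)
  have B0: "0 \<le> B" using B(1) disp_nonneg[of g p] by linarith
  have gz: "dst (g * z) (g * p) = i" "dst (g * z) (g * q) = D - i" 
    using i by (simp_all add: dst_sym D_def)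
  have gD: "dst (g * p) (g * q) = D" by (simp add: D_def)
  have t1: "dst (g * z) q \<le> D - i + B" using dst_tri[of "g * z" q "g * q"] gz gp by (simp add: dst_sym)
  have t2: "dst (g * z) p \<le> i + B" using dst_tri[of "g * z" p "g * p"] gz gp by (simp add: dst_sym)
  have t3: "dst (g * p) q \<le> D + B" "D \<le> dst (g * p) q + B"
    using dst_tri[of "g * p" q p] dst_tri[of p q "g * p"] gp by (simp_all add: D_def dst_sym)
  have t4: "dst (g * q) p \<le> D + B"
    using dst_tri[of "g * q" p q] gp by (simp add: D_def dst_sym)
  note sy = dst_sym[of "g * z" p] dst_sym[of "g * q" p] dst_sym[of "g * p" q] dst_sym[of "g * q" q]
    dst_sym[of "g * p" p] dst_sym[of q p] dst_sym[of "g * q" "g * p"]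
  have e3: "2 * D = dst p (g * q) + dst q (g * p)"
    using dst_four[of p q "g * p" "g * q"] dst_four[of p "g * q" q "g * p"] gp i gD D_def B0 sy
    by linarith
  have e1: "dst p (g * z) = i + D - dst (g * p) q"
    using dst_four[of "g * z" "g * p" p q] dst_four[of "g * z" p q "g * p"] t1 gz gp i D_def B0 sy
    by linarith
  have e2: "dst (g * z) q = 2 * D - i - dst (g * q) p"
    using dst_four[of "g * z" "g * q" q p] dst_four[of "g * z" q p "g * q"] t2 gz gp i D_def B0 sy
    by linarith
  show ?thesis
    by (rule that[of "D - dst (g * p) q"]) (use e1 e2 e3 t3 D_def sy in linarith)+
qed

text \<open>In the middle of the segment both elements are shifts, so \<open>g * h\<close> and \<open>h * g\<close> agree on a vertex \<open>z\<close> there; since the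
vertices are group elements on which the group acts by left multiplication, this already means \<open>g * h = h * g\<close>.\<close>

lemma small_displacement_commute:
  assumes "disp g p \<le> B" "disp h p \<le> B" "disp g q \<le> B" "disp h q \<le> B" "dst p q > 4 * B + 2"
  shows "commute g h"
proof -
  define D where "D = dst p q"
  have B0: "0 \<le> B" using assms(1) disp_nonneg[of g p] by linarith
  obtain z where z: "dst p z = 2 * B + 1" "dst z q = D - (2 * B + 1)"
    using dst_between[of "2 * B + 1" p q] assms B0 D_def by auto
  have *: "\<exists>s. \<bar>s\<bar> \<le> B \<and> s = D - dst (f * p) q \<and> (\<forall>z i. dst p z = i \<and> dst z q = D - i \<and> B < i \<and> i < D - B
       \<longrightarrow> dst p (f * z) = i + s \<and> dst (f * z) q = D - i - s)"
    if f: "disp f p \<le> B" "disp f q \<le> B" for f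
  proof (intro exI conjI allI impI)
    show "D - dst (f * p) q = D - dst (f * p) q" ..
    show "\<bar>D - dst (f * p) q\<bar> \<le> B"
      using disp_shift_along[OF f z(1) z(2)[unfolded D_def]] assms(5) B0 D_def by force
    fix z i assume "dst p z = i \<and> dst z q = D - i \<and> B < i \<and> i < D - B"
    then show "dst p (f * z) = i + (D - dst (f * p) q)" "dst (f * z) q = D - i - (D - dst (f * p) q)"
      using disp_shift_along[OF f, of z i] unfolding D_def by metis+
  qed
  obtain s where s: "\<bar>s\<bar> \<le> B" "\<And>z i. dst p z = i \<Longrightarrow> dst z q = D - i \<Longrightarrow> B < i \<Longrightarrow> i < D - B
       \<Longrightarrow> dst p (g * z) = i + s \<and> dst (g * z) q = D - i - s" using *[of g] assms by blast
  obtain t where t: "\<bar>t\<bar> \<le> B" "\<And>z i. dst p z = i \<Longrightarrow> dst z q = D - i \<Longrightarrow> B < i \<Longrightarrow> i < D - B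
       \<Longrightarrow> dst p (h * z) = i + t \<and> dst (h * z) q = D - i - t" using *[of h] assms by blast
  have D: "D > 4 * B + 2" using assms D_def by simp
  have gz: "dst p (g * z) = 2 * B + 1 + s" "dst (g * z) q = D - (2 * B + 1 + s)"
    using s(2)[OF z] D B0 by auto
  have hz: "dst p (h * z) = 2 * B + 1 + t" "dst (h * z) q = D - (2 * B + 1 + t)"
    using t(2)[OF z] D B0 by auto
  have "dst p (h * (g * z)) = 2 * B + 1 + s + t" "dst (h * (g * z)) q = D - (2 * B + 1 + s + t)"
    using t(2)[OF gz] D B0 s(1) by auto
  moreover have "dst p (g * (h * z)) = 2 * B + 1 + t + s" "dst (g * (h * z)) q = D - (2 * B + 1 + t + s)"
    using s(2)[OF hz] D B0 t(1) by auto
  ultimately have "g * (h * z) = h * (g * z)"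
    by (intro dst_unique[of p _ q]) (simp_all add: D_def)
  then show ?thesis
    unfolding commute_def by (metis cancel_right mult.assoc)
qed

section \<open>Translation length and axes\<close>

lemma linear_growth_le:
  fixes a b c :: int
  assumes "\<And>n::nat. int n * a \<le> int n * b + c"
  shows "a \<le> b"
proof (rule ccontr)
  assume "\<not> a \<le> b"
  then have ab: "1 \<le> a - b" by simp
  define n where "n = nat (\<bar>c\<bar> + 1)"
  have n: "int n = \<bar>c\<bar> + 1" by (simp add: n_def)
  have "int n * 1 \<le> int n * (a - b)" using ab by (intro mult_left_mono) auto
  then show False using assms[of n] n by (simp add: algebra_simps)
qed

text \<open>The vertex chosen here lies on the axis of \<open>g\<close>; \<open>tlen_le_disp\<close> shows that the value is the least displacement, so it
does not depend on the choice.\<close>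

definition tlen :: "'a::tree_group \<Rightarrow> int" where
  "tlen g = disp g (SOME q. \<forall>n. disp (g ^ n) q = int n * disp g q)"

lemma axis_point:
  obtains q where "disp g q = tlen g" "\<And>n. disp (g ^ n) q = int n * tlen g"
proof -
  have "\<exists>q. \<forall>n. disp (g ^ n) q = int n * disp g q"
    using len_axis[of g] by (simp add: disp_def dst_def mult.assoc)
  from someI_ex[OF this] show ?thesis
    using that unfolding tlen_def by blast
qed

lemma disp_power_move: "disp (g ^ n) q \<le> int n * disp g p + 2 * dst p q"
  using disp_move[of "g ^ n" q p] disp_power[of g n p] by linarith

lemma tlen_le_disp: "tlen g \<le> disp g p"
proof -
  obtain q where q: "disp g q = tlen g" "\<And>n. disp (g ^ n) q = int n * tlen g" using axis_point by blast
  show ?thesis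
    by (rule linear_growth_le[of _ _ "2 * dst p q"]) (metis disp_power_move q(2))
qed

text \<open>Translation lengths are bounded from below through the growth of the powers of \<open>g\<close>: a change of base point costs only a
constant, which is negligible for large powers.\<close>

lemma tlen_growth:
  assumes "\<And>n. int n * L \<le> disp (g ^ n) p + c"
  shows "L \<le> tlen g"
proof -
  obtain q where q: "disp g q = tlen g" "\<And>n. disp (g ^ n) q = int n * tlen g" using axis_point by blast
  show ?thesis
  proof (rule linear_growth_le[of _ _ "2 * dst q p + c"])
    fix n
    show "int n * L \<le> int n * tlen g + (2 * dst q p + c)"
      using assms[of n] disp_power_move[of g n p q] q by simp
  qed
qed

lemma tlen_nonneg [simp]: "0 \<le> tlen g"
  using axis_point[of g] disp_nonneg by metis

lemma tlen_power: "tlen (g ^ n) = int n * tlen g"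
proof -
  obtain q where q: "disp g q = tlen g" "\<And>n. disp (g ^ n) q = int n * tlen g" using axis_point by blast
  have "int n * tlen g \<le> tlen (g ^ n)"
    by (rule tlen_growth[of _ _ q 0]) (simp add: power_mult[symmetric] q)
  then show ?thesis using tlen_le_disp[of "g ^ n" q] q by simp
qed

lemma disp_power_ge: "int n * tlen g \<le> disp (g ^ n) p"
  using tlen_le_disp[of "g ^ n" p] by (simp add: tlen_power)

lemma disp_power_axis: "disp g p = tlen g \<Longrightarrow> disp (g ^ n) p = int n * tlen g"
  using disp_power_ge[of n g p] disp_power[of g n p] by simp

lemma tlen_conj [simp]: "tlen (b * g * iv b) = tlen g"
proof -
  have le: "tlen (b * g * iv b) \<le> tlen g" for b g :: 'a
  proof -
    obtain q where q: "disp g q = tlen g" using axis_point by blast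
    have "disp (b * g * iv b) (b * q) = disp g q" by (simp add: disp_conj)
    then show ?thesis using tlen_le_disp[of "b * g * iv b" "b * q"] q by simp
  qed
  have "tlen g = tlen (iv b * (b * g * iv b) * iv (iv b))" by (simp add: mult.assoc)
  also have "\<dots> \<le> tlen (b * g * iv b)" by (rule le)
  finally show ?thesis using le[of b g] by simp
qed

lemma tlen_iv [simp]: "tlen (iv g) = tlen g"
proof -
  have le: "tlen (iv g) \<le> tlen g" for g :: 'a
    by (metis axis_point disp_iv tlen_le_disp)
  show ?thesis using le[of g] le[of "iv g"] by simp
qed

lemma tlen_eq_0 [simp]: "tlen g = 0 \<longleftrightarrow> g = 1"
  by (metis axis_point disp_eq_0 disp_nonneg disp_one order_antisym tlen_le_disp tlen_nonneg)

lemma tlen_one [simp]: "tlen 1 = 0"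
  unfolding tlen_eq_0 ..

lemma tlen_pos: "g \<noteq> 1 \<Longrightarrow> 1 \<le> tlen g"
  using tlen_nonneg[of g] tlen_eq_0[of g] by linarith

section \<open>Commuting elements\<close>

lemma commute_refl [simp]: "commute x x" by (simp add: commute_def)
lemma commute_one [simp]: "commute x 1" "commute 1 x" by (simp_all add: commute_def)
lemma commute_sym: "commute x y \<longleftrightarrow> commute y x" by (auto simp: commute_def)

lemma commute_mult: "commute x y \<Longrightarrow> commute x z \<Longrightarrow> commute x (y * z)"
  unfolding commute_def by (metis mult.assoc)

lemma commute_iv [simp]: "commute x (iv y) \<longleftrightarrow> commute x y"
proof -
  have "commute x y \<Longrightarrow> commute x (iv y)" for x y :: 'a
  proof -
    assume "commute x y"
    then have "iv y * (x * y) * iv y = iv y * (y * x) * iv y" by (simp add: commute_def)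
    then show "commute x (iv y)" by (simp add: commute_def mult.assoc)
  qed
  from this[of x y] this[of x "iv y"] show ?thesis by auto
qed

lemma commute_iv_left [simp]: "commute (iv x) y \<longleftrightarrow> commute x y"
  by (simp add: commute_sym[of _ y])

lemma commute_power: "commute x y \<Longrightarrow> commute x (y ^ n)"
  by (induction n) (simp_all add: commute_mult)

lemma commute_conj: "commute (b * x * iv b) (b * y * iv b) \<longleftrightarrow> commute x y"
  by (simp add: commute_def mult.assoc) (simp add: mult.assoc[symmetric])

lemma between_near:
  assumes "dst x z + dst z y = dst x y" "dst x x' < dst x z"
  shows "dst x' z + dst z y = dst x' y"
proof -
  note sy = dst_sym[of x x'] dst_sym[of y z] dst_sym[of x z] dst_sym[of y x'] dst_sym[of y x]
  have "dst x z \<le> dst x x' + dst x' z" by (rule dst_tri)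
  then show ?thesis
    using dst_four[of x' z x y] dst_four[of x' y z x] dst_tri[of x' y z] assms sy by linarith
qed

text \<open>Commuting elements have the same axis: \<open>g\<close> has displacement \<open>tlen g\<close> at all points \<open>h ^ k * q'\<close>, and \<open>q\<close> lies between
two of these for large \<open>\<bar>k\<bar>\<close>.\<close>

lemma commute_axis:
  assumes "commute g h" "h \<noteq> 1" "disp h q = tlen h"
  shows "disp g q = tlen g"
proof -
  obtain q' where q': "disp g q' = tlen g" using axis_point by blast
  define k where "k = nat (dst q q' + 1)"
  have k: "int k = dst q q' + 1" by (simp add: k_def)
  have "int k * 1 \<le> int k * tlen h" using tlen_pos[OF assms(2)] by (intro mult_left_mono) auto
  then have kt: "dst q q' < int k * tlen h" using k by linarith
  define x where "x = iv h ^ k * q"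
  define y where "y = h ^ k * q"
  have p: "disp (h ^ n) q = int n * tlen h" for n using disp_power_axis[OF assms(3)] .
  have "dst x q = int k * tlen h"
    using p[of k] disp_iv[of "h ^ k" q] by (simp add: x_def disp_def dst_sym iv_power)
  moreover have "dst q y = int k * tlen h"
    using p[of k] by (simp add: y_def disp_def)
  moreover have "dst x y = 2 * int k * tlen h"
  proof -
    have "dst x y = dst (h ^ k * x) (h ^ k * y)" by simp
    also have "\<dots> = disp (h ^ (2 * k)) q"
      by (simp add: x_def y_def iv_power[symmetric] disp_def mult_2 power_add mult.assoc)
    finally show ?thesis using p by simp
  qed
  ultimately have s: "dst x q + dst q y = dst x y" "dst x q = int k * tlen h" "dst q y = int k * tlen h" by simp_all
  define x' where "x' = iv h ^ k * q'"
  define y' where "y' = h ^ k * q'"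
  have xx: "dst x x' = dst q q'" "dst y y' = dst q q'" by (simp_all add: x_def x'_def y_def y'_def)
  have s1: "dst x' q + dst q y = dst x' y" using between_near[OF s(1), of x'] xx s kt by simp
  have s2: "dst y' q + dst q x' = dst y' x'"
    by (rule between_near[of y]) (use s1 s xx kt in \<open>simp_all add: dst_sym\<close>)
  have "disp g x' = tlen g" "disp g y' = tlen g"
    using assms(1) q' by (simp_all add: x'_def y'_def disp_shift commute_power)
  then have "disp g q \<le> tlen g"
    using disp_le_between[of g q y' x'] s2 by (simp add: dst_sym)
  then show ?thesis using tlen_le_disp[of g q] by simp
qed

text \<open>The displacement of \<open>g\<close> at \<open>e\<close> exceeds \<open>tlen g\<close> by twice the distance from \<open>e\<close> to the axis. The summand 1
absorbs a rounding error.\<close>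

lemma axis_projection:
  obtains q where "disp g q = tlen g" "2 * dst e q \<le> disp g e - tlen g + 1"
proof (cases "g = 1")
  case True
  then show ?thesis by (intro that[of e]) simp_all
next
  case False
  obtain q0 where q0: "disp g q0 = tlen g" "\<And>n. disp (g ^ n) q0 = int n * tlen g" using axis_point by blast
  define s where "s n = dst e (g ^ n * q0) + dst e (iv g ^ Suc n * q0)" for n
  have len: "dst (iv g ^ m * q0) (g ^ n * q0) = (int m + int n) * tlen g" for m n
  proof -
    have "dst (iv g ^ m * q0) (g ^ n * q0) = dst (g ^ m * (iv g ^ m * q0)) (g ^ m * (g ^ n * q0))" by simp
    also have "\<dots> = disp (g ^ (m + n)) q0"
      by (simp add: iv_power[symmetric] disp_def power_add mult.assoc)
    finally show ?thesis using q0 by simp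
  qed
  \<comment> \<open>otherwise the four-point inequality makes \<open>s\<close> non-increasing, although it grows at least linearly\<close>
  have "\<exists>n. s n \<le> (2 * int n + 1) * tlen g + disp g e - tlen g"
  proof (rule ccontr)
    assume "\<not> ?thesis"
    then have n: "s n > (2 * int n + 1) * tlen g + disp g e - tlen g" for n by (auto simp: not_le)
    have "s (Suc n) \<le> s n" for n
    proof -
      have "dst e (iv g ^ Suc (Suc n) * q0) = dst (g * e) (iv g ^ Suc n * q0)"
        using dst_left[of g e "iv g ^ Suc (Suc n) * q0"] by (simp add: mult.assoc)
      moreover have "dst (g * e) (g ^ Suc n * q0) = dst e (g ^ n * q0)"
        by (simp add: mult.assoc)
      moreover have "dst (g ^ Suc n * q0) (iv g ^ Suc n * q0) = (int (Suc n) + int (Suc n)) * tlen g"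
        using len by (simp only: dst_sym)
      moreover have "dst e (g * e) = disp g e" by (simp add: disp_def)
      ultimately have "s (Suc n) \<le> max (disp g e + (2 * int (Suc n) + 1) * tlen g - tlen g) (s n)"
        using dst_four[of e "g ^ Suc n * q0" "g * e" "iv g ^ Suc n * q0"]
        unfolding s_def dst_sym[of "g ^ Suc n * q0" "g * e"]
        by (simp only: algebra_simps)
      then show ?thesis using n[of "Suc n"] by linarith
    qed
    then have "s n \<le> s 0" for n by (rule lift_Suc_antimono_le) simp
    moreover have "s n \<ge> (2 * int n + 1) * tlen g" for n
      using dst_tri[of "iv g ^ Suc n * q0" "g ^ n * q0" e] len[of "Suc n" n]
      by (simp add: s_def dst_sym algebra_simps)
    ultimately have *: "(2 * int n + 1) * tlen g \<le> s 0" for n by (meson order_trans)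
    have "int n * (2 * tlen g) \<le> int n * 0 + s 0" for n
      proof -
      have "(2 * int n + 1) * tlen g = int n * (2 * tlen g) + tlen g" by (simp add: algebra_simps)
      then show ?thesis using *[of n] tlen_nonneg[of g] by linarith
    qed
    then have "2 * tlen g \<le> 0" by (rule linear_growth_le)
    then show False using tlen_pos[OF False] by simp
  qed
  then obtain n where n: "s n \<le> (2 * int n + 1) * tlen g + disp g e - tlen g" ..
  define p where "p = iv g ^ Suc n * q0"
  define y where "y = g ^ n * q0"
  have py: "dst p y = (2 * int n + 1) * tlen g" using len[of "Suc n" n] by (simp add: p_def y_def algebra_simps)
  have sl: "dst e p + dst e y - dst p y \<le> disp g e - tlen g" using n py by (simp add: s_def p_def y_def)
  define i where "i = (dst p y + dst e p - dst e y) div 2"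
  have i: "2 * i \<le> dst p y + dst e p - dst e y" "dst p y + dst e p - dst e y \<le> 2 * i + 1"
    unfolding i_def by linarith+
  note tri = dst_tri[of e y p] dst_tri[of e p y] dst_tri[of p y e] dst_sym[of p e] dst_sym[of y p]
  have "0 \<le> i" "i \<le> dst p y" using i tri by linarith+
  then obtain z where z: "dst p z = i" "dst z y = dst p y - i" by (rule dst_between)
  have "disp g p = tlen g" "disp g y = tlen g"
    using q0 by (simp_all add: p_def y_def disp_shift commute_power del: power_Suc)
  then have "disp g z \<le> tlen g" using disp_le_between[of g z p y] z by (simp add: dst_sym)
  then have "disp g z = tlen g" using tlen_le_disp[of g z] by simp
  moreover have "2 * dst e z \<le> disp g e - tlen g + 1"
    using dst_four[of e z p y] z i sl dst_sym[of z p] by linarith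
  ultimately show ?thesis by (rule that)
qed

lemma commute_disp:
  assumes "commute g h" "h \<noteq> 1"
  shows "disp g e \<le> tlen g + disp h e - tlen h + 1"
proof -
  obtain q where q: "disp h q = tlen h" "2 * dst e q \<le> disp h e - tlen h + 1" by (rule axis_projection)
  then show ?thesis
    using disp_move[of g e q] commute_axis[OF assms q(1)] by (simp add: dst_sym)
qed

lemma power_eq_one: "g ^ n = (1::'a::tree_group) \<Longrightarrow> 0 < n \<Longrightarrow> g = 1"
  using tlen_power[of g n] tlen_eq_0[of "g ^ n"] tlen_eq_0[of g] by auto

text \<open>Both \<open>g\<close> and \<open>h\<close> have constant displacement along the orbit of a point under the powers of \<open>u\<close>, and this orbit is unbounded.\<close>

lemma commute_trans:
  assumes "commute g u" "commute h u" "u \<noteq> 1"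
  shows "commute g h"
proof -
  obtain q where q: "disp u q = tlen u" using axis_point by blast
  define B where "B = max (disp g q) (disp h q)"
  have B0: "0 \<le> B" by (simp add: B_def le_max_iff_disj)
  define k where "k = nat (4 * B + 3)"
  have "int k * 1 \<le> int k * tlen u" using tlen_pos[OF assms(3)] by (intro mult_left_mono) auto
  moreover have "int k = 4 * B + 3" using B0 by (simp add: k_def)
  ultimately have "4 * B + 2 < dst q (u ^ k * q)"
    using disp_power_axis[OF q, of k] unfolding disp_def by linarith
  then show ?thesis
    by (intro small_displacement_commute[of g q B h "u ^ k * q"])
      (simp_all add: B_def disp_shift commute_power assms)
qed

lemma commute_root: "commute (g ^ n) h \<Longrightarrow> 0 < n \<Longrightarrow> commute g h"
  by (metis commute_one(2) commute_power commute_refl commute_sym commute_trans power_eq_one)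

text \<open>On the common axis \<open>h\<close> moves \<open>q\<close> by the distance \<open>tlen g\<close>, forwards or backwards, so it agrees with \<open>g\<close> or with
its inverse there.\<close>

lemma commute_eq_tlen:
  assumes c: "commute g h" and t: "tlen g = tlen h"
  shows "h = g \<or> h = iv g"
proof (cases "g = 1")
  case True
  then show ?thesis using t by (metis tlen_eq_0)
next
  case False
  obtain q where q: "disp g q = tlen g" using axis_point by blast
  have hq: "disp h q = tlen g"
    using commute_axis[of h g q] c t q False by (simp add: commute_sym)
  define T where "T = tlen g"
  define a where "a = iv g * q"
  define b where "b = g * q"
  define r where "r = h * q"
  have d1: "dst q b = T" "dst q r = T" "dst q a = T"
    using q hq disp_iv[of g q] by (simp_all add: a_def b_def r_def T_def disp_def)
  have d2: "dst a b = 2 * T"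
    using dst_left[of g a b] disp_power_axis[OF q, of 2]
    by (simp add: a_def b_def disp_def T_def power2_eq_square mult.assoc)
  have gr: "g * r = h * b" using c unfolding r_def b_def commute_def by (simp add: mult.assoc[symmetric])
  have d3: "dst b (g * r) = T" using d1 unfolding b_def by simp
  have d4: "dst r (g * r) = T" unfolding gr using d1 by (simp add: r_def)
  have d5: "dst q (g * r) = dst a r" using dst_left[of g a r] by (simp add: a_def)
  have iar: "iv g * r = h * a"
    using c by (simp add: a_def r_def commute_def[symmetric] mult.assoc[symmetric])
  have d6: "dst a (iv g * r) = T" using d1 unfolding a_def by simp
  have d7: "dst r (iv g * r) = T" unfolding iar using d1 by (simp add: r_def)
  have d8: "dst q (iv g * r) = dst b r" using dst_left[of "iv g" b r] by (simp add: b_def)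
  note sy = dst_sym[of r q] dst_sym[of r a] dst_sym[of r b] dst_sym[of b q] dst_sym[of a q]
  have tri: "dst a r \<le> 2 * T" "dst b r \<le> 2 * T"
    using dst_tri[of a r q] dst_tri[of b r q] d1 sy by simp_all
  have or: "dst a r = 2 * T \<or> dst b r = 2 * T"
    using dst_four[of q r a b] d1 d2 tri sy by linarith
  have "dst a r = 2 * T \<Longrightarrow> dst b r \<le> 0"
    using dst_four[of q "g * r" b r] d1 d3 d4 d5 dst_sym[of "g * r" r] dst_sym[of "g * r" b] sy by linarith
  moreover have "dst b r = 2 * T \<Longrightarrow> dst a r \<le> 0"
    using dst_four[of q "iv g * r" a r] d1 d6 d7 d8 dst_sym[of "iv g * r" r] dst_sym[of "iv g * r" a] sy by linarith
  ultimately have "a = r \<or> b = r" using or by (metis dst_eq_0 dst_nonneg order_antisym)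
  then show ?thesis by (auto simp: a_def b_def r_def)
qed

text \<open>The conjugate has the translation length of \<open>u\<close>, hence it is \<open>u\<close> or its inverse. In the second case \<open>b ^ 2\<close>, and therefore \<open>b\<close>, commutes
with \<open>u\<close>.\<close>

lemma commute_conj_self:
  assumes "commute (b * u * iv b) u" "u \<noteq> 1"
  shows "commute b u"
proof -
  have "b * u * iv b = u \<or> b * u * iv b = iv u"
    using commute_eq_tlen[of u "b * u * iv b"] assms(1) by (simp add: commute_sym)
  then show ?thesis
  proof
    assume "b * u * iv b = u"
    then have "b * u * iv b * b = u * b" by simp
    then show ?thesis by (simp add: commute_def mult.assoc)
  next
    assume eq: "b * u * iv b = iv u"
    then have bu: "b * u = iv u * b" by (metis iv_simps(1) mult.assoc mult_1_right)
    have "b * (b * u) = b * iv u * b" by (simp add: bu mult.assoc)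
    also have "b * iv u = u * b"
      by (metis bu iv_cancel(1) iv_cancel(2) iv_simps(5) mult.assoc iv_simps(3) cancel_left)
    finally have "commute (b ^ 2) u" by (simp add: commute_def power2_eq_square mult.assoc)
    then show ?thesis by (rule commute_root) simp
  qed
qed

lemma commute_conj_gen:
  assumes "commute (b * u * iv b) w" "commute u w" "u \<noteq> 1" "w \<noteq> 1"
  shows "commute b u"
  using assms commute_conj_self commute_trans by blast

section \<open>From local to global lower bounds\<close>

text \<open>In a tree a broken path whose edges are longer than the backtracking \<open>s\<close> (each corner loses \<open>s / 2\<close> on either side)
cannot turn back later: cancellation at one corner never reaches the next one.\<close>

lemma local_to_global_step:
  assumes s: "0 \<le> s"
    and slack: "\<And>j. j < n \<Longrightarrow> dst (z j) (z (Suc j)) + dst (z (Suc j)) (z (Suc (Suc j)))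
          \<le> dst (z j) (z (Suc (Suc j))) + s"
    and long: "\<And>j. j \<le> n \<Longrightarrow> s < dst (z j) (z (Suc j))"
  shows "dst (z 0) (z n) + dst (z n) (z (Suc n)) - s \<le> dst (z 0) (z (Suc n))"
  using slack long
proof (induction n)
  case 0
  then show ?case using s by simp
next
  case (Suc n)
  have IH: "dst (z 0) (z n) + dst (z n) (z (Suc n)) - s \<le> dst (z 0) (z (Suc n))"
    using Suc by simp
  have "s < dst (z n) (z (Suc n))" using Suc.prems(2)[of n] by simp
  then show ?case
    using dst_four[of "z 0" "z (Suc n)" "z n" "z (Suc (Suc n))"] IH Suc.prems(1)[of n]
      dst_sym[of "z (Suc n)" "z n"] by linarith
qed

lemma local_to_global:
  assumes s: "0 \<le> s"
    and slack: "\<And>j. dst (z j) (z (Suc j)) + dst (z (Suc j)) (z (Suc (Suc j)))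
          \<le> dst (z j) (z (Suc (Suc j))) + s"
    and long: "\<And>j. s < dst (z j) (z (Suc j))"
  shows "(\<Sum>j<n. dst (z j) (z (Suc j)) - s) \<le> dst (z 0) (z n)"
proof (induction n)
  case (Suc n)
  then show ?case using local_to_global_step[where n = n and z = z, OF s slack long] by simp
qed simp

text \<open>The same for the bi-infinite path traced by a periodic sequence; one period bounds the translation length of the period element.\<close>

lemma local_to_global_tlen:
  assumes m: "0 < m" and s: "0 \<le> s"
    and per: "\<And>j. z (j + m) = g * z j"
    and slack: "\<And>j. j < m \<Longrightarrow> dst (z j) (z (Suc j)) + dst (z (Suc j)) (z (Suc (Suc j)))
          \<le> dst (z j) (z (Suc (Suc j))) + s"
    and long: "\<And>j. j < m \<Longrightarrow> s < dst (z j) (z (Suc j))"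
  shows "(\<Sum>j<m. dst (z j) (z (Suc j)) - s) \<le> tlen g"
proof -
  have per': "z (j + n * m) = g ^ n * z j" for j n
  proof (induction n)
    case (Suc n)
    have "z (j + Suc n * m) = g * z (j + n * m)" using per[of "j + n * m"] by (simp add: algebra_simps)
    then show ?case using Suc by (simp add: mult.assoc)
  qed simp
  have red: "z j = g ^ (j div m) * z (j mod m)" "z (Suc j) = g ^ (j div m) * z (Suc (j mod m))"
    "z (Suc (Suc j)) = g ^ (j div m) * z (Suc (Suc (j mod m)))" for j
  proof -
    have j: "j = j mod m + j div m * m" by simp
    show "z j = g ^ (j div m) * z (j mod m)" using per'[of "j mod m" "j div m"] by simp
    have "Suc j = Suc (j mod m) + j div m * m" using j by linarith
    then show "z (Suc j) = g ^ (j div m) * z (Suc (j mod m))" using per' by metis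
    have "Suc (Suc j) = Suc (Suc (j mod m)) + j div m * m" using j by linarith
    then show "z (Suc (Suc j)) = g ^ (j div m) * z (Suc (Suc (j mod m)))" using per' by metis
  qed
  have jm: "j mod m < m" for j using m by simp
  have slack': "dst (z j) (z (Suc j)) + dst (z (Suc j)) (z (Suc (Suc j)))
          \<le> dst (z j) (z (Suc (Suc j))) + s" for j
    using slack[OF jm] by (simp only: red[of j] dst_left)
  have long': "s < dst (z j) (z (Suc j))" for j
    using long[OF jm] by (simp only: red[of j] dst_left)
  have d: "dst (z (j + n * m)) (z (Suc (j + n * m))) = dst (z j) (z (Suc j))" for j n
    using per'[of j n] per'[of "Suc j" n] by simp
  have "(\<Sum>j<n * m. dst (z j) (z (Suc j)) - s) = int n * (\<Sum>j<m. dst (z j) (z (Suc j)) - s)" for n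
  proof (induction n)
    case (Suc n)
    have "(\<Sum>j<Suc n * m. dst (z j) (z (Suc j)) - s)
        = (\<Sum>j<n * m. dst (z j) (z (Suc j)) - s) + (\<Sum>j=n*m..<n * m + m. dst (z j) (z (Suc j)) - s)"
      using sum.atLeastLessThan_concat[of 0 "n*m" "n*m+m" "\<lambda>j. dst (z j) (z (Suc j)) - s"]
      by (simp add: atLeast0LessThan add.commute mult.commute)
    also have "(\<Sum>j=n*m..<n * m + m. dst (z j) (z (Suc j)) - s) = (\<Sum>j<m. dst (z j) (z (Suc j)) - s)"
      using sum.shift_bounds_nat_ivl[of "\<lambda>j. dst (z j) (z (Suc j)) - s" 0 "n*m" m] d
      by (simp add: atLeast0LessThan add.commute)
    finally show ?case using Suc by (simp add: algebra_simps)
  qed simp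
  moreover have "dst (z 0) (z (n * m)) = disp (g ^ n) (z 0)" for n
    using per'[of 0 n] by (simp add: disp_def)
  ultimately have "int n * (\<Sum>j<m. dst (z j) (z (Suc j)) - s) \<le> disp (g ^ n) (z 0) + 0" for n
    using local_to_global[where z = z and n = "n * m", OF s slack' long'] by simp
  then show ?thesis by (rule tlen_growth)
qed

lemma tlen_lower_bound:
  assumes "0 \<le> s" "2 * disp g p \<le> disp (g ^ 2) p + s" "s < disp g p"
  shows "disp g p - s \<le> tlen g"
proof -
  define z where "z j = g ^ j * p" for j
  have z: "dst (z j) (z (Suc j)) = disp g p" for j
    by (simp only: z_def power_Suc2 mult.assoc dst_left disp_def)
  have z2: "dst (z 0) (z (Suc (Suc 0))) = disp (g ^ 2) p"
    by (simp add: z_def disp_def power2_eq_square)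
  have "(\<Sum>j<1. dst (z j) (z (Suc j)) - s) \<le> tlen g"
  proof (rule local_to_global_tlen)
    show "z (j + 1) = g * z j" for j by (simp add: z_def mult.assoc)
    fix j :: nat assume "j < 1"
    then show "dst (z j) (z (Suc j)) + dst (z (Suc j)) (z (Suc (Suc j))) \<le> dst (z j) (z (Suc (Suc j))) + s"
      "s < dst (z j) (z (Suc j))" using assms z2 by (simp_all only: z less_one)
  qed (use assms in simp_all)
  then show ?thesis by (simp add: z)
qed

lemma commute_conj_self_iff: "u \<noteq> 1 \<Longrightarrow> commute u (b * u * iv b) \<longleftrightarrow> commute b u"
proof
  assume "u \<noteq> 1" "commute u (b * u * iv b)"
  then show "commute b u" using commute_conj_self[of b u] by (simp add: commute_sym)
next
  assume "commute b u"
  then have "b * u * iv b = u" unfolding commute_def by (simp add: mult.assoc)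
  then show "commute u (b * u * iv b)" by simp
qed

lemma noncommute_ne_one: "\<not> commute x y \<Longrightarrow> x \<noteq> 1 \<and> y \<noteq> 1"
  by auto

text \<open>The geodesics from \<open>p\<close> to \<open>s\<close> and to \<open>b * q\<close> separate near \<open>p\<close>. The first stays where \<open>t\<close> has small displacement, the
second where the conjugate of \<open>t\<close> by \<open>b\<close> has small displacement, and these two elements do not commute.\<close>

lemma gate:
  assumes nc: "\<not> commute b t" and B: "1 \<le> B"
    and p: "disp t p \<le> B" "disp b p \<le> B" and s: "disp t s \<le> B" and q: "disp t q \<le> B"
  shows "dst p s + dst p (b * q) - dst s (b * q) \<le> 30 * B"
proof (rule ccontr)
  assume "\<not> ?thesis"
  then have G: "dst p s + dst p (b * q) - dst s (b * q) > 30 * B" by simp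
  have "15 * B \<le> dst p s"
    using G dst_tri[of p "b * q" s] by linarith
  then obtain z where z: "dst p z = 15 * B" "dst z s = dst p s - 15 * B"
    using dst_between[of "15 * B" p s] B by auto
  let ?t = "b * t * iv b"
  have t1: "disp t z \<le> B" using disp_le_between[of t z p s] z p s by (simp add: dst_sym)
  have "dst z (b * q) \<le> dst p (b * q) - 15 * B"
    using dst_four[of z "b * q" p s] z G dst_sym[of z p] dst_sym[of s "b * q"] 
      dst_sym[of "b * q" p] by linarith
  then have z2: "dst z p + dst z (b * q) \<le> dst p (b * q)" using z by (simp add: dst_sym)
  have "disp ?t p \<le> disp t p + 2 * dst (iv b * p) p"
    using disp_move[of t "iv b * p" p] by (simp add: disp_conj dst_sym)
  also have "dst (iv b * p) p = disp b p" using disp_iv[of b p] by (simp add: disp_def dst_sym)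
  finally have c1: "disp ?t p \<le> 3 * B" using p by simp
  have "disp ?t (b * q) = disp t q" by (simp add: disp_conj)
  then have "disp ?t z \<le> 3 * B"
    using disp_le_between[of ?t z p "b * q"] z2 c1 q B by linarith
  moreover have "4 * (3 * B) + 2 < dst p z" using z B by simp
  ultimately have "commute t ?t"
    by (intro small_displacement_commute[of t p "3 * B" ?t z]) (use p t1 c1 B in simp_all)
  then show False using nc noncommute_ne_one[OF nc] commute_conj_self_iff by blast
qed

text \<open>Positive powers on both sides make the case distinction harmless: if \<open>b\<close> commutes with \<open>t\<close> then the two powers add up, and otherwise
\<open>b\<close> makes the path leave the axis of \<open>t\<close>.\<close>

lemma power_mult_power_disp:
  assumes B: "1 \<le> B" "tlen t \<le> B" and p: "disp t p = tlen t" "disp b p \<le> B"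
  shows "(int n + int m) * tlen t - 31 * B \<le> disp (t ^ n * b * t ^ m) p"
proof (cases "commute b t")
  case True
  have c: "t ^ n * b * t ^ m = t ^ (n + m) * b"
    using commute_power[OF True, of m] unfolding commute_def by (simp add: power_add mult.assoc)
  have "disp (t ^ (n + m)) p \<le> disp (t ^ (n + m) * b) p + disp (iv b) p"
    using disp_mult[of "t ^ (n + m) * b" "iv b" p] by (simp add: mult.assoc)
  then have "(int n + int m) * tlen t \<le> disp (t ^ n * b * t ^ m) p + B"
    using disp_power_axis[OF p(1), of "n + m"] p c by simp
  then show ?thesis using B by simp
next
  case False
  have s: "disp t (iv t ^ n * p) = tlen t" "disp t (t ^ m * p) = tlen t"
    using p by (simp_all add: disp_shift commute_power)
  have 1: "dst p (iv t ^ n * p) = int n * tlen t"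
    using disp_power_axis[OF p(1), of n] disp_iv[of "t ^ n" p] by (simp add: iv_power disp_def)
  have 2: "dst (iv t ^ n * p) (b * (t ^ m * p)) = disp (t ^ n * b * t ^ m) p"
    using dst_left[of "t ^ n" "iv t ^ n * p" "b * (t ^ m * p)"]
    by (simp add: iv_power[symmetric] disp_def mult.assoc)
  have "disp (t ^ m) p \<le> disp (iv b) p + disp (b * t ^ m) p"
    using disp_mult[of "iv b" "b * t ^ m" p] by (simp add: mult.assoc)
  then have 3: "int m * tlen t \<le> B + dst p (b * (t ^ m * p))"
    using disp_power_axis[OF p(1), of m] p disp_iv[of b p] by (simp add: disp_def[of "b * t ^ m"] mult.assoc)
  show ?thesis
    using gate[OF False B(1), of p "iv t ^ n * p" "t ^ m * p"] 1 2 3 s p B by (simp add: algebra_simps)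
qed

lemma tlen_power_mult:
  assumes B: "1 \<le> B" "tlen t \<le> B" and p: "disp t p = tlen t" "disp b p \<le> B"
    and n: "35 * B < int n * tlen t"
  shows "int n * tlen t - 35 * B \<le> tlen (t ^ n * b)"
proof -
  have u: "disp (t ^ n * b) p \<le> int n * tlen t + B" "int n * tlen t \<le> disp (t ^ n * b) p + B"
    using disp_mult[of "t ^ n" b p] disp_mult[of "t ^ n * b" "iv b" p] disp_power_axis[OF p(1), of n] p
    by (simp_all add: mult.assoc)
  have "t ^ n * b * t ^ n = (t ^ n * b) ^ 2 * iv b" by (simp add: power2_eq_square mult.assoc)
  then have "disp (t ^ n * b * t ^ n) p \<le> disp ((t ^ n * b) ^ 2) p + B"
    using disp_mult[of "(t ^ n * b) ^ 2" "iv b" p] p by simp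
  then have "2 * disp (t ^ n * b) p \<le> disp ((t ^ n * b) ^ 2) p + 34 * B"
    using power_mult_power_disp[OF B p, of n n] u by (simp add: algebra_simps)
  then have "disp (t ^ n * b) p - 34 * B \<le> tlen (t ^ n * b)"
    by (rule tlen_lower_bound[rotated]) (use B n u in linarith)+
  then show ?thesis using u by linarith
qed

text \<open>A version with a base point that need not lie on the axis of \<open>t\<close>; it is moved to the axis by projection.\<close>

lemma tlen_power_mult_near:
  assumes B: "1 \<le> B" and p: "disp t p \<le> B" "disp b p \<le> B"
    and n: "70 * B < int n * tlen t"
  shows "int n * tlen t - 70 * B \<le> tlen (t ^ n * b)"
proof -
  obtain q where q: "disp t q = tlen t" "2 * dst p q \<le> disp t p - tlen t + 1" by (rule axis_projection)
  have "t \<noteq> 1" using n B by auto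
  then have t: "1 \<le> tlen t" by (rule tlen_pos)
  have "disp b q \<le> 2 * B"
    using disp_move[of b q p] q p t by (simp add: dst_sym)
  then show ?thesis
    using tlen_power_mult[of "2 * B" t q b n] B n q p tlen_le_disp[of t p] by simp
qed

text \<open>At the centre of the tripod spanned by \<open>p\<close>, \<open>e\<close> and \<open>q\<close> all of \<open>t\<close>, \<open>a\<close>, \<open>k\<close> have small displacement, by convexity. Hence the
centre is close to \<open>p\<close> (pair \<open>t\<close>, \<open>a\<close>) and close to \<open>e\<close> (pair \<open>t\<close>, \<open>k\<close>).\<close>

lemma tripod_bound:
  assumes p: "disp t p \<le> B" "disp a p \<le> B" and e: "disp t e \<le> B" "disp k e \<le> B"
    and q: "disp k q \<le> B" "disp a q \<le> B" and nc: "\<not> commute t a" "\<not> commute t k"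
  shows "dst p e \<le> 8 * B + 8"
proof -
  define i where "i = (dst p e + dst p q - dst e q) div 2"
  have i: "2 * i \<le> dst p e + dst p q - dst e q" "dst p e + dst p q - dst e q \<le> 2 * i + 1"
    unfolding i_def by linarith+
  note sy = dst_sym[of e p] dst_sym[of q p] dst_sym[of q e]
  note tri = dst_tri[of e q p] dst_tri[of p q e] dst_tri[of p e q]
  have "0 \<le> i" "i \<le> dst p e" using i tri sy by linarith+
  then obtain z where z: "dst p z = i" "dst z e = dst p e - i" by (rule dst_between)
  have zq: "2 * dst z q \<le> dst p q + dst e q - dst p e + 1"
    using dst_four[of z q p e] z i sy dst_sym[of z p] by linarith
  have t: "disp t z \<le> B" using disp_le_between[of t z p e] z p e by (simp add: dst_sym)
  have a: "disp a z \<le> B" using disp_le_between[of a z p q] z zq i p q dst_sym[of z p] by linarith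
  have k: "disp k z \<le> B + 1" using disp_le_between[of k z e q] z zq i e q by linarith
  have "\<not> 4 * B + 2 < dst p z" using small_displacement_commute[of t p B a z] t a p nc by blast
  moreover have "\<not> 4 * (B + 1) + 2 < dst e z"
    using small_displacement_commute[of t e "B + 1" k z] t k e nc by force
  ultimately have "dst p z \<le> 4 * B + 2" "dst z e \<le> 4 * B + 6" by (simp_all add: dst_sym[of z e])
  then show ?thesis using z by simp
qed


section \<open>Commutators of powers dominate\<close>

lemma ex_least_int:
  fixes f :: "'b \<Rightarrow> int"
  assumes "P x" "\<And>x. 0 \<le> f x"
  obtains a where "P a" "\<And>b. P b \<Longrightarrow> f a \<le> f b"
proof -
  obtain a where "P a" "\<forall>b. P b \<longrightarrow> nat (f a) \<le> nat (f b)"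
    using ex_has_least_nat[of P x "\<lambda>x. nat (f x)"] assms by blast
  then show ?thesis using that assms(2) by (metis nat_le_eq_zle order_antisym_conv linorder_not_less)
qed

text \<open>Away from the axis of \<open>x\<close> the displacement changes by 2 along every edge. If it is the same at both ends of an edge, then \<open>x\<close>
moves the edge coherently, parity excludes the flat case of the four-point inequality, and the edge lies on the axis.\<close>

lemma adjacent_equal_disp:
  assumes o: "dst a z = 1" and eq: "disp x a = disp x z"
  shows "disp x a = tlen x"
proof -
  have *: "disp x a = tlen x"
    if o: "dst a z = 1" and eq: "disp x a = disp x z" and l: "dst a (x * z) = disp x a - 1"
      and l': "dst z (x * a) = disp x a + 1" for a z
  proof -
    define F where "F = disp x a"
    have F: "1 \<le> F" using l dst_nonneg[of a "x * z"] by (simp add: F_def)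
    have d: "dst (iv x * a) z = F - 1" "dst (iv x * a) a = F" "dst a (x * a) = F"
      using dst_left[of x "iv x * a" z] dst_left[of x "iv x * a" a] l
      by (simp_all add: F_def disp_def)
    have "dst (iv x * a) (x * a) = disp (x ^ 2) a"
      using dst_left[of x "iv x * a" "x * a"] by (simp add: disp_def power2_eq_square mult.assoc)
    moreover have "dst (iv x * a) (x * a) \<ge> 2 * F"
      using dst_four[of "iv x * a" a z "x * a"] d o l' F_def dst_sym[of a z] by linarith
    ultimately have "F \<le> tlen x" using tlen_lower_bound[of 0 x a] F F_def by simp
    then show ?thesis using tlen_le_disp[of x a] F_def by simp
  qed
  show ?thesis
  proof (cases "disp x a \<le> 1")
    case True
    then show ?thesis
      by (metis disp_eq_0 disp_nonneg int_one_le_iff_zero_less le_less order_antisym_conv tlen_le_disp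
          tlen_one tlen_pos zero_less_one_class.zero_le_one order_trans)
  next
    case False
    define F where "F = disp x a"
    have F: "dst a (x * a) = F" "dst z (x * z) = F" using eq by (simp_all add: F_def disp_def)
    have sum: "dst a (x * z) + dst z (x * a) = 2 * F"
      using dst_four[of a "x * z" z "x * a"] dst_four[of a "x * a" z "x * z"] o F False F_def
        dst_sym[of "x * a" z] dst_sym[of "x * z" z] dst_sym[of "x * z" "x * a"] dst_left[of x a z] by linarith
    have "dst a (x * z) \<le> F + 1" "dst z (x * a) \<le> F + 1"
      using dst_tri[of a "x * z" z] dst_tri[of z "x * a" a] F o dst_sym[of a z] by linarith+
    moreover have "even (dst a z + dst z (x * z) + dst a (x * z))" by (rule dst_parity)
    then have "odd (F + dst a (x * z))" unfolding o F by presburger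
    then have "dst a (x * z) \<noteq> F" by auto
    ultimately consider "dst a (x * z) = F - 1 \<and> dst z (x * a) = F + 1" | "dst a (x * z) = F + 1 \<and> dst z (x * a) = F - 1"
      using sum by linarith
    then show ?thesis
    proof cases
      case 1
      then show ?thesis using *[OF o eq] F_def by simp
    next
      case 2
      then show ?thesis using *[of z a] o eq F_def by (simp add: dst_sym)
    qed
  qed
qed

text \<open>With exponent 7, a segment common to the axes of \<open>k\<close> and \<open>x\<close>, of length at most \<open>4 * tlen x + 2\<close> by
\<open>small_displacement_commute\<close>, is moved off itself by \<open>x ^ 7\<close> when \<open>tlen k \<le> tlen x\<close>.\<close>

definition pcomm :: "'a::tree_group \<Rightarrow> 'a \<Rightarrow> 'a" where
  "pcomm k x = k ^ 7 * x ^ 7 * iv (k ^ 7) * iv (x ^ 7)"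

lemma iv_pcomm: "iv (pcomm k x) = pcomm x k"
  by (simp add: pcomm_def mult.assoc)

text \<open>With \<open>y = x ^ 7\<close>, the axis \<open>A\<close> of \<open>k\<close> and its translate \<open>y A\<close> are disjoint, and \<open>a\<close>, \<open>y * a'\<close> are the ends of the bridge
between them. The commutator is the product of a translation along \<open>A\<close> and one along \<open>y A\<close>, so its axis crosses the bridge twice
in each period, and the length of the bridge bounds the displacement of \<open>x\<close> at \<open>a\<close>.\<close>

lemma pcomm_dominates_aux:
  assumes nc: "\<not> commute k x" and le: "tlen k \<le> tlen x"
  shows "\<exists>a. disp k a \<le> tlen (pcomm k x) \<and> disp x a \<le> tlen (pcomm k x)"
proof -
  have kx: "k \<noteq> 1" "x \<noteq> 1" using noncommute_ne_one[OF nc] by auto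
  \<comment> \<open>\<open>A\<close> is the axis of \<open>k\<close>; the bridge is sought among the points of \<open>A\<close> closest to the axis of \<open>x\<close>\<close>
  define A where "A q \<longleftrightarrow> disp k q = tlen k" for q
  define y where "y = x ^ 7"
  obtain q0 where "A q0" unfolding A_def using axis_point by blast
  then obtain a0 where a0: "A a0" "\<And>b. A b \<Longrightarrow> disp x a0 \<le> disp x b"
    using ex_least_int[of A q0 "disp x"] by (metis disp_nonneg)
  define F where "F = disp x a0"
  define P where "P = (\<lambda>(a, a'). A a \<and> A a' \<and> disp x a = F \<and> disp x a' = F)"
  have "P (a0, a0)" by (simp add: P_def a0 F_def)
  then obtain aa where aa: "P aa" "\<And>b. P b \<Longrightarrow> dst (fst aa) (y * snd aa) \<le> dst (fst b) (y * snd b)"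
    using ex_least_int[of P "(a0, a0)" "\<lambda>b. dst (fst b) (y * snd b)"] by (metis dst_nonneg)
  obtain a a' where aa': "aa = (a, a')" by fastforce
  have a: "A a" "A a'" "disp x a = F" "disp x a' = F" using aa(1) by (simp_all add: P_def aa')
  define D where "D = dst a (y * a')"
  have min: "D \<le> dst b (y * b')" if "A b" "A b'" "disp x b \<le> F" "disp x b' \<le> F" for b b'
    using aa(2)[of "(b, b')"] that a0(2)[of b] a0(2)[of b'] by (simp add: P_def aa' D_def F_def)
  have A_between: "A z" if "A b" "A b'" "dst b z + dst z b' \<le> dst b b'" for b b' z
    using disp_le_between[of k z b b'] that tlen_le_disp[of k z] dst_sym[of b z] by (simp add: A_def)
  have F1: "tlen x \<le> F" using tlen_le_disp[of x a0] by (simp add: F_def)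
  have x1: "1 \<le> tlen x" "1 \<le> tlen k" using kx tlen_pos by blast+
  have xa: "disp x (y * b) = disp x b" for b unfolding y_def by (rule disp_shift) (simp add: commute_power)
  have DF: "F \<le> D"
  proof (cases "a = a'")
    case True
    have "disp x a \<le> tlen x + disp y a - tlen y + 1"
      unfolding y_def by (rule commute_disp) (use kx power_eq_one[of x 7] in \<open>auto simp: commute_power\<close>)
    then show ?thesis using a x1 tlen_power[of x 7] by (simp add: True D_def disp_def y_def)
  next
    case False
    then have "1 \<le> dst a a'" using dst_nonneg[of a a'] dst_eq_0[of a a'] by linarith
    then obtain z where z: "dst a z = 1" "dst z a' = dst a a' - 1"
      using dst_between[of 1 a a'] by auto
    have Az: "A z" using A_between[OF a(1,2)] z by simp
    have "disp x z \<le> F" using disp_le_between[of x z a a'] z a dst_sym[of z a] by simp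
    then have "disp x z = F" using a0(2)[OF Az] by (simp add: F_def)
    then have xF: "tlen x = F" using adjacent_equal_disp[OF z(1), of x] a by simp
    have S: "dst a a' \<le> 4 * F + 2"
      using small_displacement_commute[of k a F x a'] a nc le xF by (force simp: A_def)
    have "disp y a = 7 * F" using disp_power_axis[of x a 7] a xF by (simp add: y_def)
    then have "7 * F \<le> D + dst a a'"
      using dst_tri[of a "y * a" "y * a'"] by (simp add: disp_def D_def dst_sym)
    then show ?thesis using S xF x1 by linarith
  qed
  have D1: "1 \<le> D" using DF F1 x1 by linarith
  \<comment> \<open>no backtracking where the bridge meets \<open>A\<close> and \<open>y A\<close>: a first common edge would give a shorter bridge\<close>
  have zero1: "dst b a + dst a (y * a') \<le> dst b (y * a')" if b: "A b" for b
  proof (rule ccontr)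
    assume "\<not> ?thesis"
    moreover have "even (dst b a + dst a (y * a') + dst b (y * a'))" by (rule dst_parity)
    ultimately have sl: "2 + dst b (y * a') \<le> dst b a + dst a (y * a')" by presburger
    obtain z where z: "dst a z = 1" "dst z (y * a') = D - 1"
      using dst_between[of 1 a "y * a'"] D1 by (auto simp: D_def)
    have "dst z b \<le> dst a b - 1"
      using dst_four[of z b a "y * a'"] sl z D_def dst_sym[of z a] dst_sym[of b a] by linarith
    then have "A z" using A_between[OF a(1) b] z by simp
    moreover have "disp x z \<le> F"
      using disp_le_between[of x z a "y * a'"] z a xa D_def dst_sym[of z a] by simp
    ultimately show False using min[of z a'] a z by simp
  qed
  have zero2: "dst (y * b) (y * a') + dst (y * a') a \<le> dst (y * b) a" if b: "A b" for b
  proof (rule ccontr)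
    assume "\<not> ?thesis"
    moreover have "even (dst (y * b) (y * a') + dst (y * a') a + dst (y * b) a)" by (rule dst_parity)
    ultimately have sl: "2 + dst (y * b) a \<le> dst (y * b) (y * a') + dst (y * a') a" by presburger
    obtain z' where z': "dst (y * a') z' = 1" "dst z' a = D - 1"
      using dst_between[of 1 "y * a'" a] D1 dst_sym[of "y * a'" a] by (auto simp: D_def)
    define z where "z = iv y * z'"
    have zz: "z' = y * z" by (simp add: z_def)
    have "dst z' (y * b) \<le> dst (y * a') (y * b) - 1"
      using dst_four[of z' "y * b" "y * a'" a] sl z' D_def dst_sym[of z' "y * a'"] dst_sym[of "y * b" "y * a'"]
        dst_sym[of "y * a'" a] by linarith
    then have "A z" using A_between[OF a(2) b, of z] z' by (simp add: zz)
    moreover have "disp x z \<le> F"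
      using disp_le_between[of x z' a "y * a'"] z' a xa D_def dst_sym[of z' a] dst_sym[of z' "y * a'"]
        zz by simp
    ultimately show False using min[of a z] a z' by (simp add: zz dst_sym)
  qed
  define K where "K = k ^ 7"
  define g where "g = y * iv K * iv y * K"
  have AK: "A (K * b)" "A (iv K * b)" if "A b" for b
    using that by (simp_all add: A_def K_def disp_shift commute_power)
  have dK: "dst b (K * b) = 7 * tlen k" "dst b (iv K * b) = 7 * tlen k" if "A b" for b
    using that disp_power_axis[of k b 7] disp_iv[of K b] by (simp_all add: A_def K_def disp_def)
  \<comment> \<open>four corners per period: bridge, \<open>y A\<close>, bridge backwards, translate of \<open>A\<close>\<close>
  define w where "w j = (if j = 0 then a else if j = 1 then y * a' else if j = 2 then y * iv K * a'
      else y * iv K * iv y * a)" for j :: nat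
  define z where "z j = g ^ (j div 4) * w (j mod 4)" for j
  have zs: "z 0 = a" "z (Suc 0) = y * a'" "z 2 = y * iv K * a'" "z 3 = y * iv K * iv y * a"
     "z 4 = g * a" "z 5 = g * (y * a')"
    by (simp_all add: z_def w_def)
  have n4: "Suc (Suc 0) = 2" "Suc 2 = 3" "Suc 3 = 4" "Suc 4 = 5" by simp_all
  have d0: "dst (z 0) (z (Suc 0)) = D" by (simp add: zs D_def)
  have d1: "dst (z (Suc 0)) (z 2) = 7 * tlen k" using dK[OF a(2)] by (simp add: zs mult.assoc)
  have d2: "dst (z 2) (z 3) = D" using dst_left[of y a' "iv y * a"] by (simp add: zs mult.assoc D_def dst_sym)
  have d3: "dst (z 3) (z 4) = 7 * tlen k" using dK[OF a(1)] by (simp add: zs g_def mult.assoc)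
  have d4: "dst (z 4) (z 5) = D" by (simp add: zs D_def)
  have s0: "dst (z 0) (z (Suc 0)) + dst (z (Suc 0)) (z 2) \<le> dst (z 0) (z 2)"
    using zero2[OF AK(2)[OF a(2)]] by (simp add: zs mult.assoc dst_sym)
  have s1: "dst (z (Suc 0)) (z 2) + dst (z 2) (z 3) \<le> dst (z (Suc 0)) (z 3)"
  proof -
    have "dst (z (Suc 0)) (z 3) = dst (y * (K * (iv y * z (Suc 0)))) (y * (K * (iv y * z 3)))"
      by (simp only: dst_left)
    also have "\<dots> = dst (y * (K * a')) a" by (simp add: zs mult.assoc)
    finally have "dst (z (Suc 0)) (z 3) = dst (y * (K * a')) a" .
    moreover have "dst (y * (K * a')) (y * a') = 7 * tlen k" using dK[OF a(2)] by (simp add: dst_sym)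
    ultimately show ?thesis using zero2[OF AK(1)[OF a(2)]] d1 d2 D_def dst_sym[of a "y * a'"] by linarith
  qed
  have s2: "dst (z 2) (z 3) + dst (z 3) (z 4) \<le> dst (z 2) (z 4)"
  proof -
    have "dst (z 2) (z 4) = dst (y * a') (K * a)"
      using dst_left[of y a' "iv y * (K * a)"] by (simp add: zs g_def mult.assoc)
    moreover have "dst (K * a) a = 7 * tlen k" using dK[OF a(1)] by (simp add: dst_sym)
    ultimately show ?thesis using zero1[OF AK(1)[OF a(1)]] d2 d3 D_def dst_sym[of "K * a" "y * a'"] by linarith
  qed
  have s3: "dst (z 3) (z 4) + dst (z 4) (z 5) \<le> dst (z 3) (z 5)"
  proof -
    have "dst (z 3) (z 5) = dst (iv K * a) (y * a')"
      using dst_left[of K "iv K * a" "y * a'"] by (simp add: zs g_def mult.assoc)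
    moreover have "dst (iv K * a) a = 7 * tlen k" using dK[OF a(1)] by (simp add: dst_sym)
    ultimately show ?thesis using zero1[OF AK(2)[OF a(1)]] d3 d4 D_def by linarith
  qed
  have "(\<Sum>j<4. dst (z j) (z (Suc j)) - 0) \<le> tlen g"
  proof (rule local_to_global_tlen)
    have "(j + 4) div 4 = Suc (j div 4)" for j :: nat by simp
    then show "z (j + 4) = g * z j" for j by (simp only: z_def mod_add_self2 power_Suc mult.assoc)
    fix j :: nat assume "j < 4"
    then consider "j = 0" | "j = 1" | "j = 2" | "j = 3" by linarith
    then show "0 < dst (z j) (z (Suc j))"
      "dst (z j) (z (Suc j)) + dst (z (Suc j)) (z (Suc (Suc j))) \<le> dst (z j) (z (Suc (Suc j))) + 0"
      using d0 d1 d2 d3 s0 s1 s2 s3 D1 x1 by (cases; simp only: n4 One_nat_def; linarith)+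
  qed simp_all
  then have "2 * D + 14 * tlen k \<le> tlen g"
    using d0 d1 d2 d3 by (simp add: numeral_eq_Suc)
  moreover have "pcomm k x = K * g * iv K" by (simp add: pcomm_def g_def K_def y_def mult.assoc)
  then have "tlen (pcomm k x) = tlen g" by (simp only: tlen_conj)
  ultimately have "disp k a \<le> tlen (pcomm k x)" "disp x a \<le> tlen (pcomm k x)"
    using a DF D1 x1 F1 by (simp_all add: A_def)
  then show ?thesis by blast
qed

lemma pcomm_dominates:
  assumes "\<not> commute k x"
  obtains a where "disp k a \<le> tlen (pcomm k x)" "disp x a \<le> tlen (pcomm k x)"
proof (cases "tlen k \<le> tlen x")
  case True
  then show ?thesis using pcomm_dominates_aux[OF assms] that by blast
next
  case False
  have "tlen (pcomm k x) = tlen (pcomm x k)" by (metis iv_pcomm tlen_iv)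
  then show ?thesis
    using pcomm_dominates_aux[of x k] False that assms by (auto simp: commute_sym)
qed

section \<open>Alternating words\<close>

text \<open>The points reached from \<open>p\<close> by a path that first leaves the axis of \<open>u\<close> by a letter not commuting with \<open>u\<close>, then alternates
between long powers of \<open>u\<close> (of either sign) and such letters, and finally ends anywhere on an axis.\<close>

inductive turning :: "'a::tree_group \<Rightarrow> int \<Rightarrow> 'a \<Rightarrow> 'a \<Rightarrow> bool" for u B p where
  base: "\<lbrakk>\<not> commute a u; disp a p \<le> B; disp u q \<le> B\<rbrakk> \<Longrightarrow> turning u B p (a * q)"
| step: "\<lbrakk>\<not> commute a u; disp a p \<le> B; v = u ^ n \<or> v = iv u ^ n; 100 * B \<le> int n * tlen u;
      turning u B p e\<rbrakk> \<Longrightarrow> turning u B p (a * (v * e))"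

text \<open>All points \<open>turning u B p\<close> are seen from the axis of \<open>u\<close> through a gate near \<open>p\<close>. By induction the path continues beyond
\<open>a * (v * p)\<close>, which is so far away that only the first turn matters.\<close>

lemma gate_turning:
  assumes "turning u B p e" "1 \<le> B" "disp u p \<le> B" "disp u s \<le> B"
  shows "dst p s + dst p e - dst s e \<le> 30 * B"
  using assms(1,4)
proof (induction arbitrary: s)
  case (base a q)
  then show ?case using gate[of a u B p s q] assms by simp
next
  case (step a v n e)
  have v: "commute u v" using step.hyps(3) by (auto simp: commute_power)
  have vp: "disp u (iv v * p) \<le> B" using disp_shift[of u "iv v" p] v assms by simp
  have vp': "disp u (v * p) \<le> B" using disp_shift[OF v] assms by simp
  have "dst p (iv v * p) + dst p e - dst (iv v * p) e \<le> 30 * B" by (rule step.IH[OF vp])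
  moreover have "dst p (iv v * p) = dst (v * p) p" "dst (iv v * p) e = dst p (v * e)"
    using dst_left[of v p "iv v * p"] dst_left[of v "iv v * p" e] by simp_all
  ultimately have s1: "dst (v * p) p + dst p e - dst p (v * e) \<le> 30 * B" by simp
  have vv: "disp v p = disp (u ^ n) p" using step.hyps(3) by (auto simp: iv_power[symmetric])
  have long: "100 * B \<le> dst (v * p) p"
    using disp_power_ge[of n u p] vv step.hyps(4) by (simp add: disp_def dst_sym)
  have g: "dst p s + dst p (a * (v * p)) - dst s (a * (v * p)) \<le> 30 * B"
    by (rule gate) (use step.hyps step.prems assms vp' in simp_all)
  have ap: "dst (a * p) p \<le> B" using step.hyps by (simp add: disp_def dst_sym)
  have l1: "99 * B \<le> dst p (a * (v * p))"
    using dst_tri[of "a * p" "a * (v * p)" p] ap long dst_sym[of "v * p" p] dst_left[of a p "v * p"] by linarith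
  have l2: "dst p (v * e) - B \<le> dst p (a * (v * e))"
    using dst_tri[of "a * p" "a * (v * e)" p] ap dst_left[of a p "v * e"] by linarith
  have l3: "dst (a * (v * p)) (a * (v * e)) = dst p e" by simp
  show ?case
    using dst_four[of s "a * (v * p)" p "a * (v * e)"] g l1 l2 l3 s1 long assms(2)
      dst_sym[of s p] dst_sym[of "a * (v * p)" p] by linarith
qed

fun zig :: "'a::tree_group \<Rightarrow> nat list \<Rightarrow> 'a list \<Rightarrow> 'a" where
  "zig u (n # ns) (a # as) = u ^ n * a * zig u ns as"
| "zig u _ _ = 1"

text \<open>Each exponent exceeds \<open>c\<close> times the total of all later ones, the summand \<open>length ns + 1\<close> accounting for the letters in between.\<close>

fun steep :: "nat \<Rightarrow> nat list \<Rightarrow> bool" where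
  "steep c [] = True"
| "steep c (n # ns) = (c * (sum_list ns + length ns + 1) \<le> n \<and> steep c ns)"

lemma steep_ex: "\<exists>ns. length ns = k \<and> steep c ns"
proof (induction k)
  case (Suc k)
  then obtain ns where "length ns = k" "steep c ns" by blast
  then have "length (c * (sum_list ns + length ns + 1) # ns) = Suc k \<and>
    steep c (c * (sum_list ns + length ns + 1) # ns)" by simp
  then show ?case by blast
qed simp

lemma steep_le: "steep c ns \<Longrightarrow> n \<in> set ns \<Longrightarrow> c \<le> n"
  by (induction ns) (auto simp: algebra_simps)

text \<open>The vertex \<open>p\<close> lies on the axis of \<open>u\<close>, and seen from it the letters are short compared with \<open>u\<close> and lead off the axis.\<close>

definition frame :: "'a::tree_group \<Rightarrow> 'a \<Rightarrow> nat \<Rightarrow> 'a list \<Rightarrow> bool" where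
  "frame u p C as \<longleftrightarrow> disp u p = tlen u \<and> u \<noteq> 1 \<and>
     (\<forall>a \<in> set as. disp a p \<le> int C * tlen u \<and> \<not> commute a u)"

lemma frame_Cons: "frame u p C (a # as) \<longleftrightarrow>
    disp a p \<le> int C * tlen u \<and> \<not> commute a u \<and> frame u p C as"
  by (auto simp: frame_def)

lemma zig_conj: "zig (c * u * iv c) ns (map (\<lambda>a. c * a * iv c) as) = c * zig u ns as * iv c"
proof (induction u ns as rule: zig.induct)
  case (1 u n ns a as)
  have "(c * u * iv c) ^ n = c * u ^ n * iv c" by (induction n) (simp_all add: mult.assoc)
  then show ?case using 1 by (simp add: mult.assoc)
qed simp_all

lemma frame_conj:
  "frame u p C as \<Longrightarrow> frame (c * u * iv c) (c * p) C (map (\<lambda>a. c * a * iv c) as)"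
proof -
  have "u \<noteq> 1 \<Longrightarrow> c * u * iv c \<noteq> 1" by (metis tlen_conj tlen_eq_0)
  then show "frame u p C as \<Longrightarrow> ?thesis"
    by (auto simp: frame_def disp_conj commute_conj)
qed

lemma disp_zig:
  assumes "frame u p C as"
  shows "disp (zig u ns as) p \<le> (int (sum_list ns) + int (length ns) * int C) * tlen u"
  using assms
proof (induction u ns as rule: zig.induct)
  case (1 u n ns a as)
  have f: "disp u p = tlen u" "disp a p \<le> int C * tlen u" using "1.prems" by (simp_all add: frame_def)
  have "disp (u ^ n * a * zig u ns as) p \<le> disp (u ^ n) p + disp a p + disp (zig u ns as) p"
    using disp_mult[of "u ^ n * a" "zig u ns as" p] disp_mult[of "u ^ n" a p] by simp
  moreover have "disp (zig u ns as) p \<le> (int (sum_list ns) + int (length ns) * int C) * tlen u"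
    using 1 by (simp add: frame_Cons)
  ultimately show ?case
    using f disp_power_axis[OF f(1), of n] by (simp add: algebra_simps)
next
  case ("2_1" u as)
  then show ?case by simp
next
  case ("2_2" u ns)
  then show ?case by simp
qed


lemma turning_zig:
  assumes f: "frame u p C (a # as)" and B: "int C * tlen u \<le> B"
    and ns: "\<forall>n \<in> set ns. 100 * B \<le> int n * tlen u" and q: "disp u q \<le> B"
  shows "turning u B p (a * zig u ns as * q)"
  using f ns
proof (induction ns arbitrary: a as)
  case Nil
  then have "turning u B p (a * q)"
    by (intro turning.base) (use B q in \<open>auto simp: frame_Cons\<close>)
  then show ?case by simp
next
  case (Cons n ns)
  show ?case
  proof (cases as)
    case Nil
    then have "turning u B p (a * q)"
      by (intro turning.base) (use B q Cons in \<open>auto simp: frame_Cons\<close>)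
    then show ?thesis using Nil by simp
  next
    case (Cons b bs)
    then have "turning u B p (b * zig u ns bs * q)"
      using Cons.IH[of b bs] Cons.prems by (simp add: frame_Cons)
    then have "turning u B p (a * (u ^ n * (b * zig u ns bs * q)))"
      using Cons.prems B by (intro turning.step[where n = n]) (auto simp: frame_Cons)
    then show ?thesis by (simp add: Cons mult.assoc)
  qed
qed

lemma turning_zig_inverse:
  assumes f: "frame u p C as" and B: "int C * tlen u \<le> B"
    and ns: "\<forall>n \<in> set ns. 100 * B \<le> int n * tlen u" and x: "turning u B p x"
  shows "turning u B p (iv (zig u ns as) * x)"
  using f B ns x
proof (induction u ns as arbitrary: x rule: zig.induct)
  case (1 u n ns a as)
  have "disp a p \<le> B" using "1.prems" by (auto simp: frame_Cons)
  then have "turning u B p (iv a * (iv u ^ n * x))"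
    by (intro turning.step[where n = n]) (use "1.prems" in \<open>auto simp: frame_Cons\<close>)
  then have "turning u B p (iv (zig u ns as) * (iv a * (iv u ^ n * x)))"
    by (intro "1.IH") (use "1.prems" in \<open>auto simp: frame_Cons\<close>)
  then show ?case by (simp add: mult.assoc iv_power)
qed simp_all

text \<open>The relation \<open>a' = z * a * iv b\<close> between corresponding letters, with \<open>z\<close> and \<open>b\<close> in the centralizer of \<open>u\<close>, where the offset after one
letter determines the offset before the next one. After the last letter there is no offset left, because
both alternating words have the same value.\<close>

fun related :: "'a::tree_group \<Rightarrow> 'a \<Rightarrow> 'a \<Rightarrow> nat list \<Rightarrow> 'a list \<Rightarrow> 'a list \<Rightarrow> bool" where
  "related u u' z [] as as' \<longleftrightarrow> (\<exists>a. as = [a] \<and> as' = [z * a])"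
| "related u u' z (n # ns) as as' \<longleftrightarrow> (\<exists>a bs b bs'. as = a # bs \<and> as' = (z * a * iv b) # bs' \<and>
     commute b u \<and> related u u' (iv u' ^ n * b * u ^ n) ns bs bs')"

lemma steep_big:
  assumes "steep c ns" "n \<in> set ns" "200 * C \<le> c" "0 \<le> M" "M \<le> 2 * t"
  shows "100 * (int C * M) \<le> int n * t"
proof -
  have "c \<le> n" using steep_le assms by blast
  then have n: "200 * int C \<le> int n" using assms(3) by linarith
  have "200 * int C * M \<le> int n * M" using n assms by (intro mult_right_mono) auto
  also have "\<dots> \<le> int n * (2 * t)" using assms by (intro mult_left_mono) auto
  finally have "200 * int C * M \<le> int n * (2 * t)" .
  moreover have "200 * int C * M = 2 * (100 * (int C * M))" "int n * (2 * t) = 2 * (int n * t)" by simp_all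
  ultimately show ?thesis by linarith
qed

text \<open>Read backwards from the turn of the axis, both alternating words lead to the same point \<open>e\<close>, and from the common axis of \<open>u\<close> and \<open>u'\<close> this point is seen
through a gate near \<open>p\<close> and through a gate near \<open>p'\<close>. The sum of the two gate inequalities bounds the distance
of \<open>p\<close> and \<open>p'\<close>.\<close>

lemma frames_close:
  assumes uu: "commute u u'" and C: "1 \<le> C" and M: "tlen u \<le> M" "tlen u' \<le> M" "M \<le> 2 * tlen u" "M \<le> 2 * tlen u'"
    and c: "200 * C \<le> c" and f: "frame u p C (a # as)" "frame u' p' C (a' # as')"
    and ns: "steep c ns" and zu: "commute z u" and eq: "a' * zig u' ns as' = z * (a * zig u ns as)"
  shows "dst p p' \<le> 30 * (int C * M)"
proof -
  have fr: "disp u p = tlen u" "disp u' p' = tlen u'" "u \<noteq> 1" "u' \<noteq> 1"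
    using f by (simp_all add: frame_def)
  have u'p: "disp u p' = tlen u" "disp u' p = tlen u'"
    using commute_axis[of u u' p'] commute_axis[of u' u p] uu fr by (simp_all add: commute_sym)
  have zu': "commute z u'" using commute_trans[of z u u'] uu fr zu by (simp add: commute_sym)
  define B where "B = int C * M"
  have M1: "1 \<le> M" using tlen_pos[OF fr(3)] M by linarith
  have MB: "M \<le> B" using mult_right_mono[of 1 "int C" M] C M1 by (simp add: B_def)
  have B1: "1 \<le> B" using MB M1 by simp
  have CB: "int C * tlen u \<le> B" "int C * tlen u' \<le> B" using M unfolding B_def by (simp_all add: mult_left_mono)
  have big: "\<forall>k \<in> set ns. 100 * B \<le> int k * tlen u" "\<forall>k \<in> set ns. 100 * B \<le> int k * tlen u'"
    using steep_big[OF ns _ c, of _ M] M M1 by (simp_all add: B_def)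
  define e where "e = iv (a * zig u ns as) * p"
  have "turning u B p (iv a * p)"
    by (rule turning.base) (use f CB fr M MB in \<open>auto simp: frame_Cons\<close>)
  then have "turning u B p (iv (zig u ns as) * (iv a * p))"
    by (rule turning_zig_inverse[rotated 3]) (use f CB big in \<open>auto simp: frame_Cons\<close>)
  then have t1: "turning u B p e" by (simp add: e_def mult.assoc)
  have e': "e = iv (zig u' ns as') * (iv a' * (z * p))"
  proof -
    have "iv (a' * zig u' ns as') * (z * p) = e" unfolding eq e_def by (simp add: mult.assoc)
    then show ?thesis by (simp add: mult.assoc)
  qed
  have "turning u' B p' (iv a' * (z * p))"
    by (rule turning.base) (use f CB fr u'p M MB zu' in \<open>auto simp: frame_Cons disp_shift commute_sym[of u' z]\<close>)
  then have t2: "turning u' B p' e" unfolding e'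
    by (rule turning_zig_inverse[rotated 3]) (use f CB big in \<open>auto simp: frame_Cons\<close>)
  have "dst p p' + dst p e - dst p' e \<le> 30 * B"
    using gate_turning[OF t1 B1, of p'] fr u'p M MB by simp
  moreover have "dst p' p + dst p' e - dst p e \<le> 30 * B"
    using gate_turning[OF t2 B1, of p] fr u'p M MB by simp
  ultimately show ?thesis by (simp add: dst_sym B_def)
qed

text \<open>The two words agree up to the offset \<open>z\<close>. The same gate argument, now read forwards, bounds \<open>z\<close>. Then the next stretches of the two
paths start close together and, all later exponents being much smaller, end close together, so their translations commute and
the next offset again lies in the centralizer of \<open>u\<close>.\<close>

lemma unpeel:
  assumes uu: "commute u u'" and C: "1 \<le> C" and M: "tlen u \<le> M" "tlen u' \<le> M" "M \<le> 2 * tlen u" "M \<le> 2 * tlen u'"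
    and pp: "dst p p' \<le> 30 * (int C * M)" and c: "2000 * C \<le> c"
  shows "\<lbrakk>frame u p C (a # as); frame u' p' C (a' # as'); length as = length ns; length as' = length ns;
    steep c ns; commute z u; a' * zig u' ns as' = z * (a * zig u ns as)\<rbrakk>
    \<Longrightarrow> related u u' z ns (a # as) (a' # as')"
proof (induction ns arbitrary: a as a' as' z)
  case Nil
  then show ?case by simp
next
  case (Cons n ns)
  obtain a2 as2 where as: "as = a2 # as2" "length as2 = length ns" using Cons.prems(3) by (cases as) auto
  obtain a2' as2' where as': "as' = a2' # as2'" "length as2' = length ns" using Cons.prems(4) by (cases as') auto
  have fr: "disp u p = tlen u" "disp u' p' = tlen u'" "u \<noteq> 1" "u' \<noteq> 1"
    using Cons.prems by (simp_all add: frame_def)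
  have u'p: "disp u p' = tlen u" using commute_axis[of u u' p'] uu fr by simp
  have zu': "commute z u'" using commute_trans[of z u u'] uu fr Cons.prems(6) by (simp add: commute_sym)
  define B where "B = int C * M"
  have M1: "1 \<le> M" using tlen_pos[OF fr(3)] M by linarith
  have MB: "M \<le> B" using mult_right_mono[of 1 "int C" M] C M1 by (simp add: B_def)
  have B1: "1 \<le> B" using MB M1 by simp
  have CB: "int C * tlen u \<le> B" "int C * tlen u' \<le> B" using M unfolding B_def by (simp_all add: mult_left_mono)
  have big: "100 * B \<le> int k * tlen u" "100 * B \<le> int k * tlen u'" if "k \<in> set (n # ns)" for k
    using steep_big[OF Cons.prems(5) that, of C M] c M M1 by (simp_all add: B_def)
  define S where "S = a * zig u (n # ns) as"
  define S' where "S' = a' * zig u' (n # ns) as'"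
  have SS: "S' = z * S" using Cons.prems by (simp add: S_def S'_def)
  have pp': "dst p p' \<le> 30 * B" using pp by (simp add: B_def)
  \<comment> \<open>two gates for the same point, near \<open>p'\<close> and near \<open>z * p\<close>\<close>
  have t1: "turning u B p (S * p')" unfolding S_def
    by (rule turning_zig[of u p C]) (use Cons.prems CB big u'p M MB in auto)
  have t2: "turning u' B p' (S' * p')" unfolding S'_def
    by (rule turning_zig[of u' p' C]) (use Cons.prems CB big fr M MB in auto)
  have "disp u' (z * p) = tlen u'"
    using commute_axis[of u' u p] uu fr zu' by (simp add: disp_shift commute_sym)
  then have g1: "dst p' (z * p) + dst p' (S' * p') - dst (z * p) (S' * p') \<le> 30 * B"
    using gate_turning[OF t2 B1, of "z * p"] fr M MB by simp
  have "disp u (iv z * p') = tlen u" using u'p Cons.prems(6) by (simp add: disp_shift commute_sym)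
  then have "dst p (iv z * p') + dst p (S * p') - dst (iv z * p') (S * p') \<le> 30 * B"
    using gate_turning[OF t1 B1, of "iv z * p'"] fr M MB by simp
  moreover have "dst p (iv z * p') = dst (z * p) p'" "dst p (S * p') = dst (z * p) (S' * p')"
    "dst (iv z * p') (S * p') = dst p' (S' * p')"
    using dst_left[of z p "iv z * p'"] dst_left[of z p "S * p'"] dst_left[of z "iv z * p'" "S * p'"]
    by (simp_all add: SS mult.assoc)
  ultimately have zp': "dst p' (z * p) \<le> 30 * B" using g1 by (simp add: dst_sym)
  then have zp: "disp z p \<le> 60 * B" using dst_tri[of p "z * p" p'] pp' by (simp add: disp_def)
  define S1 where "S1 = a2 * zig u ns as2"
  define S1' where "S1' = a2' * zig u' ns as2'"
  have Seq: "S = a * (u ^ n * S1)" "S' = a' * (u' ^ n * S1')"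
    by (simp_all add: S_def S'_def S1_def S1'_def as as' mult.assoc)
  define e where "e = int (sum_list ns) + (int (length ns) + 1) * int C"
  have fa: "frame u p C (a2 # as2)" "frame u' p' C (a2' # as2')"
    using Cons.prems by (simp_all add: as as' frame_Cons)
  have e0: "0 \<le> e" by (simp add: e_def)
  have S1: "disp S1 p \<le> e * M"
  proof -
    have "disp S1 p \<le> e * tlen u"
      using disp_mult[of a2 "zig u ns as2" p] disp_zig[of u p C as2 ns] fa
      by (simp add: S1_def e_def frame_Cons algebra_simps)
    also have "\<dots> \<le> e * M" using e0 M by (intro mult_left_mono)
    finally show ?thesis .
  qed
  have S1': "disp S1' p' \<le> e * M"
  proof -
    have "disp S1' p' \<le> e * tlen u'"
      using disp_mult[of a2' "zig u' ns as2'" p'] disp_zig[of u' p' C as2' ns] fa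
      by (simp add: S1'_def e_def frame_Cons algebra_simps)
    also have "\<dots> \<le> e * M" using e0 M by (intro mult_left_mono)
    finally show ?thesis .
  qed
  \<comment> \<open>the translations along the next stretches; both are small at \<open>p\<close> and at the far point \<open>m\<close>\<close>
  define h where "h = z * a"
  define g where "g = h * u * iv h"
  define g' where "g' = a' * u' * iv a'"
  have ha: "disp a p \<le> B" "disp a' p' \<le> B" using Cons.prems CB by (auto simp: frame_Cons)
  have hp: "disp h p \<le> 61 * B" using disp_mult[of z a p] zp ha by (simp add: h_def)
  have conj: "disp (f * w * iv f) x \<le> disp w x + 2 * disp f x" for f w x :: 'a
  proof -
    have "dst x (iv f * x) = dst x (f * x)" using disp_iv[of f x] unfolding disp_def .
    then show ?thesis using disp_move[of w "iv f * x" x]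
      by (simp add: disp_conj disp_def[of f] dst_sym[of "iv f * x" x])
  qed
  have gp: "disp g p \<le> 123 * B" using conj[of h u p] hp fr M MB by (simp add: g_def)
  have "disp a' p \<le> 61 * B" using disp_move[of a' p p'] ha pp' by (simp add: dst_sym)
  moreover have "disp u' p = tlen u'" using commute_axis[of u' u p] uu fr by (simp add: commute_sym)
  ultimately have g'p: "disp g' p \<le> 123 * B" using conj[of a' u' p] M MB by (simp add: g'_def)
  define m where "m = h * (u ^ n * p)"
  define m' where "m' = a' * (u' ^ n * p')"
  have gm: "disp g m \<le> B" using fr M MB by (simp add: g_def m_def disp_conj disp_shift commute_power)
  have g'm': "disp g' m' \<le> B" using fr M MB by (simp add: g'_def m'_def disp_conj disp_shift commute_power)
  have "dst m (S' * p) \<le> e * M" using S1 by (simp add: m_def SS Seq h_def mult.assoc disp_def)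
  moreover have "dst (S' * p') m' \<le> e * M" using S1' by (simp add: m'_def Seq mult.assoc disp_def dst_sym)
  ultimately have mm: "dst m m' \<le> 2 * (e * M) + 30 * B"
    using dst_tri[of m m' "S' * p"] dst_tri[of "S' * p" m' "S' * p'"] pp' by simp
  have g'm: "disp g' m \<le> 61 * B + 4 * (e * M)" using disp_move[of g' m m'] g'm' mm by (simp add: dst_sym)
  have "int n * tlen u \<le> disp (u ^ n) p" by (rule disp_power_ge)
  also have "disp (u ^ n) p \<le> disp (iv h) p + disp (h * u ^ n) p"
    using disp_mult[of "iv h" "h * u ^ n" p] by simp
  finally have pm: "int n * tlen u - 61 * B \<le> dst p m"
    using hp by (simp add: m_def disp_def[of "h * u ^ n"] mult.assoc)
  have n: "1110 * int C + 32 * e + 4 < int n"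
  proof -
    have "2000 * C * (sum_list ns + length ns + 1) \<le> c * (sum_list ns + length ns + 1)"
      using c by (intro mult_right_mono) auto
    also have "\<dots> \<le> n" using Cons.prems by simp
    finally have "int (2000 * C * (sum_list ns + length ns + 1)) \<le> int n" by (simp only: of_nat_le_iff)
    then have "2000 * (int C * int (sum_list ns)) + 2000 * (int C * (int (length ns) + 1)) \<le> int n"
      by (simp add: algebra_simps)
    moreover have "int (sum_list ns) \<le> int C * int (sum_list ns)" using C mult_right_mono[of 1 "int C" "int (sum_list ns)"] by simp
    moreover have "int C \<le> int C * (int (length ns) + 1)" by (simp add: algebra_simps)
    moreover have "e = int (sum_list ns) + int C * (int (length ns) + 1)" by (simp add: e_def algebra_simps)
    ultimately show ?thesis using C by linarith
  qed
  have "4 * (123 * B + 4 * (e * M)) + 2 < dst p m"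
  proof -
    have "(1110 * int C + 32 * e + 4) * tlen u < int n * tlen u"
      using n tlen_pos[OF fr(3)] by (intro mult_strict_right_mono) auto
    moreover have "(555 * int C + 16 * e + 2) * M \<le> (555 * int C + 16 * e + 2) * (2 * tlen u)"
      using M e0 by (intro mult_left_mono) auto
    ultimately have "555 * B + 16 * (e * M) + 2 * M < int n * tlen u" by (simp add: B_def algebra_simps)
    moreover have "4 * (123 * B + 4 * (e * M)) = 492 * B + 16 * (e * M)" by simp
    ultimately show ?thesis using pm MB B1 M1 by linarith
  qed
  moreover have "0 \<le> e * M" using e0 M1 by simp
  ultimately have "commute g g'"
    by (intro small_displacement_commute[of g p "123 * B + 4 * (e * M)" g' m]) (use gp g'p gm g'm B1 in linarith)+
  define b where "b = iv a' * h"
  have "commute (iv a' * g * iv (iv a')) (iv a' * g' * iv (iv a'))" using \<open>commute g g'\<close> by (simp only: commute_conj)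
  then have "commute (b * u * iv b) u'" by (simp add: g_def g'_def b_def mult.assoc)
  then have bu: "commute b u" using commute_conj_gen[of b u u'] uu fr by blast
  define z2 where "z2 = iv u' ^ n * b * u ^ n"
  have z2u: "commute z2 u"
    unfolding z2_def using bu uu commute_power[of u "iv u'" n] commute_power[of u u n]
    by (auto simp: commute_sym[of _ u] intro!: commute_mult)
  have "h * (u ^ n * S1) = a' * (u' ^ n * S1')" using SS by (simp add: Seq h_def mult.assoc)
  then have "iv u' ^ n * (iv a' * (h * (u ^ n * S1))) = S1'"
    by (simp add: iv_power[symmetric])
  then have eq: "S1' = z2 * S1" by (simp add: z2_def b_def mult.assoc)
  have "related u u' z2 ns (a2 # as2) (a2' # as2')"
    by (rule Cons.IH) (use fa as as' Cons.prems z2u eq in \<open>simp_all add: S1_def S1'_def\<close>)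
  moreover have "a' = z * a * iv b" by (simp add: b_def h_def mult.assoc)
  ultimately show ?case using bu by (auto simp: as as' z2_def)
qed


section \<open>Recovering the letters of an alternating word\<close>

text \<open>The points \<open>p\<close> and \<open>p'\<close> are near the axis of \<open>W\<close> and less than about half a period apart, \<open>p'\<close> lying ahead of \<open>p\<close>. Then the segment from \<open>p'\<close> to
\<open>W * p\<close> is contained, up to a small error, both in the segment from \<open>p\<close> to \<open>W * p\<close>, where \<open>u\<close> is small, and in the one from
\<open>p'\<close> to \<open>W * p'\<close>, where \<open>u'\<close> is small.\<close>

lemma overlap_commute_aux:
  assumes E: "1 \<le> E" and T: "T = tlen W" "19000 * E \<le> T"
    and p: "disp u p \<le> E" "disp u (W * p) \<le> 3 * E" "disp W p \<le> T + 36 * E"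
    and p': "disp u' p' \<le> E" "disp u' (W * p') \<le> 3 * E" "disp W p' \<le> T + 36 * E"
    and min: "dst p p' \<le> dst (W * p) p'" and le: "dst (W * p) p' \<le> dst p (W * p')"
  shows "commute u u'"
proof -
  define D where "D = dst p p'"
  define D1 where "D1 = dst (W * p) p'"
  define D2 where "D2 = dst p (W * p')"
  have l: "dst p (W * p) \<le> T + 36 * E" "dst p' (W * p') \<le> T + 36 * E" "T \<le> dst p (W * p)" "T \<le> dst p' (W * p')"
    using p p' T tlen_le_disp[of W p] tlen_le_disp[of W p'] by (simp_all add: disp_def)
  have w: "dst (iv W * p') p' = dst p' (W * p')" "dst p (iv W * p') = D1"
    using dst_left[of W "iv W * p'" p'] dst_left[of W p "iv W * p'"] by (simp_all add: D1_def)
  have "dst (iv W * p') (W * p') = disp (W ^ 2) p'"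
    using dst_left[of W "iv W * p'" "W * p'"] by (simp add: disp_def power2_eq_square mult.assoc)
  then have w2: "2 * T \<le> dst (iv W * p') (W * p')" using disp_power_ge[of 2 W p'] T by simp
  have a1: "D1 + D2 \<le> dst p (W * p) + dst p' (W * p') \<or> D1 + D2 \<le> 2 * D"
    using dst_four[of p "W * p'" "W * p" p'] dst_sym[of "W * p'" p'] dst_sym[of "W * p'" "W * p"]
    unfolding D_def D1_def D2_def by (simp add: max_def split: if_splits)
  have a2: "D + 2 * T \<le> D2 + (T + 36 * E)"
    using dst_four[of p p' "iv W * p'" "W * p'"] w w2 l le
      dst_sym[of p' "iv W * p'"]
    unfolding D_def D1_def D2_def by linarith
  have D12: "D \<le> D1" using min by (simp add: D_def D1_def)
  have D1: "D1 + D \<le> T + 108 * E" using a1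
  proof
    assume "D1 + D2 \<le> dst p (W * p) + dst p' (W * p')"
    then show ?thesis using a2 l by linarith
  next
    assume "D1 + D2 \<le> 2 * D"
    then show ?thesis using a2 D12 T E by linarith
  qed
  have D1': "T \<le> D + D1" using dst_tri[of p "W * p" p'] l dst_sym[of p' "W * p"] by (simp add: D_def D1_def)
  have far: "4 * (111 * E) + 2 < dst p' (W * p)"
    using D1' D12 T E dst_sym[of p' "W * p"] by (simp add: D_def D1_def)
  have "disp u p' \<le> 111 * E"
    using disp_le_between[of u p' p "W * p"] p D1 l E dst_sym[of p' p] dst_sym[of p' "W * p"]
    unfolding D_def D1_def by linarith
  moreover have "disp u' (W * p) \<le> 111 * E"
    using disp_le_between[of u' "W * p" p' "W * p'"] p' D1 l E
    unfolding D_def D1_def by (simp add: max_def split: if_splits)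
  ultimately show ?thesis
    by (intro small_displacement_commute[OF _ _ _ _ far]) (use p p' E in linarith)+
qed

text \<open>Most of a period of \<open>W\<close> is covered by \<open>u ^ n\<close> and likewise by \<open>u' ^ n\<close>. This makes the translation lengths comparable, and the previous
lemma applies, with the roles of the two sides exchanged if \<open>p\<close> lies ahead of \<open>p'\<close>.\<close>

lemma overlap_commute:
  assumes W: "W = u ^ n * r" "W = u' ^ n * r'" and ne: "u \<noteq> 1" "u' \<noteq> 1"
    and p: "disp u p = tlen u" "disp r p \<le> e * tlen u"
    and p': "disp u' p' = tlen u'" "disp r' p' \<le> e * tlen u'"
    and n: "1 \<le> e" "20000 * e \<le> int n"
    and min: "dst p p' \<le> dst (W * p) p'" "dst p p' \<le> dst p (W * p')"
  shows "tlen u \<le> 2 * tlen u'" "tlen u' \<le> 2 * tlen u" "commute u u'"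
proof -
  have *: "(int n - 35 * e) * tlen w \<le> tlen W" "disp W q \<le> (int n + e) * tlen w"
    "disp w q \<le> e * tlen w" "disp w (W * q) \<le> 3 * (e * tlen w)" "0 < tlen w"
    if "W = w ^ n * s" "w \<noteq> 1" "disp w q = tlen w" "disp s q \<le> e * tlen w" for w s q
  proof -
    show t: "0 < tlen w" using tlen_pos[OF that(2)] by simp
    have et: "tlen w \<le> e * tlen w" using n t by simp
    have "20000 * e * tlen w \<le> int n * tlen w" using n t by (intro mult_right_mono) auto
    then have "35 * (e * tlen w) < int n * tlen w" using et t by (simp add: mult.assoc)
    then have "int n * tlen w - 35 * (e * tlen w) \<le> tlen W"
      using tlen_power_mult[of "e * tlen w" w q s n] that et t by simp
    then show "(int n - 35 * e) * tlen w \<le> tlen W" by (simp add: algebra_simps)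
    show "disp W q \<le> (int n + e) * tlen w"
      using disp_mult[of "w ^ n" s q] disp_power_axis[OF that(3), of n] that by (simp add: algebra_simps)
    show "disp w q \<le> e * tlen w" using that et by simp
    have "disp w (W * q) = disp w (s * q)"
      using disp_shift[of w "w ^ n" "s * q"] by (simp add: that(1) mult.assoc commute_power)
    also have "\<dots> \<le> tlen w + 2 * (e * tlen w)" using disp_move[of w "s * q" q] that by (simp add: disp_def)
    finally show "disp w (W * q) \<le> 3 * (e * tlen w)" using et by simp
  qed
  note X = *[OF W(1) ne(1) p] and Y = *[OF W(2) ne(2) p']
  have half: "tlen w \<le> 2 * tlen w'"
    if "(int n - 35 * e) * tlen w \<le> tlen W" "tlen W \<le> (int n + e) * tlen w'" "0 < tlen w'" for w w' :: 'a
  proof -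
    have "(int n + e) * tlen w' \<le> ((int n - 35 * e) * 2) * tlen w'"
      using n that by (intro mult_right_mono) auto
    also have "((int n - 35 * e) * 2) * tlen w' = (int n - 35 * e) * (2 * tlen w')" by (simp only: mult.assoc)
    finally have "(int n - 35 * e) * tlen w \<le> (int n - 35 * e) * (2 * tlen w')" using that by linarith
    then show ?thesis by (rule mult_left_le_imp_le) (use n in linarith)
  qed
  have TX: "tlen W \<le> (int n + e) * tlen u" using X(2) tlen_le_disp[of W p] by linarith
  have TY: "tlen W \<le> (int n + e) * tlen u'" using Y(2) tlen_le_disp[of W p'] by linarith
  show h: "tlen u \<le> 2 * tlen u'" "tlen u' \<le> 2 * tlen u"
    using half[OF X(1) TY Y(5)] half[OF Y(1) TX X(5)] by auto
  define E where "E = e * max (tlen u) (tlen u')"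
  have eE: "e * tlen u \<le> E" "e * tlen u' \<le> E" using n by (auto simp: E_def)
  have E1: "1 \<le> E" using eE n X(5) mult_mono[of 1 e 1 "tlen u"] by linarith
  have "tlen W + 36 * E \<ge> disp W p" "tlen W + 36 * E \<ge> disp W p'"
    using X(1,2) Y(1,2) eE by (simp_all add: algebra_simps)
  moreover have "19000 * E \<le> tlen W"
  proof -
    have "(int n - 35 * e) * max (tlen u) (tlen u') \<le> tlen W" using X(1) Y(1) by (simp add: max_def)
    moreover have "19000 * e * max (tlen u) (tlen u') \<le> (int n - 35 * e) * max (tlen u) (tlen u')"
      using n X(5) by (intro mult_right_mono) auto
    ultimately show ?thesis by (simp add: E_def mult.assoc)
  qed
  moreover have b: "disp u p \<le> E" "disp u (W * p) \<le> 3 * E" "disp u' p' \<le> E" "disp u' (W * p') \<le> 3 * E"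
    using X Y eE by linarith+
  ultimately show "commute u u'"
    using overlap_commute_aux[of E "tlen W" W u p u' p'] overlap_commute_aux[of E "tlen W" W u' p' u p]
      min E1 dst_sym[of "W * p'" p] dst_sym[of "W * p" p'] dst_sym[of p' p]
    by (cases "dst (W * p) p' \<le> dst p (W * p')") (simp_all add: commute_sym dst_sym)
qed

definition triples :: "'b list \<Rightarrow> 'b list" where
  "triples gs = concat (map (\<lambda>g. [g, g, g]) gs)"

lemma triples_simps [simp]: "triples [] = []" "triples (g # gs) = g # g # g # triples gs"
  by (simp_all add: triples_def)

lemma set_triples [simp]: "set (triples gs) = set gs"
  by (induction gs) auto

lemma length_triples [simp]: "length (triples gs) = 3 * length gs"
  by (induction gs) auto

lemma map_triples: "map f (triples gs) = triples (map f gs)"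
  by (induction gs) auto

text \<open>Outside the centralizer of \<open>u\<close>, the double cosets of this centralizer are parametrized freely by its pairs of elements.\<close>

lemma two_sided_cancel:
  assumes nc: "\<not> commute g u" and c: "commute z u" "commute z2 u" "commute b u" "commute b2 u"
    and eq: "z * g * iv b = z2 * g * iv b2"
  shows "z = z2 \<and> b = b2"
proof -
  define w where "w = iv z2 * z"
  have w: "commute w u" unfolding w_def using c by (auto simp: commute_sym[of _ u] intro!: commute_mult)
  have "iv g * (iv z2 * (z * g * iv b)) * b = iv g * (iv z2 * (z2 * g * iv b2)) * b" by (simp only: eq)
  then have e: "iv g * w * iv (iv g) = iv b2 * b" by (simp add: w_def mult.assoc)
  have "w = 1"
  proof (rule ccontr)
    assume "w \<noteq> 1"
    moreover have "commute (iv g * w * iv (iv g)) u"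
      unfolding e using c by (auto simp: commute_sym[of _ u] intro!: commute_mult)
    moreover have "u \<noteq> 1" using nc by auto
    ultimately have "commute (iv g) w" using commute_conj_gen w by blast
    then have "commute g u" using commute_trans[of g w u] w \<open>w \<noteq> 1\<close> by (simp add: commute_sym)
    then show False using nc by simp
  qed
  then have "z2 * (iv z2 * z) = z2" "b2 * (iv b2 * b) = b2" using e by (simp_all add: w_def)
  then show ?thesis by simp
qed

lemma related_Nil [simp]: "\<not> related u u' z ns [] as'"
  by (cases ns) auto

lemma related_same:
  assumes "related u u z ns (triples gs) (triples gs')" "commute z u" "gs \<noteq> []" "length gs = length gs'"
    "\<forall>g \<in> set gs. \<not> commute g u"
  shows "z = 1 \<and> gs' = gs"
  using assms
proof (induction gs arbitrary: z ns gs')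
  case (Cons g gs)
  obtain g' gs2 where gs': "gs' = g' # gs2" using Cons.prems by (cases gs') auto
  have cc: "iv u ^ n * b * u ^ n = b" if "commute b u" for b n
    using commute_power[OF that, of n] by (simp add: commute_def iv_power[symmetric] mult.assoc)
  have nc: "\<not> commute g u" using Cons.prems by simp
  obtain n2 ns2 where ns: "ns = n2 # ns2" using Cons.prems(1) by (cases ns) (auto simp: gs')
  obtain b where b: "g' = z * g * iv b" "commute b u" "related u u b ns2 (g # g # triples gs) (g' # g' # triples gs2)"
    using Cons.prems(1) cc by (auto simp: gs' ns)
  obtain n3 ns3 where ns2: "ns2 = n3 # ns3" using b(3) by (cases ns2) auto
  obtain b2 where b2: "g' = b * g * iv b2" "commute b2 u" "related u u b2 ns3 (g # triples gs) (g' # triples gs2)"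
    using b(3) cc by (auto simp: ns2)
  have zb: "z = b" "b = b2" using two_sided_cancel[OF nc Cons.prems(2) b(2) b(2) b2(2)] b b2 by auto
  show ?case
  proof (cases gs)
    case Nil
    then have "g' = b2 * g" using b2(3) Cons.prems(4) by (cases ns3) (auto simp: gs')
    then have "b * g * iv b2 = b2 * g * iv 1" using b2(1) by simp
    then have "b2 = 1" using two_sided_cancel[OF nc b(2) b2(2) b2(2)] by auto
    then show ?thesis using zb b2 Cons.prems(4) Nil by (simp add: gs')
  next
    case (Cons h hs)
    then obtain n4 ns4 where ns3: "ns3 = n4 # ns4" using b2(3) by (cases ns3) auto
    obtain b3 where b3: "g' = b2 * g * iv b3" "commute b3 u" "related u u b3 ns4 (triples gs) (triples gs2)"
      using b2(3) cc by (auto simp: ns3)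
    have "b2 = b3" using two_sided_cancel[OF nc b(2) b2(2) b2(2) b3(2)] b2 b3 by auto
    moreover have "b3 = 1 \<and> gs2 = gs"
      by (rule Cons.IH[OF b3(3)]) (use Cons.prems b3 Cons in \<open>auto simp: gs'\<close>)
    ultimately show ?thesis using zb b2 by (simp add: gs')
  qed
qed simp


lemma power_mult_commuting: "commute x y \<Longrightarrow> (x * y) ^ n = x ^ n * y ^ n"
proof (induction n)
  case (Suc n)
  have "y * x ^ n = x ^ n * y" using commute_power[of y x n] Suc.prems by (simp add: commute_def)
  then have "y * (x ^ n * z) = x ^ n * (y * z)" for z by (simp flip: mult.assoc)
  then show ?case using Suc by (simp add: mult.assoc)
qed simp

lemma commute_powers_eq:
  assumes c: "commute u u'" "commute b u" "u \<noteq> 1" "u' \<noteq> 1"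
    and eq: "iv u' ^ n * b * u ^ n = iv u' ^ m * b * u ^ m" and nm: "m < n"
  shows "u' = u"
proof -
  define l where "l = iv u' * u"
  have uu: "u * iv u' = iv u' * u" using c commute_iv[of u u'] by (simp add: commute_def)
  have bu': "commute b (iv u')" using commute_trans[of b u u'] c by (simp add: commute_sym)
  have e: "iv u' ^ k * b * u ^ k = b * l ^ k" for k
  proof -
    have "iv u' ^ k * b = b * iv u' ^ k" using commute_power[OF bu', of k] by (simp add: commute_def)
    moreover have "(iv u' * u) ^ k = iv u' ^ k * u ^ k"
      by (rule power_mult_commuting) (use uu in \<open>simp add: commute_def\<close>)
    ultimately show ?thesis by (simp add: l_def mult.assoc)
  qed
  have "l ^ n = l ^ m" using eq by (simp add: e)
  moreover have "l ^ n = l ^ m * l ^ (n - m)" using nm by (simp flip: power_add)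
  ultimately have "l ^ m * l ^ (n - m) = l ^ m * 1" by simp
  then have "l ^ (n - m) = 1" by (simp only: cancel_left)
  then have "l = 1" using power_eq_one[of l "n - m"] nm by simp
  then have "u' * (iv u' * u) = u' * 1" by (simp only: l_def)
  then show ?thesis by simp
qed

text \<open>Equal letters at consecutive places have equal offsets by \<open>two_sided_cancel\<close>. The second and third occurrence of the first letter
therefore give \<open>(iv u' * u) ^ n2 = (iv u' * u) ^ n3\<close> with different exponents, whence \<open>u' = u\<close>; from then
on the offset is the same everywhere, and the last one is trivial.\<close>

lemma related_triples:
  assumes r: "related u u' z ns (triples gs) (triples gs')" and z: "commute z u" and gs: "gs \<noteq> []" "length gs = length gs'"
    and nc: "\<forall>g \<in> set gs. \<not> commute g u" and uu: "commute u u'" "u' \<noteq> 1" and ns: "steep c ns" "1 \<le> c"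
  shows "gs' = gs"
proof -
  obtain g gs2 where g: "gs = g # gs2" using gs by (cases gs) auto
  obtain g' gs2' where g': "gs' = g' # gs2'" using gs g by (cases gs') auto
  have ncg: "\<not> commute g u" using nc g by simp
  then have u1: "u \<noteq> 1" by auto
  have cc: "commute (iv u' ^ n * b * u ^ n) u" if "commute b u" for b n
    using that uu commute_power[of u "iv u'" n] commute_power[of u u n]
    by (auto simp: commute_sym[of _ u] intro!: commute_mult)
  obtain n2 ns2 where n2: "ns = n2 # ns2" using r by (cases ns) (auto simp: g g')
  obtain b where b: "g' = z * g * iv b" "commute b u"
    "related u u' (iv u' ^ n2 * b * u ^ n2) ns2 (g # g # triples gs2) (g' # g' # triples gs2')"
    using r by (auto simp: g g' n2)
  obtain n3 ns3 where n3: "ns2 = n3 # ns3" using b(3) by (cases ns2) auto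
  obtain b2 where b2: "g' = iv u' ^ n2 * b * u ^ n2 * g * iv b2" "commute b2 u"
    "related u u' (iv u' ^ n3 * b2 * u ^ n3) ns3 (g # triples gs2) (g' # triples gs2')"
    using b(3) by (auto simp: n3)
  obtain b3 where b3: "g' = iv u' ^ n3 * b2 * u ^ n3 * g * iv b3" "commute b3 u"
  proof (cases ns3)
    case Nil
    then show ?thesis using b2(3) that[of 1] by auto
  next
    case (Cons n4 ns4)
    then show ?thesis using b2(3) that by auto
  qed
  have 1: "iv u' ^ n2 * b * u ^ n2 = z" "b2 = b"
    using two_sided_cancel[OF ncg cc[OF b(2)] z b2(2) b(2)] b b2 by auto
  have 2: "iv u' ^ n2 * b * u ^ n2 = iv u' ^ n3 * b2 * u ^ n3"
    using two_sided_cancel[OF ncg cc[OF b(2)] cc[OF b2(2)] b2(2) b3(2)] b2 b3 by auto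
  have "n3 < n2"
  proof -
    have "c * (n3 + sum_list ns3 + length ns2 + 1) \<le> n2" using ns n2 n3 by simp
    moreover have "n3 < 1 * (n3 + sum_list ns3 + length ns2 + 1)" by simp
    then have "n3 < c * (n3 + sum_list ns3 + length ns2 + 1)" using ns by (meson less_le_trans mult_le_mono1)
    ultimately show ?thesis by linarith
  qed
  then have "u' = u"
    by (intro commute_powers_eq[OF uu(1) b(2) u1 uu(2), of n2 n3]) (use 1 2 in simp_all)
  then show ?thesis using related_same[of u z ns gs gs'] assms by blast
qed

text \<open>An alternating word with steep exponents determines its letters up to conjugation by a power of its value. That the conjugator is
such a power keeps it inside every subgroup that contains the letters.\<close>

theorem zig_rigid:
  assumes C: "1 \<le> C" and c: "40000 * C \<le> c" and ns: "steep c ns" "length ns = 3 * length gs"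
    and gs: "gs \<noteq> []" "length gs = length gs'"
    and f: "frame u p C (triples gs)" and f': "frame u' p' C (triples gs')"
    and W: "zig u ns (triples gs) = zig u' ns (triples gs')"
  shows "\<exists>i j s. s = zig u ns (triples gs) ^ i * iv (zig u ns (triples gs)) ^ j \<and> gs' = map (\<lambda>g. s * g * iv s) gs"
proof -
  define W where "W = zig u ns (triples gs)"
  obtain n ms where n: "ns = n # ms" using ns gs by (cases ns) auto
  obtain g gs2 where g: "gs = g # gs2" using gs by (cases gs) auto
  \<comment> \<open>the translate of the second frame by a power of \<open>W\<close> that is closest to \<open>p\<close>\<close>
  define P where "P x \<longleftrightarrow> (\<exists>i j. x = W ^ i * iv W ^ j)" for x
  have P1: "P 1" unfolding P_def by (intro exI[of _ 0]) simp
  obtain x where x: "P x" "\<And>y. P y \<Longrightarrow> dst p (x * p') \<le> dst p (y * p')"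
    using ex_least_int[of P 1 "\<lambda>y. dst p (y * p')"] P1 by auto
  obtain i j where ij: "x = W ^ i * iv W ^ j" using x(1) by (auto simp: P_def)
  have xW: "commute x W" unfolding ij
    by (auto simp: commute_sym[of _ W] intro!: commute_mult commute_power)
  have "P (W * x)" unfolding P_def ij by (intro exI[of _ "Suc i"] exI[of _ j]) (simp add: mult.assoc)
  then have min1: "dst p (x * p') \<le> dst p (W * (x * p'))" using x(2)[of "W * x"] by (simp add: mult.assoc)
  have "iv W * x = x * iv W" using xW commute_iv[of x W] by (simp add: commute_def)
  then have "P (iv W * x)" unfolding P_def ij
    by (intro exI[of _ i] exI[of _ "Suc j"]) (simp add: mult.assoc power_commutes)
  then have "dst p (x * p') \<le> dst p (iv W * (x * p'))" using x(2)[of "iv W * x"] by (simp add: mult.assoc)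
  then have min2: "dst p (x * p') \<le> dst (W * p) (x * p')"
    using dst_left[of W p "iv W * (x * p')"] by simp
  define v where "v = x * u' * iv x"
  define q where "q = x * p'"
  define hs where "hs = map (\<lambda>a. x * a * iv x) gs'"
  have fv: "frame v q C (triples hs)"
    using frame_conj[OF f', of x] by (simp add: v_def q_def hs_def map_triples)
  have "zig v ns (triples hs) = x * W * iv x"
    using zig_conj[of x u' ns "triples gs'"] W by (simp add: v_def hs_def map_triples W_def)
  also have "x * W = W * x" using xW by (simp add: commute_def)
  finally have Wv: "zig v ns (triples hs) = W" by (simp add: mult.assoc)
  obtain h hs2 where h: "hs = h # hs2" using gs g by (cases hs) (auto simp: hs_def)
  have len: "length hs2 = length gs2" using gs g h by (metis hs_def length_Cons length_map nat.inject)
  define as where "as = g # g # triples gs2"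
  define bs where "bs = h # h # triples hs2"
  have tr: "triples gs = g # as" "triples hs = h # bs" by (simp_all add: g h as_def bs_def)
  have lens: "length as = length ms" "length bs = length ms"
    using ns gs len by (simp_all add: as_def bs_def n g)
  define r where "r = g * zig u ms as"
  define r' where "r' = h * zig v ms bs"
  have Wr: "W = u ^ n * r" "W = v ^ n * r'"
    using Wv by (simp_all add: W_def n tr r_def r'_def mult.assoc)
  define e where "e = int (sum_list ms) + (int (length ms) + 1) * int C"
  have rp: "disp r p \<le> e * tlen u"
    using disp_mult[of g "zig u ms as" p] disp_zig[of u p C as ms] f
    by (simp add: r_def e_def tr frame_Cons algebra_simps)
  have rq: "disp r' q \<le> e * tlen v"
    using disp_mult[of h "zig v ms bs" q] disp_zig[of v q C bs ms] fv
    by (simp add: r'_def e_def tr frame_Cons algebra_simps)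
  have e1: "1 \<le> e" "20000 * e \<le> int n"
  proof -
    have CL: "int C \<le> int C * (int (length ms) + 1)" by (simp add: algebra_simps)
    have e: "e = int (sum_list ms) + int C * (int (length ms) + 1)" by (simp add: e_def algebra_simps)
    show "1 \<le> e" using e CL C by linarith
    have "20000 * C * (sum_list ms + length ms + 1) \<le> c * (sum_list ms + length ms + 1)"
      using c by (intro mult_right_mono) auto
    also have "\<dots> \<le> n" using ns n by simp
    finally have "int (20000 * C * (sum_list ms + length ms + 1)) \<le> int n" by (simp only: of_nat_le_iff)
    then have "20000 * (int C * int (sum_list ms)) + 20000 * (int C * (int (length ms) + 1)) \<le> int n"
      by (simp add: algebra_simps)
    moreover have "int (sum_list ms) \<le> int C * int (sum_list ms)"
      using C mult_right_mono[of 1 "int C" "int (sum_list ms)"] by simp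
    ultimately show "20000 * e \<le> int n" using e by linarith
  qed
  have fr: "u \<noteq> 1" "v \<noteq> 1" "disp u p = tlen u" "disp v q = tlen v" using f fv by (auto simp: frame_def)
  note ov = overlap_commute[OF Wr fr(1,2,3) rp fr(4) rq e1 min2[folded q_def] min1[folded q_def]]
  define M where "M = max (tlen u) (tlen v)"
  have M: "tlen u \<le> M" "tlen v \<le> M" "M \<le> 2 * tlen u" "M \<le> 2 * tlen v"
    using ov by (auto simp: M_def)
  define z where "z = iv v ^ n * u ^ n"
  have zu: "commute z u" unfolding z_def using ov(3) commute_power[of u "iv v" n] commute_power[of u u n]
    by (auto simp: commute_sym[of _ u] intro!: commute_mult)
  have "iv v ^ n * (u ^ n * r) = iv v ^ n * (v ^ n * r')" using Wr by simp
  then have eq: "h * zig v ms bs = z * (g * zig u ms as)"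
    by (simp add: z_def r_def r'_def iv_power[symmetric] mult.assoc)
  have cC: "200 * C \<le> c" "2000 * C \<le> c" using c by linarith+
  have st: "steep c ms" using ns n by simp
  have close: "dst p q \<le> 30 * (int C * M)"
    by (rule frames_close[OF ov(3) C M cC(1) _ _ st zu eq]) (use f fv tr in simp_all)
  have "related u v z ms (g # as) (h # bs)"
    by (rule unpeel[OF ov(3) C M close cC(2)]) (use f fv tr lens st zu eq in simp_all)
  then have "hs = gs"
  proof (intro related_triples[of u v z ms gs hs c])
    show "related u v z ms (g # as) (h # bs) \<Longrightarrow> related u v z ms (triples gs) (triples hs)" by (simp only: tr)
    show "\<forall>g \<in> set gs. \<not> commute g u" using f by (simp add: frame_def)
    show "length gs = length hs" using gs by (simp add: hs_def)
  qed (use zu gs ov(3) fr st c C in simp_all)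
  then have "gs' = map (\<lambda>g. iv x * g * iv (iv x)) gs"
    by (auto simp: hs_def mult.assoc comp_def intro!: map_idI[symmetric])
  moreover have "iv x = W ^ j * iv W ^ i" by (simp add: ij flip: iv_power)
  ultimately show ?thesis unfolding W_def by blast
qed

text \<open>If the value were 1, then conjugating all letters by \<open>u\<close> would not change it, while the conjugator provided by \<open>zig_rigid\<close> would be trivial.\<close>

corollary zig_ne_one:
  assumes "1 \<le> C" "40000 * C \<le> c" "steep c ns" "length ns = 3 * length gs" "gs \<noteq> []"
    and f: "frame u p C (triples gs)"
  shows "zig u ns (triples gs) \<noteq> 1"
proof
  assume 1: "zig u ns (triples gs) = 1"
  define gs' where "gs' = map (\<lambda>a. u * a * iv u) gs"
  have "zig u ns (triples gs) = zig (u * u * iv u) ns (triples gs')"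
    unfolding gs'_def map_triples[symmetric] zig_conj 1 by simp
  moreover have "frame (u * u * iv u) (u * p) C (triples gs')"
    unfolding gs'_def map_triples[symmetric] by (rule frame_conj[OF f])
  moreover have "length gs = length gs'" by (simp add: gs'_def)
  ultimately have "\<exists>i j s. s = zig u ns (triples gs) ^ i * iv (zig u ns (triples gs)) ^ j \<and> gs' = map (\<lambda>g. s * g * iv s) gs"
    by (intro zig_rigid[OF assms(1-5) _ f]) auto
  then obtain s :: 'a where s: "s = 1" "gs' = map (\<lambda>g. s * g * iv s) gs" unfolding 1 by auto
  obtain g gs2 where g: "gs = g # gs2" using assms by (cases gs) auto
  have "u * g * iv u = g" using s by (simp add: gs'_def g)
  then have "u * g = g * u" by (metis iv_simps(1) mult.assoc mult_1_right)
  then show False using f by (simp add: frame_def g commute_def)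
qed

section \<open>Absorbing a letter\<close>

lemma conj_power: "(b * g * iv b) ^ n = b * g ^ n * iv (b::'a::tree_group)"
  by (induction n) (simp_all add: mult.assoc)

lemma pcomm_eq_one: "commute k x \<Longrightarrow> pcomm k x = 1"
proof -
  assume "commute k x"
  then have "commute (k ^ 7) (x ^ 7)"
    by (metis commute_power commute_sym)
  then have "k ^ 7 * x ^ 7 = x ^ 7 * k ^ 7" by (simp add: commute_def)
  then show ?thesis by (simp add: pcomm_def mult.assoc)
qed

lemma pcomm_noncommute:
  assumes "\<not> commute k x"
  shows "\<not> commute (pcomm k x) k"
proof
  assume c: "commute (pcomm k x) k"
  have kx: "k \<noteq> 1" "x \<noteq> 1" using noncommute_ne_one[OF assms] by auto
  define y where "y = x ^ 7"
  have "commute k (iv (k ^ 7) * pcomm k x)"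
    using c commute_power[of k k 7] by (auto simp: commute_sym[of _ k] intro!: commute_mult)
  moreover have "iv (k ^ 7) * pcomm k x = iv ((y * k * iv y) ^ 7)"
    unfolding conj_power by (simp add: pcomm_def y_def mult.assoc)
  ultimately have "commute (y * k * iv y) k"
    using commute_root[of "y * k * iv y" 7 k] by (simp add: commute_sym)
  then have "commute (x ^ 7) k" using commute_conj_self kx by (auto simp: y_def)
  then have "commute x k" by (rule commute_root) simp
  then show False using assms by (simp add: commute_sym)
qed

lemma pcomm_ne_one: "\<not> commute k x \<Longrightarrow> pcomm k x \<noteq> 1"
  using pcomm_noncommute by fastforce

lemma disp_pcomm: "disp k p \<le> B \<Longrightarrow> disp x p \<le> B \<Longrightarrow> disp (pcomm k x) p \<le> 28 * B"
proof -
  assume B: "disp k p \<le> B" "disp x p \<le> B"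
  have "disp (pcomm k x) p \<le> disp (k ^ 7) p + disp (x ^ 7) p + disp (k ^ 7) p + disp (x ^ 7) p"
    using disp_mult[of "k ^ 7 * x ^ 7 * iv (k ^ 7)" "iv (x ^ 7)" p]
      disp_mult[of "k ^ 7 * x ^ 7" "iv (k ^ 7)" p] disp_mult[of "k ^ 7" "x ^ 7" p]
    by (simp add: pcomm_def)
  then show ?thesis using disp_power[of k 7 p] disp_power[of x 7 p] B by simp
qed

text \<open>If \<open>z\<close> commutes with \<open>w ^ n * r\<close>, then its displacement at \<open>w ^ n * p\<close> is as small as at \<open>p\<close>, up to the displacement of \<open>r\<close>.\<close>

lemma commute_power_times:
  assumes z: "commute z (w ^ n * r)" and B: "disp z p \<le> B" "disp w p \<le> B" "disp r p \<le> B"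
    and n: "12 * B + 2 < int n * tlen w"
  shows "commute z w"
proof (rule small_displacement_commute[of z p "3 * B" w "w ^ n * p"])
  have B0: "0 \<le> B" using B(1) disp_nonneg[of z p] by linarith
  have "disp z (w ^ n * r * p) = disp z p" using z by (rule disp_shift)
  moreover have "dst (w ^ n * r * p) (w ^ n * p) \<le> B" using B by (simp add: mult.assoc disp_def dst_sym)
  ultimately show "disp z (w ^ n * p) \<le> 3 * B"
    using disp_move[of z "w ^ n * p" "w ^ n * r * p"] B by simp
  show "disp z p \<le> 3 * B" "disp w p \<le> 3 * B" "disp w (w ^ n * p) \<le> 3 * B"
    using B B0 by (simp_all add: disp_shift commute_power)
  show "4 * (3 * B) + 2 < dst p (w ^ n * p)"
    using disp_power_ge[of n w p] n by (simp add: disp_def)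
qed

text \<open>The power 2000 outweighs the factor \<open>k\<close>: the commutator has displacement at most 28 times its translation length where
it dominates \<open>k\<close> and \<open>x\<close>, and \<open>tlen_power_mult_near\<close> requires an exponent above \<open>70 * 28\<close>. The factor \<open>k\<close> keeps the element
non-trivial when \<open>x\<close> commutes with \<open>k\<close>.\<close>

definition absorb :: "'a::tree_group \<Rightarrow> 'a \<Rightarrow> 'a" where
  "absorb k x = pcomm k x ^ 2000 * k"

lemma absorb_commute: "commute k x \<Longrightarrow> absorb k x = k"
  by (simp add: absorb_def pcomm_eq_one)

lemma absorb_noncommute: "\<not> commute k x \<Longrightarrow> \<not> commute k (absorb k x)"
proof
  assume "\<not> commute k x" and c: "commute k (absorb k x)"
  then have "commute k (absorb k x * iv k)" by (auto intro!: commute_mult)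
  then have "commute (pcomm k x ^ 2000) k" by (simp add: absorb_def mult.assoc commute_sym)
  then have "commute (pcomm k x) k" by (rule commute_root) simp
  then show False using pcomm_noncommute \<open>\<not> commute k x\<close> by blast
qed

lemma absorb_dominates:
  assumes "\<not> commute k x"
  obtains a where "disp k a \<le> tlen (absorb k x)" "disp x a \<le> tlen (absorb k x)"
proof -
  define c where "c = pcomm k x"
  obtain a where a: "disp k a \<le> tlen c" "disp x a \<le> tlen c"
    unfolding c_def by (rule pcomm_dominates[OF assms])
  have c1: "1 \<le> tlen c" using pcomm_ne_one[OF assms] tlen_pos by (simp add: c_def)
  have "int 2000 * tlen c - 70 * (28 * tlen c) \<le> tlen (c ^ 2000 * k)"
    by (rule tlen_power_mult_near[where p = a])
      (use c1 a disp_pcomm[OF a] in \<open>simp_all add: c_def\<close>)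
  then show ?thesis using a c1 by (intro that[of a]) (simp_all add: absorb_def c_def)
qed

lemma tlen_absorb: "tlen k \<le> tlen (absorb k x)"
proof (cases "commute k x")
  case False
  then show ?thesis by (metis absorb_dominates order_trans tlen_le_disp)
qed (simp add: absorb_commute)

lemma disp_absorb: "disp k p \<le> B \<Longrightarrow> disp x p \<le> B \<Longrightarrow> disp (absorb k x) p \<le> 56001 * B"
  using disp_mult[of "pcomm k x ^ 2000" k p] disp_power[of "pcomm k x" 2000 p] disp_pcomm[of k p B x]
  by (simp add: absorb_def)

text \<open>If \<open>x\<close> commutes with \<open>t\<close>, then absorbing \<open>s\<close> leads out of the centralizer of \<open>t\<close>, and absorbing \<open>x\<close> afterwards makes \<open>tlen x\<close>, the only
unbounded part of the displacement of \<open>x\<close> at \<open>p\<close>, bounded. Otherwise \<open>absorb t x\<close> dominates \<open>x\<close>, but possibly only at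
a point \<open>e\<close> far from \<open>p\<close>; absorbing \<open>s\<close> makes the translation length exceed a multiple of the distance from \<open>p\<close> to \<open>e\<close>, since \<open>s\<close> and \<open>t\<close>
are both small only near \<open>p\<close>.\<close>

lemma absorb_letter:
  fixes x :: "'a::tree_group"
  assumes nc: "\<not> commute s t" and p: "disp s p \<le> B" "disp t p \<le> B" and B: "B \<le> int L * tlen t"
    and r_def: "r = absorb (absorb (absorb t x) s) x"
  shows "tlen t \<le> tlen r" "disp x p \<le> int (1000000 + 16 * L) * tlen r"
proof -
  define k1 where "k1 = absorb t x"
  define k2 where "k2 = absorb k1 s"
  have r: "r = absorb k2 x" by (simp add: r_def k1_def k2_def)
  have le: "tlen t \<le> tlen k1" "tlen k1 \<le> tlen k2" "tlen k2 \<le> tlen r"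
    by (simp_all add: r k1_def k2_def tlen_absorb)
  show "tlen t \<le> tlen r" using le by linarith
  have t1: "1 \<le> tlen t" using nc tlen_pos[of t] by fastforce
  define T where "T = tlen r"
  have T: "1 \<le> T" "tlen t \<le> T" "tlen k1 \<le> T" "tlen k2 \<le> T" using t1 le by (simp_all add: T_def)
  have BT: "B \<le> int L * T" using B mult_left_mono[OF T(2), of "int L"] by linarith
  have LT: "0 \<le> int L * T" using T by simp
  have "disp x p \<le> 1000000 * T + 16 * (int L * T)"
  proof (cases "commute x t")
    case True
    then have k1: "k1 = t" by (simp add: k1_def absorb_commute commute_sym)
    have nk2: "\<not> commute t k2"
      using absorb_noncommute[of t s] nc by (simp add: k2_def k1 commute_sym)
    show ?thesis
    proof (cases "x = 1")
      case True
      then show ?thesis using T LT by simp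
    next
      case False
      then have "\<not> commute k2 x" using commute_trans[of t x k2] True nk2 by (auto simp: commute_sym)
      then have "tlen x \<le> T" unfolding T_def r by (metis absorb_dominates order_trans tlen_le_disp)
      moreover have "t \<noteq> 1" using nc by auto
      ultimately show ?thesis using commute_disp[of x t p] \<open>commute x t\<close> p BT T LT t1 by linarith
    qed
  next
    case False
    then have tx: "\<not> commute t x" by (simp add: commute_sym)
    obtain e where e0: "disp t e \<le> tlen k1" "disp x e \<le> tlen k1"
      unfolding k1_def by (rule absorb_dominates[OF tx])
    then have e: "disp t e \<le> T" "disp x e \<le> T" using T by linarith+
    have k1e: "disp k1 e \<le> 56001 * T" unfolding k1_def by (rule disp_absorb[OF e])
    have tk1: "\<not> commute t k1" unfolding k1_def by (rule absorb_noncommute[OF tx])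
    define E where "E = 60000 * T + int L * T"
    have E: "B \<le> E" "T \<le> E" "56001 * T \<le> E" "E \<le> 60000 * T + int L * T"
      unfolding E_def using BT LT T by linarith+
    have "dst p e \<le> 8 * E + 8"
    proof (cases "commute k1 s")
      case False
      obtain q where q: "disp k1 q \<le> tlen k2" "disp s q \<le> tlen k2"
        unfolding k2_def by (rule absorb_dominates[OF False])
      show ?thesis
        by (rule tripod_bound[of t p E s e k1 q]) (use p e k1e q T E nc tk1 commute_sym in \<open>auto\<close>)
    next
      case True
      have "k1 \<noteq> 1" using tk1 by auto
      then have "disp s e \<le> tlen s + disp k1 e - tlen k1 + 1"
        using commute_disp[of s k1 e] True by (simp add: commute_sym)
      then have se: "disp s e \<le> E + 1"
        using tlen_le_disp[of s p] p k1e BT T LT tlen_nonneg[of k1] unfolding E_def by linarith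
      have "\<not> 4 * (E + 1) + 2 < dst p e"
        using small_displacement_commute[of s p "E + 1" t e] se p e E nc by auto
      then show ?thesis using E T by (simp add: not_less)
    qed
    then show ?thesis using disp_move[of x p e] e T LT E dst_sym[of e p] by linarith
  qed
  then show "disp x p \<le> int (1000000 + 16 * L) * tlen r" by (simp add: T_def algebra_simps)
qed

section \<open>Words that dominate their letters\<close>

text \<open>The counterpart of \<open>word_value\<close> for groups given by a type class.\<close>

fun wv :: "(nat \<Rightarrow> 'a::tree_group) \<Rightarrow> nat group_word \<Rightarrow> 'a" where
  "wv X [] = 1"
| "wv X ((a, b) # w) = (if b then X a else iv (X a)) * wv X w"

lemma wv_append [simp]: "wv X (u @ v) = wv X u * wv X v"
  by (induction X u rule: wv.induct) (simp_all add: mult.assoc)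

definition winv :: "nat group_word \<Rightarrow> nat group_word" where
  "winv w = rev (map inv_letter w)"

definition wpow :: "nat group_word \<Rightarrow> nat \<Rightarrow> nat group_word" where
  "wpow w n = concat (replicate n w)"

lemma wv_inv [simp]: "wv X (winv w) = iv (wv X w)"
  by (induction X w rule: wv.induct) (simp_all add: winv_def)

lemma wv_pow [simp]: "wv X (wpow w n) = wv X w ^ n"
  by (induction n) (simp_all add: wpow_def)

lemma group_words_append [simp]: "u @ v \<in> group_words A \<longleftrightarrow> u \<in> group_words A \<and> v \<in> group_words A"
  by (auto simp: group_words_def)

lemma group_words_inv [simp]: "w \<in> group_words A \<Longrightarrow> winv w \<in> group_words A"
  by (fastforce simp: group_words_def winv_def)

lemma group_words_pow [simp]: "w \<in> group_words A \<Longrightarrow> wpow w n \<in> group_words A"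
  by (induction n) (auto simp: group_words_def wpow_def)

lemma group_words_Nil [simp]: "[] \<in> group_words A"
  by (simp add: group_words_def)

lemma group_words_Cons [simp]: "(i, b) # w \<in> group_words A \<longleftrightarrow> i \<in> A \<and> w \<in> group_words A"
  by (auto simp: group_words_def)

lemma group_words_mono: "w \<in> group_words A \<Longrightarrow> A \<subseteq> B \<Longrightarrow> w \<in> group_words B"
  by (auto simp: group_words_def)

definition wpcomm :: "nat group_word \<Rightarrow> nat group_word \<Rightarrow> nat group_word" where
  "wpcomm k x = wpow k 7 @ wpow x 7 @ winv (wpow k 7) @ winv (wpow x 7)"

definition wabsorb :: "nat group_word \<Rightarrow> nat group_word \<Rightarrow> nat group_word" where
  "wabsorb k x = wpow (wpcomm k x) 2000 @ k"

lemma wv_pcomm [simp]: "wv X (wpcomm k x) = pcomm (wv X k) (wv X x)"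
  by (simp add: wpcomm_def pcomm_def mult.assoc)

lemma wv_absorb [simp]: "wv X (wabsorb k x) = absorb (wv X k) (wv X x)"
  by (simp add: wabsorb_def absorb_def)

lemma group_words_pcomm [simp]: "k \<in> group_words A \<Longrightarrow> x \<in> group_words A \<Longrightarrow> wpcomm k x \<in> group_words A"
  by (simp add: wpcomm_def)

lemma group_words_absorb [simp]: "k \<in> group_words A \<Longrightarrow> x \<in> group_words A \<Longrightarrow> wabsorb k x \<in> group_words A"
  by (simp add: wabsorb_def)

lemma disp_wv:
  assumes "w \<in> group_words I" "\<And>i. i \<in> I \<Longrightarrow> disp (X i) p \<le> B"
  shows "disp (wv X w) p \<le> int (length w) * B"
  using assms(1)
proof (induction w)
  case (Cons l w)
  obtain i b where l: "l = (i, b)" by fastforce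
  have "i \<in> I" "w \<in> group_words I" using Cons.prems by (simp_all add: group_words_def l)
  then have "disp (wv X w) p \<le> int (length w) * B" "disp (if b then X i else iv (X i)) p \<le> B"
    using Cons.IH assms(2) by simp_all
  then show ?case
    using disp_mult[of "if b then X i else iv (X i)" "wv X w" p] by (simp add: l algebra_simps)
qed simp

text \<open>Only the ratio of displacement and translation length counts, not the position of \<open>p\<close> relative to the axis of \<open>g\<close>; so whatever
increases \<open>tlen g\<close> preserves domination.\<close>

definition dominates :: "(nat \<Rightarrow> 'a::tree_group) \<Rightarrow> nat set \<Rightarrow> nat \<Rightarrow> 'a \<Rightarrow> bool" where
  "dominates X I C g \<longleftrightarrow> g \<noteq> 1 \<and> (\<exists>p. \<forall>i \<in> I. disp (X i) p \<le> int C * tlen g)"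

lemma dominates_mono:
  assumes "dominates X I C g" "tlen g \<le> tlen h" "C \<le> D"
  shows "dominates X I D h"
proof -
  obtain p where p: "g \<noteq> 1" "\<forall>i \<in> I. disp (X i) p \<le> int C * tlen g" using assms by (auto simp: dominates_def)
  have "int C * tlen g \<le> int D * tlen h" using assms by (intro mult_mono) auto
  moreover have "h \<noteq> 1" using tlen_pos[OF p(1)] assms(2) by auto
  ultimately show ?thesis using p unfolding dominates_def by (meson order_trans)
qed

lemma dominates_power_mult:
  assumes g: "dominates X I C (wv X w)" and w: "w \<in> group_words I" and R: "R \<in> group_words I"
    and n: "100 * (length w + length R + 1) * (C + 1) \<le> n"
  shows "dominates X I C (wv X (wpow w n @ R))" "tlen (wv X w) \<le> tlen (wv X (wpow w n @ R))"
proof -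
  define t where "t = tlen (wv X w)"
  obtain p where p: "wv X w \<noteq> 1" "\<And>i. i \<in> I \<Longrightarrow> disp (X i) p \<le> int C * t"
    using g by (auto simp: dominates_def t_def)
  have t: "1 \<le> t" using tlen_pos[OF p(1)] by (simp add: t_def)
  define L where "L = length w + length R + 1"
  define B where "B = int L * (int (C + 1) * t)"
  have le: "int (length v) * (int C * t) \<le> B" if "length v \<le> L" for v :: "nat group_word"
    unfolding B_def using that t by (intro mult_mono) auto
  have d: "disp (wv X w) p \<le> B" "disp (wv X R) p \<le> B"
    using disp_wv[OF w, of X p "int C * t"] disp_wv[OF R, of X p "int C * t"] le[of w] le[of R] p(2)
    by (simp_all add: L_def)
  have tB: "t \<le> B"
  proof -
    have "1 * (1 * t) \<le> int L * (int (C + 1) * t)" using t by (intro mult_mono) (auto simp: L_def)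
    then show ?thesis by (simp add: B_def)
  qed
  have "100 * B \<le> int n * t"
  proof -
    have "int (100 * L * (C + 1)) * t \<le> int n * t"
      using n t unfolding L_def by (intro mult_right_mono) (simp_all only: of_nat_le_iff)
    then show ?thesis by (simp add: B_def algebra_simps)
  qed
  then have "t \<le> tlen (wv X w ^ n * wv X R)"
    using tlen_power_mult_near[of B "wv X w" p "wv X R" n] d tB t by (simp add: t_def)
  then show *: "tlen (wv X w) \<le> tlen (wv X (wpow w n @ R))" by (simp add: t_def)
  show "dominates X I C (wv X (wpow w n @ R))" by (rule dominates_mono[OF g *]) simp
qed

lemma dominates_commute_power_mult:
  assumes g: "dominates X I C (wv X w)" and w: "w \<in> group_words I" and R: "R \<in> group_words I"
    and T: "T \<in> group_words I" and c: "commute (wv X T) (wv X (wpow w n @ R))"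
    and n: "100 * (length w + length R + length T + 1) * (C + 1) \<le> n"
  shows "commute (wv X T) (wv X w)"
proof -
  define t where "t = tlen (wv X w)"
  obtain p where p: "wv X w \<noteq> 1" "\<And>i. i \<in> I \<Longrightarrow> disp (X i) p \<le> int C * t"
    using g by (auto simp: dominates_def t_def)
  have t: "1 \<le> t" using tlen_pos[OF p(1)] by (simp add: t_def)
  define L where "L = length w + length R + length T + 1"
  define B where "B = int L * (int (C + 1) * t)"
  have le: "int (length v) * (int C * t) \<le> B" if "length v \<le> L" for v :: "nat group_word"
    unfolding B_def using that t by (intro mult_mono) auto
  have d: "disp (wv X w) p \<le> B" "disp (wv X R) p \<le> B" "disp (wv X T) p \<le> B"
    using disp_wv[OF w, of X p "int C * t"] disp_wv[OF R, of X p "int C * t"] disp_wv[OF T, of X p "int C * t"] le[of w] le[of R] le[of T] p(2)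
    by (simp_all add: L_def)
  have tB: "t \<le> B"
  proof -
    have "1 * (1 * t) \<le> int L * (int (C + 1) * t)" using t by (intro mult_mono) (auto simp: L_def)
    then show ?thesis by (simp add: B_def)
  qed
  have "100 * B \<le> int n * t"
  proof -
    have "int (100 * L * (C + 1)) * t \<le> int n * t"
      using n t unfolding L_def by (intro mult_right_mono) (simp_all only: of_nat_le_iff)
    then show ?thesis by (simp add: B_def algebra_simps)
  qed
  then show ?thesis
    using commute_power_times[of "wv X T" "wv X w" n "wv X R" p B] c d tB t by (simp add: t_def)
qed

text \<open>The word \<open>U\<close> behaves like the first word of \<open>ws\<close> with a non-trivial value. The word \<open>T\<close> is carried along to keep a value that commutes with none
of the non-trivial values from commuting with \<open>U\<close>.\<close>

definition selects :: "nat set \<Rightarrow> nat group_word list \<Rightarrow> nat group_word \<Rightarrow> nat group_word \<Rightarrow> nat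
    \<Rightarrow> (nat \<Rightarrow> 'a::tree_group) \<Rightarrow> bool" where
  "selects I ws T U C X \<longleftrightarrow>
     (if \<forall>w \<in> set ws. wv X w = 1 then wv X U = 1
      else dominates X I C (wv X U) \<and>
        ((\<forall>w \<in> set ws. wv X w \<noteq> 1 \<longrightarrow> \<not> commute (wv X T) (wv X w)) \<longrightarrow> \<not> commute (wv X T) (wv X U)))"

text \<open>In \<open>w ^ n\<close> times the word for the rest, the first factor either is trivial or dominates all letters, hence also the value of the
second factor, whose length is known before \<open>n\<close> is chosen.\<close>

lemma select_nontrivial:
  assumes "set ws \<subseteq> group_words I" "T \<in> group_words I"
    and "\<And>w. w \<in> set ws \<Longrightarrow> \<exists>C. \<forall>X :: nat \<Rightarrow> 'a::tree_group. wv X w \<noteq> 1 \<longrightarrow> dominates X I C (wv X w)"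
  shows "\<exists>U \<in> group_words I. \<exists>C. \<forall>X :: nat \<Rightarrow> 'a. selects I ws T U C X"
  using assms(1,3)
proof (induction ws)
  case Nil
  show ?case by (rule bexI[of _ "[]"]) (simp_all add: selects_def)
next
  case (Cons w ws)
  obtain U C where U: "U \<in> group_words I" "\<And>X :: nat \<Rightarrow> 'a. selects I ws T U C X"
    using Cons by auto
  obtain D where D: "\<And>X :: nat \<Rightarrow> 'a. wv X w \<noteq> 1 \<Longrightarrow> dominates X I D (wv X w)"
    using Cons.prems(2)[of w] by auto
  have w: "w \<in> group_words I" using Cons.prems by simp
  define n where "n = 100 * (length w + length U + length T + 1) * (D + 1)"
  have n: "100 * (length w + length U + 1) * (D + 1) \<le> n"
    unfolding n_def by (intro mult_right_mono) auto
  have "selects I (w # ws) T (wpow w n @ U) (max C D) X" for X :: "nat \<Rightarrow> 'a"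
  proof (cases "wv X w = 1")
    case True
    then show ?thesis
      using U(2)[of X] dominates_mono[of X I C "wv X U" "wv X U" "max C D"]
      by (auto simp: selects_def split: if_splits)
  next
    case False
    have "dominates X I (max C D) (wv X (wpow w n @ U))"
      by (rule dominates_mono[OF dominates_power_mult(1)[OF D[OF False] w U(1) n]]) auto
    moreover have "commute (wv X T) (wv X w)" if "commute (wv X T) (wv X (wpow w n @ U))"
      by (rule dominates_commute_power_mult[OF D[OF False] w U(1) assms(2) that]) (simp add: n_def)
    ultimately show ?thesis using False by (auto simp: selects_def)
  qed
  then show ?case using U(1) w by (intro bexI[of _ "wpow w n @ U"]) auto
qed

text \<open>The commutators of \<open>t\<close> with the letters have translation length at least that of \<open>t\<close> unless they are trivial, so they inherit domination from \<open>t\<close>; a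
non-trivial one does not commute with \<open>t\<close>.\<close>

lemma separating_word:
  assumes t: "t \<in> group_words I" "\<And>X :: nat \<Rightarrow> 'a::tree_group. wv X t \<noteq> 1 \<Longrightarrow> dominates X I C (wv X t)"
    and ls: "set ls \<subseteq> I"
  shows "\<exists>U \<in> group_words I. \<exists>D. \<forall>X :: nat \<Rightarrow> 'a.
     (if \<forall>l \<in> set ls. commute (wv X t) (X l) then wv X U = 1
      else dominates X I D (wv X U) \<and> \<not> commute (wv X t) (wv X U))"
proof -
  define ws where "ws = map (\<lambda>l. wpcomm t [(l, True)]) ls"
  have triv: "wv X (wpcomm t [(l, True)]) = 1 \<longleftrightarrow> commute (wv X t) (X l)" for X :: "nat \<Rightarrow> 'a" and l
    using pcomm_eq_one[of "wv X t" "X l"] pcomm_ne_one[of "wv X t" "X l"] by auto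
  have "\<exists>U \<in> group_words I. \<exists>D. \<forall>X :: nat \<Rightarrow> 'a. selects I ws t U D X"
  proof (rule select_nontrivial)
    show "set ws \<subseteq> group_words I" using t(1) ls by (auto simp: ws_def)
    show "\<exists>C. \<forall>X :: nat \<Rightarrow> 'a. wv X w \<noteq> 1 \<longrightarrow> dominates X I C (wv X w)" if ww: "w \<in> set ws" for w
    proof (intro exI[of _ C] allI impI)
      fix X :: "nat \<Rightarrow> 'a" assume 1: "wv X w \<noteq> 1"
      obtain l where l: "w = wpcomm t [(l, True)]" using ww by (auto simp: ws_def)
      have nc: "\<not> commute (wv X t) (X l)" using 1 triv l by blast
      then have "wv X t \<noteq> 1" by auto
      moreover obtain a where "disp (wv X t) a \<le> tlen (wv X w)"
        using pcomm_dominates[OF nc] by (auto simp: l)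
      then have "tlen (wv X t) \<le> tlen (wv X w)" using tlen_le_disp[of "wv X t" a] by linarith
      ultimately show "dominates X I C (wv X w)" using dominates_mono[OF t(2)] by blast
    qed
  qed (rule t(1))
  then obtain U D where U: "U \<in> group_words I" "\<And>X :: nat \<Rightarrow> 'a. selects I ws t U D X" by blast
  have "\<not> commute (wv X t) (wv X w)" if "w \<in> set ws" "wv X w \<noteq> 1" for X :: "nat \<Rightarrow> 'a" and w
    using that triv pcomm_noncommute by (fastforce simp: ws_def commute_sym)
  moreover have "(\<forall>w \<in> set ws. wv X w = 1) \<longleftrightarrow> (\<forall>l \<in> set ls. commute (wv X t) (X l))" for X :: "nat \<Rightarrow> 'a"
    using triv by (simp add: ws_def del: wv_pcomm)
  ultimately show ?thesis
    using U unfolding selects_def by (intro bexI[of _ U] exI[of _ D]) (auto split: if_splits)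
qed


definition pairwise_commute :: "(nat \<Rightarrow> 'a::tree_group) \<Rightarrow> nat set \<Rightarrow> bool" where
  "pairwise_commute X I \<longleftrightarrow> (\<forall>i \<in> I. \<forall>j \<in> I. commute (X i) (X j))"

text \<open>First replace \<open>t\<close> by a dominating word \<open>U\<close> that does not commute with \<open>t\<close>: as \<open>X i\<close> and \<open>X j\<close> do not commute, one of them does not commute with
the value of \<open>t\<close>. Then \<open>absorb_letter\<close> applies to this pair.\<close>

lemma extend_dominating_word:
  assumes t: "t \<in> group_words I" "i \<in> I" "j \<in> I"
    and C: "\<And>X :: nat \<Rightarrow> 'a::tree_group. if commute (X i) (X j) then wv X t = 1 else dominates X I C (wv X t)"
  shows "\<exists>r \<in> group_words (insert k I). \<exists>D. \<forall>X :: nat \<Rightarrow> 'a.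
    if commute (X i) (X j) then wv X r = 1 else dominates X (insert k I) D (wv X r)"
proof -
  have C': "dominates X I C (wv X t)" if "wv X t \<noteq> 1" for X :: "nat \<Rightarrow> 'a"
    using C[of X] that by (auto split: if_splits)
  have "\<exists>U \<in> group_words I. \<exists>D. \<forall>X :: nat \<Rightarrow> 'a.
     (if \<forall>l \<in> set [i, j]. commute (wv X t) (X l) then wv X U = 1
      else dominates X I D (wv X U) \<and> \<not> commute (wv X t) (wv X U))"
    by (rule separating_word[of t I C]) (use t C' in auto)
  then obtain U D where U: "U \<in> group_words I" and UD: "\<And>X :: nat \<Rightarrow> 'a.
     (if \<forall>l \<in> set [i, j]. commute (wv X t) (X l) then wv X U = 1
      else dominates X I D (wv X U) \<and> \<not> commute (wv X t) (wv X U))" by blast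
  define r where "r = wabsorb (wabsorb (wabsorb U [(k, True)]) t) [(k, True)]"
  define L where "L = (length t + length U) * D"
  define E where "E = D + 1000000 + 16 * L"
  have r: "r \<in> group_words (insert k I)"
    using group_words_mono[OF U, of "insert k I"] group_words_mono[OF t(1), of "insert k I"]
    by (simp add: r_def subset_insertI)
  have "if commute (X i) (X j) then wv X r = 1 else dominates X (insert k I) E (wv X r)" for X :: "nat \<Rightarrow> 'a"
  proof (cases "commute (X i) (X j)")
    case True
    then have "wv X t = 1" using C[of X] by simp
    moreover from this have "wv X U = 1" using UD[of X] by simp
    ultimately show ?thesis using True by (simp add: r_def absorb_commute)
  next
    case False
    then have "dominates X I C (wv X t)" using C[of X] by simp
    then have t1: "wv X t \<noteq> 1" by (simp add: dominates_def)
    have "\<not> (commute (wv X t) (X i) \<and> commute (wv X t) (X j))"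
      using commute_trans[of "X i" "wv X t" "X j"] t1 False by (auto simp: commute_sym)
    then have dU: "dominates X I D (wv X U)" "\<not> commute (wv X t) (wv X U)"
      using UD[of X] by (auto split: if_splits)
    define \<tau> where "\<tau> = tlen (wv X U)"
    obtain p where p: "wv X U \<noteq> 1" "\<And>i. i \<in> I \<Longrightarrow> disp (X i) p \<le> int D * \<tau>"
      using dU(1) by (auto simp: dominates_def \<tau>_def)
    have \<tau>: "1 \<le> \<tau>" using tlen_pos[OF p(1)] by (simp add: \<tau>_def)
    have "disp (wv X t) p \<le> int (length t) * (int D * \<tau>)" "disp (wv X U) p \<le> int (length U) * (int D * \<tau>)"
      using disp_wv[OF t(1), of X p "int D * \<tau>"] disp_wv[OF U, of X p "int D * \<tau>"] p by auto
    moreover have "int L * \<tau> = int (length t) * (int D * \<tau>) + int (length U) * (int D * \<tau>)"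
      by (simp add: L_def algebra_simps)
    moreover have "0 \<le> int (length t) * (int D * \<tau>)" "0 \<le> int (length U) * (int D * \<tau>)" using \<tau> by auto
    ultimately have d: "disp (wv X t) p \<le> int L * \<tau>" "disp (wv X U) p \<le> int L * \<tau>" by linarith+
    have wr: "wv X r = absorb (absorb (absorb (wv X U) (X k)) (wv X t)) (X k)" by (simp add: r_def)
    note x = absorb_letter[OF dU(2) d _ wr, of L, unfolded \<tau>_def, simplified]
    have tr: "\<tau> \<le> tlen (wv X r)" using x(1) by (simp add: \<tau>_def)
    have "disp (X l) p \<le> int E * tlen (wv X r)" if "l \<in> insert k I" for l
    proof (cases "l = k")
      case True
      have "disp (X k) p \<le> int (1000000 + 16 * L) * tlen (wv X r)" using x(2) by simp
      also have "\<dots> \<le> int E * tlen (wv X r)" unfolding E_def by (intro mult_right_mono) auto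
      finally show ?thesis using True by simp
    next
      case False
      then have "disp (X l) p \<le> int D * \<tau>" using that p by simp
      also have "\<dots> \<le> int E * tlen (wv X r)" using tr \<tau> unfolding E_def by (intro mult_mono) auto
      finally show ?thesis .
    qed
    moreover have "wv X r \<noteq> 1" using tr \<tau> by auto
    ultimately show ?thesis using False by (auto simp: dominates_def)
  qed
  then show ?thesis using r by blast
qed

lemma dominating_word_for_pair:
  assumes "finite F"
  shows "\<exists>r \<in> group_words ({i, j} \<union> F). \<exists>D. \<forall>X :: nat \<Rightarrow> 'a::tree_group.
    if commute (X i) (X j) then wv X r = 1 else dominates X ({i, j} \<union> F) D (wv X r)"
  using assms
proof induction
  case empty
  define r where "r = wpcomm [(i, True)] [(j, True)]"
  have "if commute (X i) (X j) then wv X r = 1 else dominates X {i, j} 1 (wv X r)" for X :: "nat \<Rightarrow> 'a"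
    using pcomm_eq_one[of "X i" "X j"] pcomm_ne_one[of "X i" "X j"] pcomm_dominates[of "X i" "X j"]
    by (fastforce simp: r_def dominates_def)
  moreover have "r \<in> group_words {i, j}" by (simp add: r_def)
  ultimately show ?case unfolding Un_empty_right by blast
next
  case (insert k F)
  then obtain t D where t: "t \<in> group_words ({i, j} \<union> F)" and D: "\<And>X :: nat \<Rightarrow> 'a.
    if commute (X i) (X j) then wv X t = 1 else dominates X ({i, j} \<union> F) D (wv X t)" by blast
  have "\<exists>r \<in> group_words (insert k ({i, j} \<union> F)). \<exists>D. \<forall>X :: nat \<Rightarrow> 'a.
    if commute (X i) (X j) then wv X r = 1 else dominates X (insert k ({i, j} \<union> F)) D (wv X r)"
    by (rule extend_dominating_word[OF t _ _ D]) simp_all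
  then show ?case by (simp only: Un_insert_right)
qed

lemma dominating_word:
  assumes "finite I"
  shows "\<exists>U \<in> group_words I. \<exists>C. \<forall>X :: nat \<Rightarrow> 'a::tree_group.
    if pairwise_commute X I then wv X U = 1 else dominates X I C (wv X U)"
proof -
  have "\<exists>r \<in> group_words I. \<exists>D. \<forall>X :: nat \<Rightarrow> 'a.
    if commute (X i) (X j) then wv X r = 1 else dominates X I D (wv X r)" if "i \<in> I" "j \<in> I" for i j
  proof -
    have "{i, j} \<union> I = I" using that by auto
    then show ?thesis using dominating_word_for_pair[OF assms, of i j] by metis
  qed
  then obtain r where r: "\<And>i j. i \<in> I \<Longrightarrow> j \<in> I \<Longrightarrow> r i j \<in> group_words I \<and> (\<exists>D. \<forall>X :: nat \<Rightarrow> 'a.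
    if commute (X i) (X j) then wv X (r i j) = 1 else dominates X I D (wv X (r i j)))" by metis
  obtain ls where ls: "set ls = I" using finite_list[OF assms] by blast
  define ws where "ws = [r i j. i \<leftarrow> ls, j \<leftarrow> ls]"
  have ws: "set ws = {r i j |i j. i \<in> I \<and> j \<in> I}" by (auto simp: ws_def ls)
  have "\<exists>U \<in> group_words I. \<exists>C. \<forall>X :: nat \<Rightarrow> 'a. selects I ws [] U C X"
  proof (rule select_nontrivial)
    show "set ws \<subseteq> group_words I" using r by (auto simp: ws)
    fix w assume "w \<in> set ws"
    then obtain i j where w: "w = r i j" "i \<in> I" "j \<in> I" by (auto simp: ws)
    then show "\<exists>C. \<forall>X :: nat \<Rightarrow> 'a. wv X w \<noteq> 1 \<longrightarrow> dominates X I C (wv X w)"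
      using r[OF w(2,3)] by metis
  qed simp
  moreover have "(\<forall>w \<in> set ws. wv X w = 1) \<longleftrightarrow> pairwise_commute X I" for X :: "nat \<Rightarrow> 'a"
  proof -
    have "wv X (r i j) = 1 \<longleftrightarrow> commute (X i) (X j)" if "i \<in> I" "j \<in> I" for i j
      using r[OF that] by (metis dominates_def)
    moreover have "(\<forall>w \<in> set ws. wv X w = 1) \<longleftrightarrow> (\<forall>i \<in> I. \<forall>j \<in> I. wv X (r i j) = 1)"
      unfolding ws by blast
    ultimately show ?thesis by (simp add: pairwise_commute_def)
  qed
  ultimately show ?thesis unfolding selects_def by metis
qed

text \<open>The words \<open>V\<close> and \<open>U\<close> are separated: they do not commute on a non-commuting tuple. If a value \<open>g \<noteq> 1\<close> of one of the words in \<open>gs\<close> commuted with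
\<open>V^n U\<close>, it would commute with \<open>V\<close> since \<open>n\<close> is large, and then with \<open>U\<close>, so that \<open>V\<close> and \<open>U\<close> would commute. The letter
\<open>X i\<close> is recovered from its conjugation action on \<open>V\<close> and \<open>U\<close>, whose centralizers intersect trivially.\<close>

lemma frame_words:
  assumes "finite I"
  shows "\<exists>u \<in> group_words I. \<exists>gs C. set gs \<subseteq> group_words I \<and> gs \<noteq> [] \<and> 1 \<le> C \<and> (\<forall>X :: nat \<Rightarrow> 'a::tree_group.
    if pairwise_commute X I then wv X u = 1 \<and> (\<forall>g \<in> set gs. wv X g = 1)
    else (\<exists>p. frame (wv X u) p C (map (wv X) gs)) \<and>
      (\<forall>Y s. (\<forall>g \<in> set gs. wv Y g = s * wv X g * iv s) \<longrightarrow> (\<forall>i \<in> I. Y i = s * X i * iv s)))"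
proof -
  obtain U C where U: "U \<in> group_words I" and UC: "\<And>X :: nat \<Rightarrow> 'a.
    if pairwise_commute X I then wv X U = 1 else dominates X I C (wv X U)"
    using dominating_word[OF assms] by blast
  obtain ls where ls: "set ls = I" using finite_list[OF assms] by blast
  have UC': "dominates X I C (wv X U)" if "wv X U \<noteq> 1" for X :: "nat \<Rightarrow> 'a"
    using UC[of X] that by (auto split: if_splits)
  have "\<exists>V \<in> group_words I. \<exists>D. \<forall>X :: nat \<Rightarrow> 'a.
     (if \<forall>l \<in> set ls. commute (wv X U) (X l) then wv X V = 1
      else dominates X I D (wv X V) \<and> \<not> commute (wv X U) (wv X V))"
    by (rule separating_word[of U I C]) (use U UC' ls in auto)
  then obtain V D where V: "V \<in> group_words I" and VD: "\<And>X :: nat \<Rightarrow> 'a.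
     (if \<forall>l \<in> I. commute (wv X U) (X l) then wv X V = 1
      else dominates X I D (wv X V) \<and> \<not> commute (wv X U) (wv X V))" unfolding ls by blast
  define gs where "gs = [V, U] @ concat (map (\<lambda>i. [[(i, True)] @ V @ [(i, False)], [(i, True)] @ U @ [(i, False)]]) ls)"
  have gs: "set gs \<subseteq> group_words I" using U V by (auto simp: gs_def ls[symmetric])
  have gs_set: "set gs = {V, U} \<union> {[(i, True)] @ w @ [(i, False)] |i w. i \<in> I \<and> w \<in> {V, U}}"
    by (auto simp: gs_def ls)
  define K where "K = sum_list (map length gs)"
  have K: "length g \<le> K" if "g \<in> set gs" for g
    unfolding K_def using that by (intro member_le_sum_list) auto
  define n where "n = 100 * (length V + length U + K + 1) * (D + 1)"
  have n1: "100 * (length V + length U + 1) * (D + 1) \<le> n"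
    unfolding n_def by (intro mult_right_mono) auto
  have n2: "100 * (length V + length U + length g + 1) * (D + 1) \<le> n" if "g \<in> set gs" for g
    unfolding n_def using K[OF that] by (intro mult_right_mono) auto
  define u where "u = wpow V n @ U"
  have u: "u \<in> group_words I" using U V by (simp add: u_def)
  define E where "E = (K + length u) * D + 1"
  have "if pairwise_commute X I then wv X u = 1 \<and> (\<forall>g \<in> set gs. wv X g = 1)
    else (\<exists>p. frame (wv X u) p E (map (wv X) gs)) \<and>
      (\<forall>Y s. (\<forall>g \<in> set gs. wv Y g = s * wv X g * iv s) \<longrightarrow> (\<forall>i \<in> I. Y i = s * X i * iv s))" for X :: "nat \<Rightarrow> 'a"
  proof (cases "pairwise_commute X I")
    case True
    then have U1: "wv X U = 1" using UC[of X] by simp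
    then have "wv X V = 1" using VD[of X] by simp
    then show ?thesis using True U1 by (auto simp: u_def gs_set)
  next
    case False
    then have "dominates X I C (wv X U)" using UC[of X] by simp
    then have U1: "wv X U \<noteq> 1" by (simp add: dominates_def)
    have "\<not> (\<forall>l \<in> I. commute (wv X U) (X l))"
      using commute_trans[of _ "wv X U"] U1 False by (metis commute_sym pairwise_commute_def)
    then have dV: "dominates X I D (wv X V)" and UV: "\<not> commute (wv X U) (wv X V)"
      using VD[of X] by (auto split: if_splits)
    have V1: "wv X V \<noteq> 1" using UV by auto
    define \<tau> where "\<tau> = tlen (wv X u)"
    have du: "dominates X I D (wv X u)" unfolding u_def by (rule dominates_power_mult(1)[OF dV V U n1])
    then have u1: "wv X u \<noteq> 1" by (simp add: dominates_def)
    have \<tau>: "1 \<le> \<tau>" using tlen_pos[OF u1] by (simp add: \<tau>_def)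
    obtain p where p: "\<And>i. i \<in> I \<Longrightarrow> disp (X i) p \<le> int D * \<tau>"
      using du by (auto simp: dominates_def \<tau>_def)
    obtain q where q: "disp (wv X u) q = \<tau>" "2 * dst p q \<le> disp (wv X u) p - \<tau> + 1"
      unfolding \<tau>_def by (rule axis_projection)
    have "disp (wv X g) q \<le> int E * \<tau>" if "g \<in> set gs" for g
    proof -
      have "disp (wv X g) p \<le> int (length g) * (int D * \<tau>)"
        using disp_wv[of g I X p "int D * \<tau>"] gs that p by auto
      also have "\<dots> \<le> int K * (int D * \<tau>)" using K[OF that] \<tau> by (intro mult_right_mono) auto
      finally have "disp (wv X g) p \<le> int K * (int D * \<tau>)" .
      moreover have "disp (wv X u) p \<le> int (length u) * (int D * \<tau>)"
        using disp_wv[OF u, of X p "int D * \<tau>"] p by auto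
      ultimately show ?thesis
        using disp_move[of "wv X g" q p] q \<tau> by (simp add: E_def algebra_simps)
    qed
    moreover have "\<not> commute (wv X g) (wv X u)" if g: "g \<in> set gs" for g
    proof
      assume c: "commute (wv X g) (wv X u)"
      have conj1: "x * y * iv x = 1 \<Longrightarrow> y = 1" for x y :: 'a by (metis tlen_conj tlen_eq_0)
      have g1: "wv X g \<noteq> 1" using g U1 V1 conj1 by (auto simp: gs_set mult.assoc[symmetric])
      have gV: "commute (wv X g) (wv X V)"
        by (rule dominates_commute_power_mult[OF dV V U _ _ n2[OF g]]) (use c g gs in \<open>auto simp: u_def\<close>)
      have "commute (wv X g) (iv (wv X V ^ n) * wv X u)"
        using c gV by (auto intro!: commute_mult commute_power)
      then have "commute (wv X g) (wv X U)" by (simp add: u_def)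
      then show False using UV gV g1 commute_trans[of "wv X U" "wv X g" "wv X V"] by (auto simp: commute_sym)
    qed
    ultimately have "frame (wv X u) q E (map (wv X) gs)"
      using q u1 by (auto simp: frame_def \<tau>_def)
    moreover have "Y i = s * X i * iv s" if Y: "\<forall>g \<in> set gs. wv Y g = s * wv X g * iv s" and i: "i \<in> I" for Y s i
    proof -
      define z where "z = iv (X i) * (iv s * Y i * s)"
      have z: "commute z (wv X w)" if w: "w \<in> {V, U}" for w
      proof -
        have "wv Y w = s * wv X w * iv s" using Y w by (auto simp: gs_set)
        moreover have "[(i, True)] @ w @ [(i, False)] \<in> set gs" using w i by (auto simp: gs_set)
        then have "wv Y ([(i, True)] @ w @ [(i, False)]) = s * wv X ([(i, True)] @ w @ [(i, False)]) * iv s"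
          using Y by blast
        ultimately have e: "Y i * (s * (wv X w * (iv s * iv (Y i)))) = s * (X i * (wv X w * (iv (X i) * iv s)))"
          by (simp add: mult.assoc)
        have "z * wv X w = iv (X i) * (iv s * (Y i * (s * (wv X w * (iv s * iv (Y i)))) * (Y i * s)))"
          by (simp add: z_def mult.assoc)
        also have "\<dots> = wv X w * z" unfolding e by (simp add: z_def mult.assoc)
        finally show ?thesis by (simp add: commute_def)
      qed
      have "z = 1" using z commute_trans[of "wv X U" z "wv X V"] UV by (auto simp: commute_sym)
      then have "X i * z = X i" by simp
      then have "iv s * (Y i * s) = X i" by (simp add: z_def mult.assoc)
      then have "s * (iv s * (Y i * s)) * iv s = s * X i * iv s" by simp
      then show ?thesis by (simp add: mult.assoc)
    qed
    ultimately show ?thesis using False by auto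
  qed
  moreover have "gs \<noteq> []" "1 \<le> E" by (simp_all add: gs_def E_def)
  ultimately show ?thesis using u gs by blast
qed

section \<open>The test word\<close>

fun wzig :: "nat group_word \<Rightarrow> nat list \<Rightarrow> nat group_word list \<Rightarrow> nat group_word" where
  "wzig u (n # ns) (g # gs) = wpow u n @ g @ wzig u ns gs"
| "wzig u _ _ = []"

lemma wv_zig [simp]: "wv X (wzig u ns gs) = zig (wv X u) ns (map (wv X) gs)"
  by (induction u ns gs rule: wzig.induct) (simp_all add: mult.assoc)

lemma group_words_zig: "u \<in> group_words A \<Longrightarrow> set gs \<subseteq> group_words A \<Longrightarrow> wzig u ns gs \<in> group_words A"
  by (induction u ns gs rule: wzig.induct) simp_all

lemma zig_one: "\<forall>a \<in> set as. a = 1 \<Longrightarrow> zig 1 ns as = 1"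
  by (induction "1 :: 'a::tree_group" ns as rule: zig.induct) simp_all

theorem test_word:
  assumes "finite I"
  shows "\<exists>v \<in> group_words I. \<forall>X :: nat \<Rightarrow> 'a::tree_group. (wv X v = 1 \<longleftrightarrow> pairwise_commute X I) \<and>
    (\<forall>Y. wv X v = wv Y v \<and> wv X v \<noteq> 1 \<longrightarrow>
      (\<exists>w \<in> group_words I. \<forall>i \<in> I. Y i = wv X w * X i * iv (wv X w)))"
proof -
  obtain u gs C where u: "u \<in> group_words I" and gs: "set gs \<subseteq> group_words I" "gs \<noteq> []" and C: "1 \<le> C"
    and F: "\<And>X :: nat \<Rightarrow> 'a. if pairwise_commute X I then wv X u = 1 \<and> (\<forall>g \<in> set gs. wv X g = 1)
    else (\<exists>p. frame (wv X u) p C (map (wv X) gs)) \<and>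
      (\<forall>Y s. (\<forall>g \<in> set gs. wv Y g = s * wv X g * iv s) \<longrightarrow> (\<forall>i \<in> I. Y i = s * X i * iv s))"
    using frame_words[OF assms] by blast
  obtain ns where ns: "length ns = 3 * length gs" "steep (40000 * C) ns" using steep_ex by blast
  define v where "v = wzig u ns (triples gs)"
  have v: "v \<in> group_words I" unfolding v_def by (rule group_words_zig) (use u gs in auto)
  have wv: "wv X v = zig (wv X u) ns (triples (map (wv X) gs))" for X :: "nat \<Rightarrow> 'a"
    by (simp add: v_def map_triples)
  have fr: "\<exists>p. frame (wv X u) p C (triples (map (wv X) gs))" if "\<not> pairwise_commute X I" for X :: "nat \<Rightarrow> 'a"
    using F[of X] that by (auto simp: frame_def)
  have iff: "wv X v = 1 \<longleftrightarrow> pairwise_commute X I" for X :: "nat \<Rightarrow> 'a"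
  proof
    assume "pairwise_commute X I"
    then show "wv X v = 1" using F[of X] by (simp add: wv zig_one)
  next
    assume 1: "wv X v = 1"
    show "pairwise_commute X I"
    proof (rule ccontr)
      assume "\<not> pairwise_commute X I"
      then obtain p where "frame (wv X u) p C (triples (map (wv X) gs))" using fr by blast
      then have "wv X v \<noteq> 1" unfolding wv using C ns gs by (intro zig_ne_one) auto
      then show False using 1 by simp
    qed
  qed
  have "\<exists>w \<in> group_words I. \<forall>i \<in> I. Y i = wv X w * X i * iv (wv X w)"
    if "wv X v = wv Y v" "wv X v \<noteq> 1" for X Y :: "nat \<Rightarrow> 'a"
  proof -
    have nc: "\<not> pairwise_commute X I" "\<not> pairwise_commute Y I" using iff[of X] iff[of Y] that by metis+
    obtain p q where pq: "frame (wv X u) p C (triples (map (wv X) gs))" "frame (wv Y u) q C (triples (map (wv Y) gs))"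
      using fr[OF nc(1)] fr[OF nc(2)] by blast
    have "\<exists>i j s. s = zig (wv X u) ns (triples (map (wv X) gs)) ^ i * iv (zig (wv X u) ns (triples (map (wv X) gs))) ^ j \<and>
      map (wv Y) gs = map (\<lambda>g. s * g * iv s) (map (wv X) gs)"
      by (rule zig_rigid[OF C _ ns(2) _ _ _ pq]) (use ns gs that wv[of X] wv[of Y] in simp_all)
    then obtain i j s where s: "s = wv X v ^ i * iv (wv X v) ^ j"
      "map (wv Y) gs = map (\<lambda>g. s * g * iv s) (map (wv X) gs)" unfolding wv by blast
    have "s = wv X (wpow v i @ wpow (winv v) j)" using s by simp
    moreover have "\<forall>i \<in> I. Y i = s * X i * iv s"
      using F[of X] nc(1) s(2) by (simp add: comp_def)
    moreover have "wpow v i @ wpow (winv v) j \<in> group_words I" using v by simp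
    ultimately show ?thesis by blast
  qed
  then show ?thesis using v iff by blast
qed

section \<open>Commuting elements generate a cyclic group\<close>

text \<open>On the common axis one of \<open>r\<close> and its inverse translates against \<open>h\<close>: a step of Euclid's algorithm.\<close>

lemma commute_reduce_tlen:
  assumes c: "commute r h" and r: "r \<noteq> 1" and le: "tlen r \<le> tlen h"
  shows "tlen (iv r * h) < tlen h \<or> tlen (r * h) < tlen h"
proof -
  obtain q where q: "disp r q = tlen r" using axis_point by blast
  have hq: "disp h q = tlen h" using commute_axis[of h r q] c r q by (simp add: commute_sym)
  have r1: "1 \<le> tlen r" using tlen_pos[OF r] .
  have d1: "dst q (r * q) = tlen r" "dst q (h * q) = tlen h" using q hq by (simp_all add: disp_def)
  have d2: "dst (iv r * q) q = tlen r" using disp_iv[of r q] q by (simp add: disp_def dst_sym)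
  have d3: "dst (iv r * q) (r * q) = 2 * tlen r"
    using dst_left[of r "iv r * q" "r * q"] disp_power_axis[OF q, of 2]
    by (simp add: disp_def power2_eq_square mult.assoc)
  have rh: "r * (h * q) = h * (r * q)"
    using c by (simp add: commute_def flip: mult.assoc)
  have d4: "dst (h * q) (r * (h * q)) = tlen r" unfolding rh using d1 by simp
  have d5: "dst (r * q) (r * (h * q)) = tlen h" using d1 by simp
  have d6: "dst q (r * (h * q)) = dst (iv r * q) (h * q)" using dst_left[of r "iv r * q" "h * q"] by simp
  have d7: "dst q (iv r * (h * q)) = dst (r * q) (h * q)" using dst_left[of "iv r" "r * q" "h * q"] by simp
  have m: "tlen h + tlen r \<le> dst (iv r * q) (h * q) \<or> tlen h + tlen r \<le> dst (r * q) (h * q)"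
    using dst_four[of q "h * q" "iv r * q" "r * q"] d1 d2 d3 dst_sym[of q "iv r * q"]
      dst_sym[of "h * q" "iv r * q"] dst_sym[of "h * q" "r * q"] by linarith
  have t1: "tlen (iv r * h) \<le> dst (r * q) (h * q)"
    using tlen_le_disp[of "iv r * h" q] d7 by (simp add: disp_def mult.assoc)
  have t2: "tlen (r * h) \<le> dst (iv r * q) (h * q)"
    using tlen_le_disp[of "r * h" q] d6 by (simp add: disp_def mult.assoc)
  have a: "dst (iv r * q) (h * q) + dst (r * q) (h * q) \<le> 2 * tlen h"
    using dst_four[of q "r * (h * q)" "r * q" "h * q"] d1 d4 d5 d6 le
      dst_sym[of "r * (h * q)" "h * q"] dst_sym[of "r * (h * q)" "r * q"] by linarith
  show ?thesis using m a t1 t2 r1 by linarith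
qed

lemma commuting_set_cyclic:
  fixes S :: "'a::tree_group set"
  assumes one: "1 \<in> S" and mul: "\<And>x y. x \<in> S \<Longrightarrow> y \<in> S \<Longrightarrow> x * y \<in> S" and inv: "\<And>x. x \<in> S \<Longrightarrow> iv x \<in> S"
    and com: "\<And>x y. x \<in> S \<Longrightarrow> y \<in> S \<Longrightarrow> commute x y"
  shows "\<exists>r \<in> S. \<forall>g \<in> S. \<exists>i j. g = r ^ i * iv r ^ j"
proof (cases "S = {1}")
  case True
  then show ?thesis by auto
next
  case False
  then obtain x0 where x0: "x0 \<in> S \<and> x0 \<noteq> 1" using one by auto
  obtain r where "r \<in> S \<and> r \<noteq> 1" "\<And>x. x \<in> S \<and> x \<noteq> 1 \<Longrightarrow> tlen r \<le> tlen x"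
    by (rule ex_least_int[of "\<lambda>x. x \<in> S \<and> x \<noteq> 1" x0 tlen]) (use x0 in simp_all)
  then have r: "r \<in> S" "r \<noteq> 1" "\<And>x. x \<in> S \<Longrightarrow> x \<noteq> 1 \<Longrightarrow> tlen r \<le> tlen x" by simp_all
  have "\<exists>i j. g = r ^ i * iv r ^ j" if g: "g \<in> S" for g
  proof -
    define P where "P h \<longleftrightarrow> (\<exists>i j. g = r ^ i * iv r ^ j * h)" for h
    have "P g" unfolding P_def by (intro exI[of _ 0]) simp
    then obtain h where h: "P h" "\<And>k. P k \<Longrightarrow> tlen h \<le> tlen k"
      by (rule ex_least_int[of P g tlen]) simp_all
    obtain i j where ij: "g = r ^ i * iv r ^ j * h" using h(1) by (auto simp: P_def)
    have pw: "x \<in> S \<Longrightarrow> x ^ n \<in> S" for x n by (induction n) (use one mul in auto)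
    have "h = iv (r ^ i * iv r ^ j) * g" by (simp add: ij mult.assoc)
    moreover have "\<dots> \<in> S" by (intro mul inv pw r(1) g)
    ultimately have hS: "h \<in> S" by simp
    have "P (iv r * h)"
      unfolding P_def
    proof (intro exI)
      have "r * iv r ^ j = iv r ^ j * r"
        using commute_power[of r "iv r" j] by (simp add: commute_def)
      then have "r * (iv r ^ j * z) = iv r ^ j * (r * z)" for z by (simp flip: mult.assoc)
      then show "g = r ^ Suc i * iv r ^ j * (iv r * h)"
        by (simp add: ij mult.assoc power_Suc2 del: power_Suc)
    qed
    moreover have "P (r * h)"
      unfolding P_def
      by (intro exI[of _ i] exI[of _ "Suc j"]) (simp add: ij mult.assoc power_Suc2 del: power_Suc)
    ultimately have "\<not> tlen (iv r * h) < tlen h" "\<not> tlen (r * h) < tlen h" using h(2) by (simp_all add: not_less)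
    then have "h = 1"
      using commute_reduce_tlen[of r h] com[OF r(1) hS] r(2) r(3)[OF hS] by blast
    then show ?thesis using ij by auto
  qed
  then show ?thesis using r(1) by blast
qed

section \<open>Reduced words form a tree group\<close>

text \<open>All free groups \<open>free_group A\<close> with letters in \<open>nat\<close> are subgroups of this one type, on which the type class applies.\<close>

typedef free_word = "{w :: nat group_word. reduced w}"
  by (rule exI[of _ "[]"]) simp

lemma reduced_Rep [simp]: "reduced (Rep_free_word w)"
  using Rep_free_word by simp

lemma Rep_Abs [simp]: "reduced w \<Longrightarrow> Rep_free_word (Abs_free_word w) = w"
  by (simp add: Abs_free_word_inverse)

lemma reduced_append:
  "reduced (u @ v) \<longleftrightarrow> reduced u \<and> reduced v \<and> (u \<noteq> [] \<longrightarrow> v \<noteq> [] \<longrightarrow> hd v \<noteq> inv_letter (last u))"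
  by (auto simp: reduced_def successively_append_iff)

lemma reduced_winv:
  assumes "reduced w"
  shows "reduced (winv w)"
  using assms
proof (induction w)
  case (Cons x w)
  show ?case
  proof (cases w)
    case (Cons y ys)
    have "y \<noteq> inv_letter x" "reduced w" using Cons.prems Cons by (auto simp: reduced_Cons)
    then have "inv_letter x \<noteq> inv_letter (inv_letter y)" by auto
    then show ?thesis using Cons.IH \<open>reduced w\<close> Cons
      by (simp add: winv_def reduced_append reduced_Cons)
  qed (simp add: winv_def reduced_Cons)
qed (simp add: winv_def)

lemma length_winv [simp]: "length (winv w) = length w"
  by (simp add: winv_def)

lemma reduce_winv_left: "reduce (winv w @ w) = []"
  by (simp add: winv_def reduce_inverse_word)

text \<open>The length of the longest common prefix is the Gromov product at the empty word, and its ultrametric inequality is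
the four-point inequality.\<close>

fun lcp :: "'b list \<Rightarrow> 'b list \<Rightarrow> nat" where
  "lcp (x # xs) (y # ys) = (if x = y then Suc (lcp xs ys) else 0)"
| "lcp _ _ = 0"

lemma lcp_ultrametric: "min (lcp u w) (lcp w v) \<le> lcp u v"
proof (induction u v arbitrary: w rule: lcp.induct)
  case (1 x xs y ys)
  show ?case
  proof (cases w)
    case (Cons z zs)
    then show ?thesis using 1[of zs] by auto
  qed simp
next
  case ("2_1" v)
  then show ?case by (cases w) auto
next
  case ("2_2" v)
  then show ?case by (cases w) auto
qed

lemma lcp_sym: "lcp u v = lcp v u"
  by (induction u v rule: lcp.induct) auto

lemma lcp_take: "i \<le> length w \<Longrightarrow> lcp (take i w) w = i"
proof (induction w arbitrary: i)
  case (Cons x w)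
  then show ?case by (cases i) auto
qed simp

lemma reduce_cancel_pair: "reduce (u @ inv_letter x # x # w) = reduce (u @ w)"
  using cancel_Cons_inv_letter[OF reduced_reduce, of "inv_letter x" w]
  by (induction u) (simp_all add: reduce_Cons)

lemma length_reduce_winv:
  assumes "reduced u" "reduced v"
  shows "length (reduce (winv u @ v)) + 2 * lcp u v = length u + length v"
  using assms
proof (induction u v rule: lcp.induct)
  case (1 x xs y ys)
  show ?case
  proof (cases "x = y")
    case True
    have "reduce (winv (x # xs) @ y # ys) = reduce (winv xs @ ys)"
      using reduce_cancel_pair[of "winv xs" x ys] True by (simp add: winv_def)
    then show ?thesis using 1 True by (auto simp: reduced_Cons)
  next
    case False
    then have "inv_letter (inv_letter x) \<noteq> y" by simp
    then have "reduced (winv (x # xs) @ y # ys)"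
      using reduced_winv[OF "1.prems"(1)] "1.prems"(2) by (auto simp: reduced_append reduced_Cons winv_def)
    then show ?thesis using False by (simp add: reduce_id)
  qed
next
  case ("2_1" v)
  then show ?case by (simp add: winv_def reduce_id)
next
  case ("2_2" v)
  then show ?case using reduced_winv[of v] by (simp add: reduce_id)
qed

lemma length_reduce_parity: "even (length (reduce w) + length w)"
proof (induction w)
  case (Cons x w)
  have "odd (length (cancel_Cons x v) + length v)" for v by (cases v) auto
  from this[of "reduce w"] show ?case using Cons by (auto simp: reduce_Cons)
qed simp

lemma reduced_take: "reduced w \<Longrightarrow> reduced (take i w)"
  by (metis append_take_drop_id reduced_append)

instantiation free_word :: monoid_mult
begin

definition one_free_word :: free_word where "one_free_word = Abs_free_word []"
definition times_free_word :: "free_word \<Rightarrow> free_word \<Rightarrow> free_word" where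
  "times_free_word u v = Abs_free_word (reduce (Rep_free_word u @ Rep_free_word v))"

lemma Rep_one: "Rep_free_word 1 = []"
  by (simp add: one_free_word_def)

lemma Rep_mult: "Rep_free_word (u * v) = reduce (Rep_free_word u @ Rep_free_word v)"
  by (simp add: times_free_word_def reduced_reduce)

instance
proof
  fix a b c :: free_word
  show "a * b * c = a * (b * c)"
    by (rule Rep_free_word_inject[THEN iffD1])
      (simp add: Rep_mult reduce_reduce_append_left reduce_reduce_append_right)
  show "1 * a = a" "a * 1 = a"
    by (rule Rep_free_word_inject[THEN iffD1], simp add: Rep_mult Rep_one reduce_id)+
qed

end

lemma Rep_power_cyclically_reduced:
  assumes "reduced (Rep_free_word c @ Rep_free_word c)"
  shows "Rep_free_word (c ^ n) = concat (replicate n (Rep_free_word c))"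
proof -
  let ?w = "Rep_free_word c"
  have red: "reduced (concat (replicate n ?w))" for n
  proof (induction n)
    case (Suc n)
    have "concat (replicate n ?w) \<noteq> [] \<Longrightarrow> hd (concat (replicate n ?w)) = hd ?w"
      by (cases n) auto
    then show ?case using Suc assms by (auto simp: reduced_append)
  qed simp
  show ?thesis
  proof (induction n)
    case (Suc n)
    then show ?case using red[of "Suc n"] by (simp add: Rep_mult reduce_id)
  qed (simp add: Rep_one)
qed

instantiation free_word :: tree_group
begin

definition iv_free_word :: "free_word \<Rightarrow> free_word" where
  "iv_free_word u = Abs_free_word (winv (Rep_free_word u))"
definition len_free_word :: "free_word \<Rightarrow> int" where
  "len_free_word u = int (length (Rep_free_word u))"

lemma Rep_iv: "Rep_free_word (iv u) = winv (Rep_free_word u)"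
  by (simp add: iv_free_word_def reduced_winv)

lemma len_iv_mult: "len (iv u * v) = len u + len v - 2 * int (lcp (Rep_free_word u) (Rep_free_word v))"
  using length_reduce_winv[of "Rep_free_word u" "Rep_free_word v"]
  by (simp add: len_free_word_def Rep_mult Rep_iv)

lemma free_word_group:
  fixes x y :: free_word
  shows "iv x * x = 1" "x * iv x = 1" "iv x * (x * y) = y" "x * (iv x * y) = y" "iv (x * y) = iv y * iv x"
proof -
  show il: "iv x * x = 1" for x :: free_word
    by (rule Rep_free_word_inject[THEN iffD1]) (simp add: Rep_mult Rep_iv Rep_one reduce_winv_left)
  show c: "iv x * (x * y) = y" for x y :: free_word
    using il[of x] by (simp flip: mult.assoc)
  have ii: "iv (iv x) = x" for x :: free_word
    using c[of "iv x" x] il[of x] by simp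
  show ir: "x * iv x = 1" for x :: free_word using il[of "iv x"] ii by simp
  show c2: "x * (iv x * y) = y" for x y :: free_word using c[of "iv x" y] ii by simp
  have "iv (x * y) * (x * y * (iv y * iv x)) = iv (x * y)"
    by (simp add: mult.assoc c2 ir)
  then show "iv (x * y) = iv y * iv x" by (simp only: c)
qed

text \<open>A shortest conjugate is cyclically reduced, for otherwise conjugation by its first letter would shorten it. Powers of a
cyclically reduced word are concatenations, so such a conjugator is a point on the axis.\<close>

lemma minimal_conjugate_reduced:
  fixes c :: free_word
  assumes "\<And>a. length (Rep_free_word c) \<le> length (Rep_free_word (iv a * c * a))"
  shows "reduced (Rep_free_word c @ Rep_free_word c)"
proof (rule ccontr)
  define w where "w = Rep_free_word c"
  assume "\<not> reduced (Rep_free_word c @ Rep_free_word c)"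
  then have w: "w \<noteq> []" "hd w = inv_letter (last w)" by (auto simp: reduced_append w_def)
  define a where "a = hd w"
  have "inv_letter a \<noteq> a" by (cases a) auto
  then have "tl w \<noteq> []" using w by (cases w) (auto simp: a_def)
  then obtain m b where wm: "w = a # m @ [b]" using w(1) by (metis a_def append_butlast_last_id list.collapse)
  have b: "b = inv_letter a" using w(2) wm by simp
  have m: "reduced m" using reduced_Rep[of c] by (simp add: w_def[symmetric] wm reduced_append reduced_Cons)
  define A where "A = Abs_free_word [a]"
  have A: "Rep_free_word A = [a]" by (simp add: A_def reduced_Cons)
  have "Rep_free_word (iv A * c * A) = reduce (inv_letter a # a # m @ [inv_letter a, a])"
    using reduce_reduce_append_left[of "winv [a] @ w" "[a]"]
    by (simp add: Rep_mult Rep_iv A wm b winv_def w_def[symmetric])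
  also have "\<dots> = m"
    using reduce_cancel_pair[of "[]" a "m @ [inv_letter a, a]"] reduce_cancel_pair[of m a "[]"] m
    by (simp add: reduce_id)
  finally have "Rep_free_word (iv A * c * A) = m" .
  then show False using assms[of A] by (simp add: w_def[symmetric] wm)
qed

instance
proof
  fix x y z w :: free_word
  show "iv x * x = 1" by (rule free_word_group)
  show "len x = 0 \<longleftrightarrow> x = 1"
    by (simp add: len_free_word_def Rep_one flip: Rep_free_word_inject)
  show "len (iv x) = len x"
    by (simp add: len_free_word_def Rep_iv)
  \<comment> \<open>the case where the fourth point is the identity; the general case follows by translation\<close>
  have four: "len (iv x * y) + len z \<le> max (len (iv x * z) + len y) (len x + len (iv y * z))" for x y z :: free_word
    using lcp_ultrametric[of "Rep_free_word x" "Rep_free_word z" "Rep_free_word y"]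
      lcp_sym[of "Rep_free_word z" "Rep_free_word y"]
    unfolding len_iv_mult by (simp add: min_def max_def split: if_splits)
  have tr: "iv (iv w * x) * (iv w * y) = iv x * y" for x y w :: free_word
  proof -
    have "iv (iv w) = w" by (metis free_word_group(3) free_word_group(1) mult_1_right)
    then show ?thesis by (simp add: free_word_group mult.assoc)
  qed
  show "len (iv x * y) + len (iv z * w) \<le>
          max (len (iv x * z) + len (iv y * w)) (len (iv x * w) + len (iv y * z))"
  proof -
    have sym: "len (iv a * b) = len (iv b * a)" for a b :: free_word
      by (simp add: len_iv_mult lcp_sym)
    show ?thesis
      using four[of "iv w * x" "iv w * y" "iv w * z"] unfolding tr
      by (simp add: sym[of w])
  qed
  show "\<exists>y. len y = i \<and> len (iv y * x) = len x - i" if "0 \<le> i" "i \<le> len x" for i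
  proof -
    define y where "y = Abs_free_word (take (nat i) (Rep_free_word x))"
    have y: "Rep_free_word y = take (nat i) (Rep_free_word x)"
      by (simp add: y_def reduced_take)
    have "len y = i" using that by (simp add: len_free_word_def y)
    moreover have "lcp (Rep_free_word y) (Rep_free_word x) = nat i"
      unfolding y using that by (intro lcp_take) (simp add: len_free_word_def)
    ultimately show ?thesis using that by (intro exI[of _ y]) (simp add: len_iv_mult)
  qed
  show "even (len x + len y + len (x * y))"
    using length_reduce_parity[of "Rep_free_word x @ Rep_free_word y"]
    by (simp add: len_free_word_def Rep_mult) 
  show "\<exists>q. \<forall>n. len (iv q * x ^ n * q) = int n * len (iv q * x * q)"
  proof -
    obtain q where q: "\<And>p. length (Rep_free_word (iv q * x * q)) \<le> length (Rep_free_word (iv p * x * p))"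
      using ex_has_least_nat[of "\<lambda>_. True" 1 "\<lambda>q. length (Rep_free_word (iv q * x * q))"] by auto
    define c where "c = iv q * x * q"
    have "reduced (Rep_free_word c @ Rep_free_word c)"
    proof (rule minimal_conjugate_reduced)
      fix a
      show "length (Rep_free_word c) \<le> length (Rep_free_word (iv a * c * a))"
        using q[of "q * a"] by (simp add: c_def free_word_group mult.assoc)
    qed
    then have len: "len (c ^ n) = int n * len c" for n
      using Rep_power_cyclically_reduced[of c n] by (simp add: len_free_word_def length_concat sum_list_replicate)
    have "iv q * x ^ n * q = c ^ n" for n
    proof (induction n)
      case (Suc n)
      have "c ^ Suc n = c * (iv q * x ^ n * q)" using Suc by simp
      then show ?case by (simp add: c_def free_word_group mult.assoc)
    qed (simp add: free_word_group)
    then show ?thesis using len by (intro exI[of _ q]) (simp add: c_def)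
  qed
qed

end

section \<open>Free groups on a set of letters\<close>

lemma carrier_free_group: "w \<in> carrier (free_group A) \<longleftrightarrow> w \<in> group_words A \<and> reduced w"
  by (simp add: free_group_def)

lemma inv_free_group:
  assumes "u \<in> carrier (free_group A)"
  shows "inv\<^bsub>free_group A\<^esub> u = winv u"
proof (rule group.inv_equality[OF group_free_group])
  show "winv u \<in> carrier (free_group A)"
    using assms by (simp add: carrier_free_group reduced_winv)
  show "winv u \<otimes>\<^bsub>free_group A\<^esub> u = \<one>\<^bsub>free_group A\<^esub>"
    by (simp add: free_group_def reduce_winv_left)
qed (rule assms)

lemma Abs_mult:
  assumes "reduced u" "reduced v"
  shows "Abs_free_word (u \<otimes>\<^bsub>free_group A\<^esub> v) = Abs_free_word u * Abs_free_word v"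
  using assms by (simp add: free_group_def times_free_word_def)

lemma Abs_inv:
  assumes "u \<in> carrier (free_group A)"
  shows "Abs_free_word (inv\<^bsub>free_group A\<^esub> u) = iv (Abs_free_word u)"
  using assms by (simp add: inv_free_group iv_free_word_def carrier_free_group)

lemma word_value_wv:
  assumes X: "X \<in> I \<rightarrow> carrier (free_group A)" and v: "v \<in> group_words I"
  shows "word_value (free_group A) X v \<in> carrier (free_group A) \<and>
    Abs_free_word (word_value (free_group A) X v) = wv (Abs_free_word \<circ> X) v"
  using v
proof (induction v)
  case Nil
  then show ?case by (simp add: one_free_word_def free_group_def)
next
  case (Cons l v)
  interpret F: group "free_group A" by (rule group_free_group)
  obtain i b where l: "l = (i, b)" by fastforce
  have i: "i \<in> I" "v \<in> group_words I" using Cons.prems by (simp_all add: l)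
  define x where "x = (if b then X i else inv\<^bsub>free_group A\<^esub> (X i))"
  have x: "x \<in> carrier (free_group A)" "Abs_free_word x = (if b then (Abs_free_word \<circ> X) i else iv ((Abs_free_word \<circ> X) i))"
    using X i by (auto simp: x_def Abs_inv Pi_def)
  have v: "word_value (free_group A) X v \<in> carrier (free_group A)"
    "Abs_free_word (word_value (free_group A) X v) = wv (Abs_free_word \<circ> X) v" using Cons.IH[OF i(2)] by blast+
  have e: "word_value (free_group A) X (l # v) = x \<otimes>\<^bsub>free_group A\<^esub> word_value (free_group A) X v"
    by (simp add: l x_def)
  have "Abs_free_word (x \<otimes>\<^bsub>free_group A\<^esub> word_value (free_group A) X v)
      = Abs_free_word x * Abs_free_word (word_value (free_group A) X v)"
    by (rule Abs_mult) (use x(1) v(1) in \<open>simp_all add: carrier_free_group\<close>)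
  then show ?case
    unfolding e x(2) v(2) using F.m_closed[OF x(1) v(1)] by (simp only: l wv.simps)
qed

lemma Abs_eq_iff:
  "u \<in> carrier (free_group A) \<Longrightarrow> v \<in> carrier (free_group A) \<Longrightarrow> Abs_free_word u = Abs_free_word v \<longleftrightarrow> u = v"
  by (simp add: carrier_free_group Abs_free_word_inject)

lemma generate_commute:
  assumes "w \<in> generate (free_group A) S" "S \<subseteq> carrier (free_group A)"
    and "\<And>s. s \<in> S \<Longrightarrow> commute c (Abs_free_word s)"
  shows "commute c (Abs_free_word w)"
  using assms(1)
proof induction
  case one
  then show ?case by (simp add: free_group_def flip: one_free_word_def)
next
  case (incl h)
  then show ?case by (rule assms(3))
next
  case (inv h)
  then show ?case using assms(2,3) by (auto simp: Abs_inv subsetD)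
next
  case (eng u v)
  have "u \<in> carrier (free_group A)" "v \<in> carrier (free_group A)"
    using group.generate_in_carrier[OF group_free_group assms(2)] eng by auto
  then show ?case using eng by (simp add: Abs_mult carrier_free_group commute_mult)
qed

lemma Abs_pow:
  assumes "r \<in> carrier (free_group A)"
  shows "Abs_free_word (r [^]\<^bsub>free_group A\<^esub> (n :: nat)) = Abs_free_word r ^ n"
proof (induction n)
  case 0
  show ?case by (simp add: free_group_def one_free_word_def)
next
  case (Suc n)
  interpret F: group "free_group A" by (rule group_free_group)
  show ?case using Suc assms F.nat_pow_closed[OF assms, of n]
    by (simp add: Abs_mult carrier_free_group power_Suc2 del: power_Suc)
qed

text \<open>If the \<open>X i\<close> commute pairwise, then so do all elements of the subgroup that they generate, and \<open>commuting_set_cyclic\<close> provides a generator inside it.\<close>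

lemma cyclic_iff_pairwise_commute:
  assumes X: "X \<in> I \<rightarrow> carrier (free_group A)"
  shows "cyclic_group (subgroup_generated (free_group A) (X ` I)) \<longleftrightarrow> pairwise_commute (Abs_free_word \<circ> X) I"
proof
  interpret F: group "free_group A" by (rule group_free_group)
  have S: "X ` I \<subseteq> carrier (free_group A)" using X by auto
  show "pairwise_commute (Abs_free_word \<circ> X) I" if "cyclic_group (subgroup_generated (free_group A) (X ` I))"
  proof -
    interpret H: group "subgroup_generated (free_group A) (X ` I)" by simp
    interpret H: comm_group "subgroup_generated (free_group A) (X ` I)"
      using H.cyclic_imp_abelian_group that by blast
    have "commute (Abs_free_word (X i)) (Abs_free_word (X j))" if "i \<in> I" "j \<in> I" for i j
    proof -
      have "X i \<in> carrier (subgroup_generated (free_group A) (X ` I))"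
        "X j \<in> carrier (subgroup_generated (free_group A) (X ` I))"
        using that S by (auto simp: carrier_subgroup_generated intro!: generate.incl)
      from H.m_comm[OF this] have "X i \<otimes>\<^bsub>free_group A\<^esub> X j = X j \<otimes>\<^bsub>free_group A\<^esub> X i" by simp
      moreover have "reduced (X i)" "reduced (X j)" using S that by (auto simp: carrier_free_group)
      ultimately show ?thesis unfolding commute_def by (metis Abs_mult)
    qed
    then show ?thesis by (simp add: pairwise_commute_def)
  qed
  show "cyclic_group (subgroup_generated (free_group A) (X ` I))" if c: "pairwise_commute (Abs_free_word \<circ> X) I"
  proof -
    define H where "H = generate (free_group A) (X ` I)"
    have HC: "w \<in> carrier (free_group A)" if "w \<in> H" for w
      using F.generate_in_carrier[OF S] that by (simp add: H_def)
    have "\<exists>r \<in> Abs_free_word ` H. \<forall>g \<in> Abs_free_word ` H. \<exists>i j. g = r ^ i * iv r ^ j"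
    proof (rule commuting_set_cyclic)
      show "1 \<in> Abs_free_word ` H"
        unfolding H_def one_free_word_def using generate.one[of "free_group A" "X ` I"]
        by (auto simp: free_group_def image_iff intro!: bexI[of _ "[]"])
      show "x * y \<in> Abs_free_word ` H" if xy: "x \<in> Abs_free_word ` H" "y \<in> Abs_free_word ` H" for x y
      proof -
        obtain u v where uv: "x = Abs_free_word u" "y = Abs_free_word v" "u \<in> H" "v \<in> H" using xy by auto
        have "x * y = Abs_free_word (u \<otimes>\<^bsub>free_group A\<^esub> v)"
          using uv HC by (simp add: Abs_mult carrier_free_group)
        moreover have "u \<otimes>\<^bsub>free_group A\<^esub> v \<in> H" using uv generate.eng unfolding H_def by metis
        ultimately show ?thesis by blast
      qed
      show "iv x \<in> Abs_free_word ` H" if xy: "x \<in> Abs_free_word ` H" for x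
      proof -
        obtain u where u: "x = Abs_free_word u" "u \<in> H" using xy by auto
        have "iv x = Abs_free_word (inv\<^bsub>free_group A\<^esub> u)" using u HC Abs_inv by metis
        moreover have "inv\<^bsub>free_group A\<^esub> u \<in> H"
          using u F.generate_m_inv_closed[OF S] unfolding H_def by blast
        ultimately show ?thesis by blast
      qed
      have 1: "commute (Abs_free_word s) (Abs_free_word w)" if "s \<in> X ` I" "w \<in> H" for s w
        using that c generate_commute[of w A "X ` I" "Abs_free_word s"] S
        by (auto simp: H_def pairwise_commute_def)
      show "commute x y" if xy: "x \<in> Abs_free_word ` H" "y \<in> Abs_free_word ` H" for x y
      proof -
        obtain u v where uv: "x = Abs_free_word u" "y = Abs_free_word v" "u \<in> H" "v \<in> H" using xy by auto
        show ?thesis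
          using generate_commute[of v A "X ` I" "Abs_free_word u"] S uv 1 by (auto simp: H_def commute_sym)
      qed
    qed
    then obtain r where r: "r \<in> H" "\<And>g. g \<in> H \<Longrightarrow> \<exists>i j. Abs_free_word g = Abs_free_word r ^ i * iv (Abs_free_word r) ^ j"
      by auto
    have rc: "r \<in> carrier (free_group A)" using r HC by simp
    have "H \<subseteq> generate (free_group A) {r}"
    proof
      fix g assume g: "g \<in> H"
      obtain i j where ij: "Abs_free_word g = Abs_free_word r ^ i * iv (Abs_free_word r) ^ j" using r(2)[OF g] by blast
      define h where "h = r [^]\<^bsub>free_group A\<^esub> i \<otimes>\<^bsub>free_group A\<^esub> inv\<^bsub>free_group A\<^esub> (r [^]\<^bsub>free_group A\<^esub> j)"
      have hc: "h \<in> carrier (free_group A)" using rc by (simp add: h_def)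
      have "Abs_free_word h = Abs_free_word r ^ i * iv (Abs_free_word r ^ j)"
      proof -
        have "r [^]\<^bsub>free_group A\<^esub> i \<in> carrier (free_group A)" "r [^]\<^bsub>free_group A\<^esub> j \<in> carrier (free_group A)"
          "inv\<^bsub>free_group A\<^esub> (r [^]\<^bsub>free_group A\<^esub> j) \<in> carrier (free_group A)"
          using rc by simp_all
        then show ?thesis unfolding h_def
          using Abs_mult Abs_inv Abs_pow[OF rc] carrier_free_group by metis
      qed
      then have "g = h" using ij Abs_eq_iff[OF HC[OF g] hc] by (simp add: iv_power)
      then have "g = r [^]\<^bsub>free_group A\<^esub> (int i - int j)"
        using rc by (simp add: h_def F.int_pow_diff int_pow_int)
      then show "g \<in> generate (free_group A) {r}" using F.generate_pow[OF rc] by blast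
    qed
    moreover have "generate (free_group A) {r} \<subseteq> H"
      unfolding H_def using r(1) F.generate_subgroup_incl[OF _ F.generate_is_subgroup[OF S]] by (simp add: H_def)
    ultimately have "H = generate (free_group A) {r}" by blast
    then have "subgroup_generated (free_group A) (X ` I) = subgroup_generated (free_group A) {r}"
      using S rc by (simp add: subgroup_generated_def H_def Int_absorb1)
    then show ?thesis using F.cyclic_group_generated by simp
  qed
qed

theorem mainTheorem1:
  fixes m n :: nat
  assumes "m \<ge> 2" and "n \<ge> 2"
  shows "\<exists>v. C_test_word (free_group {1..m}) n v \<and>
           (\<forall>X \<in> {1..n} \<rightarrow> carrier (free_group {1..m}).
              word_value (free_group {1..m}) X v = \<one>\<^bsub>free_group {1..m}\<^esub> \<longleftrightarrow>
              cyclic_group (subgroup_generated (free_group {1..m}) (X ` {1..n})))"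
proof -
  let ?F = "free_group {1..m}" and ?I = "{1..n}"
  interpret F: group ?F by (rule group_free_group)
  obtain v where v: "v \<in> group_words ?I"
    and one: "\<And>X :: nat \<Rightarrow> free_word. wv X v = 1 \<longleftrightarrow> pairwise_commute X ?I"
    and test: "\<And>X Y :: nat \<Rightarrow> free_word. wv X v = wv Y v \<Longrightarrow> wv X v \<noteq> 1 \<Longrightarrow>
      \<exists>w \<in> group_words ?I. \<forall>i \<in> ?I. Y i = wv X w * X i * iv (wv X w)"
    using test_word[of ?I] by blast
  have Abs_one: "Abs_free_word \<one>\<^bsub>?F\<^esub> = 1" by (simp add: free_group_def one_free_word_def)
  have val: "word_value ?F X w \<in> carrier ?F" "Abs_free_word (word_value ?F X w) = wv (Abs_free_word \<circ> X) w"
    if "X \<in> ?I \<rightarrow> carrier ?F" "w \<in> group_words ?I" for X w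
    using word_value_wv[OF that] by auto
  have val_one: "word_value ?F X v = \<one>\<^bsub>?F\<^esub> \<longleftrightarrow> wv (Abs_free_word \<circ> X) v = 1" if X: "X \<in> ?I \<rightarrow> carrier ?F" for X
    using Abs_eq_iff[OF val(1)[OF X v] F.one_closed] val(2)[OF X v] Abs_one by simp
  have "v \<noteq> []"
  proof
    assume "v = []"
    then have "pairwise_commute X ?I" for X :: "nat \<Rightarrow> free_word" using one[of X] by simp
    from this[of "\<lambda>i. Abs_free_word [(i, True)]"]
    have "commute (Abs_free_word [(1, True)]) (Abs_free_word [(2, True)])"
      using assms(2) by (simp add: pairwise_commute_def)
    then have "Rep_free_word (Abs_free_word [(1, True)] * Abs_free_word [(2, True)]) =
      Rep_free_word (Abs_free_word [(2, True)] * Abs_free_word [(1, True)])" by (simp add: commute_def)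
    then show False by (simp add: Rep_mult reduced_Cons reduce_Cons)
  qed
  moreover have "\<exists>S \<in> carrier ?F. \<forall>i \<in> ?I. Y i = S \<otimes>\<^bsub>?F\<^esub> X i \<otimes>\<^bsub>?F\<^esub> inv\<^bsub>?F\<^esub> S"
    if X: "X \<in> ?I \<rightarrow> carrier ?F" and Y: "Y \<in> ?I \<rightarrow> carrier ?F"
      and eq: "word_value ?F X v = word_value ?F Y v" "word_value ?F Y v \<noteq> \<one>\<^bsub>?F\<^esub>" for X Y
  proof -
    have "wv (Abs_free_word \<circ> X) v = wv (Abs_free_word \<circ> Y) v" "wv (Abs_free_word \<circ> X) v \<noteq> 1"
      using eq val(2)[OF X v] val(2)[OF Y v] val_one[OF X] by metis+
    then obtain w where w: "w \<in> group_words ?I"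
      "\<And>i. i \<in> ?I \<Longrightarrow> Abs_free_word (Y i) = wv (Abs_free_word \<circ> X) w * Abs_free_word (X i) * iv (wv (Abs_free_word \<circ> X) w)"
      using test[of "Abs_free_word \<circ> X" "Abs_free_word \<circ> Y"] by auto
    define S where "S = word_value ?F X w"
    have S: "S \<in> carrier ?F" "Abs_free_word S = wv (Abs_free_word \<circ> X) w"
      using val[OF X w(1)] by (simp_all add: S_def)
    have "Y i = S \<otimes>\<^bsub>?F\<^esub> X i \<otimes>\<^bsub>?F\<^esub> inv\<^bsub>?F\<^esub> S" if i: "i \<in> ?I" for i
    proof -
      have c: "X i \<in> carrier ?F" "Y i \<in> carrier ?F" using X Y i by auto
      have "Abs_free_word (S \<otimes>\<^bsub>?F\<^esub> X i \<otimes>\<^bsub>?F\<^esub> inv\<^bsub>?F\<^esub> S) = Abs_free_word S * Abs_free_word (X i) * iv (Abs_free_word S)"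
        using S(1) c F.m_closed[OF S(1) c(1)] F.inv_closed[OF S(1)]
        by (simp add: Abs_mult Abs_inv carrier_free_group[THEN iffD1])
      then have "Abs_free_word (Y i) = Abs_free_word (S \<otimes>\<^bsub>?F\<^esub> X i \<otimes>\<^bsub>?F\<^esub> inv\<^bsub>?F\<^esub> S)"
        using w(2)[OF i] S(2) by simp
      then show ?thesis using Abs_eq_iff[OF c(2), of "S \<otimes>\<^bsub>?F\<^esub> X i \<otimes>\<^bsub>?F\<^esub> inv\<^bsub>?F\<^esub> S"] c S(1)
        by (meson F.inv_closed F.m_closed)
    qed
    then show ?thesis using S(1) by blast
  qed
  ultimately have "C_test_word ?F n v" using v by (auto simp: C_test_word_def)
  moreover have "word_value ?F X v = \<one>\<^bsub>?F\<^esub> \<longleftrightarrow> cyclic_group (subgroup_generated ?F (X ` ?I))"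
    if X: "X \<in> ?I \<rightarrow> carrier ?F" for X
    using val_one[OF X] one cyclic_iff_pairwise_commute[OF X] by blast
  ultimately show ?thesis by blast
qed

end
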